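(* Let $z^\ast$ be the optimal threshold function defined recursively below. Then for every $i=1,\dots,n$ and every $x\ge0$, $W^{z^\ast}(x,c_i)=V^S(x,c_i)$; i.e. the threshold strategy $\pi^{z^\ast}$ is optimal among all admissible ratcheting-down strategies with rates in $S$.
   Context: Let $(W_t)_{t\ge0}$ be a standard Brownian motion and $X_t=x+\mu t+\sigma W_t$ with constants $\mu\in\mathbb R$, $\sigma>0$; $(\mathcal F_t)$ is the completed filtration generated by $X$. Fix $q>0$, $\Lambda>0$ and $S=\{c_0,c_1,\dots,c_n\}$ with $0=c_0<c_1<\dots<c_n=\bar c$. For $x\ge0$ and $c\in S$, $\Pi^S_{x,c}$ is the set of non-increasing, right-continuous, $(\mathcal F_t)$-adapted processes $C$ with values in $S$ and $C_t\le c$ for all $t\ge0$; $X^C_t=X_t-\int_0^tC_s\,ds$, $\tau=\inf\{t\ge0:X^C_t<0\}$, $J(x;C)=\mathbb E[\int_0^\tau e^{-qs}(C_s+\Lambda)ds]$ and $V^S(x,c)=\sup_{C\in\Pi^S_{x,c}}J(x;C)$. For $c\ge0$, $\theta_1(c)=\frac{c-\mu-\sqrt{(c-\mu)^2+2q\sigma^2}}{\sigma^2}<0$. Given a threshold function $z:\{c_1,\dots,c_n\}\to[0,\infty)$, the threshold strategy $\pi^z$ assigns to each $(x,c_i)$ a strategy $C_{x,c_i}\in\Pi^S_{x,c_i}$ recursively: for $i=0$, $C_{x,c_0}\equiv0$; for $i\ge1$ and $x\le z(c_i)$, $C_{x,c_i}=C_{x,c_{i-1}}$; for $i\ge1$ and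 $x>z(c_i)$, emit at rate $c_i$ until $\hat\tau$, the first time the controlled surplus hits $z(c_i)$, and from then on follow $C_{z(c_i),c_{i-1}}$ (restarted at time $\hat\tau$), until depletion. Set $W^z(x,c_i):=J(x;C_{x,c_i})$. The function $z^\ast$ is defined recursively: $W^{z^\ast}(x,c_0)=\frac{\Lambda}{q}(1-e^{\theta_1(0)x})$; given $z^\ast(c_1),\dots,z^\ast(c_{i-1})$ (hence $W^{z^\ast}(\cdot,c_{i-1})$), let $G_i(y)=\Big(1-\frac{q}{c_i+\Lambda}W^{z^\ast}(y,c_{i-1})\Big)e^{-\theta_1(c_i)y}$ for $y\ge0$ (a positive continuous function with $G_i(0)=1$ and $G_i(y)\to\infty$ as $y\to\infty$) and $z^\ast(c_i)=\min\big(\arg\min_{y\ge0}G_i(y)\big)$. *)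

theory Defs
  imports "HOL-Probability.Probability"
begin

definition std_BM :: "'a measure \<Rightarrow> (real \<Rightarrow> 'a \<Rightarrow> real) \<Rightarrow> bool" where
  "std_BM M W \<longleftrightarrow>
     prob_space M \<and>
     (\<forall>t. W t \<in> borel_measurable M) \<and>
     (\<forall>\<omega>\<in>space M. W 0 \<omega> = 0 \<and> continuous_on {0..} (\<lambda>t. W t \<omega>)) \<and>
     (\<forall>s t. 0 \<le> s \<longrightarrow> s < t \<longrightarrow>
        distributed M lborel (\<lambda>\<omega>. W t \<omega> - W s \<omega>)
          (\<lambda>y. ennreal (normal_density 0 (sqrt (t - s)) y))) \<and>
     (\<forall>(k::nat) (ts::nat \<Rightarrow> real). 0 \<le> ts 0 \<longrightarrow> (\<forall>j<k. ts j < ts (Suc j)) \<longrightarrow>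
        prob_space.indep_vars M (\<lambda>_. borel) (\<lambda>j \<omega>. W (ts (Suc j)) \<omega> - W (ts j) \<omega>) {..<k})"

definition theta1 :: "real \<Rightarrow> real \<Rightarrow> real \<Rightarrow> real \<Rightarrow> real" where
  "theta1 mu sig q c = (c - mu - sqrt ((c - mu)\<^sup>2 + 2 * q * sig\<^sup>2)) / sig\<^sup>2"

definition Xproc :: "(real \<Rightarrow> 'a \<Rightarrow> real) \<Rightarrow> real \<Rightarrow> real \<Rightarrow> real \<Rightarrow> real \<Rightarrow> 'a \<Rightarrow> real" where
  "Xproc W mu sig x t \<omega> = x + mu * t + sig * W t \<omega>"

definition filt :: "'a measure \<Rightarrow> (real \<Rightarrow> 'a \<Rightarrow> real) \<Rightarrow> real \<Rightarrow> real \<Rightarrow> real \<Rightarrow> real \<Rightarrow> 'a set set" where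
  "filt M W mu sig x t = sigma_sets (space M)
     ({Xproc W mu sig x s -` B \<inter> space M | s B. 0 \<le> s \<and> s \<le> t \<and> B \<in> sets borel} \<union>
      {N. N \<subseteq> space M \<and> (\<exists>A\<in>sets M. N \<subseteq> A \<and> emeasure M A = 0)})"

definition Xctrl :: "(real \<Rightarrow> 'a \<Rightarrow> real) \<Rightarrow> real \<Rightarrow> real \<Rightarrow> real \<Rightarrow> (real \<Rightarrow> 'a \<Rightarrow> real) \<Rightarrow> real \<Rightarrow> 'a \<Rightarrow> real" where
  "Xctrl W mu sig x C t \<omega> = Xproc W mu sig x t \<omega> - (LINT s:{0..t}|lborel. C s \<omega>)"

(* ruin time tau = inf{t >= 0 : X^C_t < 0}  (inf of the empty set = infinity) *)
definition ruin :: "(real \<Rightarrow> 'a \<Rightarrow> real) \<Rightarrow> real \<Rightarrow> real \<Rightarrow> real \<Rightarrow> (real \<Rightarrow> 'a \<Rightarrow> real) \<Rightarrow> 'a \<Rightarrow> ereal" where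
  "ruin W mu sig x C \<omega> = Inf {ereal t | t. 0 \<le> t \<and> Xctrl W mu sig x C t \<omega> < 0}"

definition Jval :: "'a measure \<Rightarrow> (real \<Rightarrow> 'a \<Rightarrow> real) \<Rightarrow> real \<Rightarrow> real \<Rightarrow> real \<Rightarrow> real \<Rightarrow> real \<Rightarrow> (real \<Rightarrow> 'a \<Rightarrow> real) \<Rightarrow> real" where
  "Jval M W mu sig q Lam x C = integral\<^sup>L (completion M)
     (\<lambda>\<omega>. LINT s:{s. 0 \<le> s \<and> ereal s < ruin W mu sig x C \<omega>}|lborel. exp (- q * s) * (C s \<omega> + Lam))"

definition admissible :: "'a measure \<Rightarrow> (real \<Rightarrow> 'a \<Rightarrow> real) \<Rightarrow> real \<Rightarrow> real \<Rightarrow> real set \<Rightarrow> real \<Rightarrow> real \<Rightarrow> (real \<Rightarrow> 'a \<Rightarrow> real) \<Rightarrow> bool" where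
  "admissible M W mu sig S x c C \<longleftrightarrow>
     (\<forall>\<omega>\<in>space M. \<forall>t\<ge>0. C t \<omega> \<in> S \<and> C t \<omega> \<le> c) \<and>
     (\<forall>\<omega>\<in>space M. \<forall>s t. 0 \<le> s \<longrightarrow> s \<le> t \<longrightarrow> C t \<omega> \<le> C s \<omega>) \<and>
     (\<forall>\<omega>\<in>space M. \<forall>t\<ge>0. continuous (at_right t) (\<lambda>s. C s \<omega>)) \<and>
     (\<forall>t\<ge>0. \<forall>B\<in>sets borel. C t -` B \<inter> space M \<in> filt M W mu sig x t)"

definition VS :: "'a measure \<Rightarrow> (real \<Rightarrow> 'a \<Rightarrow> real) \<Rightarrow> real \<Rightarrow> real \<Rightarrow> real \<Rightarrow> real \<Rightarrow> real set \<Rightarrow> real \<Rightarrow> real \<Rightarrow> real" where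
  "VS M W mu sig q Lam S x c = Sup {Jval M W mu sig q Lam x C | C. admissible M W mu sig S x c C}"

(* Threshold strategy, pathwise.  z i = threshold z(c_i), cs i = c_i, Y = path of
   t \<mapsto> mu t + sig W_t (increments of X).  thr z cs i x Y t = C_{x,c_i}(t).
   For x > z(c_i): rate c_i until the first time hat_tau at which the controlled surplus
   x + Y_s - c_i s hits z(c_i), afterwards C_{z(c_i),c_{i-1}} driven by the restarted
   path s \<mapsto> Y(hat_tau + s) - Y(hat_tau). *)
primrec thr :: "(nat \<Rightarrow> real) \<Rightarrow> (nat \<Rightarrow> real) \<Rightarrow> nat \<Rightarrow> real \<Rightarrow> (real \<Rightarrow> real) \<Rightarrow> real \<Rightarrow> real" where
  "thr z cs 0 x Y t = 0"
| "thr z cs (Suc i) x Y t =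
     (if x \<le> z (Suc i) then thr z cs i x Y t
      else (let H = {s. 0 \<le> s \<and> x + Y s - cs (Suc i) * s \<le> z (Suc i)} in
            if H = {} then cs (Suc i)
            else (let ht = Inf H in
                  if t < ht then cs (Suc i)
                  else thr z cs i (z (Suc i)) (\<lambda>s. Y (ht + s) - Y ht) (t - ht))))"

definition thrC :: "(real \<Rightarrow> 'a \<Rightarrow> real) \<Rightarrow> real \<Rightarrow> real \<Rightarrow> (nat \<Rightarrow> real) \<Rightarrow> (nat \<Rightarrow> real) \<Rightarrow> nat \<Rightarrow> real \<Rightarrow> real \<Rightarrow> 'a \<Rightarrow> real" where
  "thrC W mu sig z cs i x t \<omega> = thr z cs i x (\<lambda>s. mu * s + sig * W s \<omega>) t"

definition Wz :: "'a measure \<Rightarrow> (real \<Rightarrow> 'a \<Rightarrow> real) \<Rightarrow> real \<Rightarrow> real \<Rightarrow> real \<Rightarrow> real \<Rightarrow> (nat \<Rightarrow> real) \<Rightarrow> (nat \<Rightarrow> real) \<Rightarrow> real \<Rightarrow> nat \<Rightarrow> real" where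
  "Wz M W mu sig q Lam cs z x i = Jval M W mu sig q Lam x (thrC W mu sig z cs i x)"

(* G_i(y) built from a threshold function whose values z(c_1..c_{i-1}) are already fixed *)
definition Gfun :: "'a measure \<Rightarrow> (real \<Rightarrow> 'a \<Rightarrow> real) \<Rightarrow> real \<Rightarrow> real \<Rightarrow> real \<Rightarrow> real \<Rightarrow> (nat \<Rightarrow> real) \<Rightarrow> (nat \<Rightarrow> real) \<Rightarrow> nat \<Rightarrow> real \<Rightarrow> real" where
  "Gfun M W mu sig q Lam cs z i y =
     (1 - q / (cs i + Lam) * Wz M W mu sig q Lam cs z y (i - 1)) * exp (- theta1 mu sig q (cs i) * y)"

(* zs i holds z^*(c_1), ..., z^*(c_i) (other entries 0) *)
primrec zstep :: "'a measure \<Rightarrow> (real \<Rightarrow> 'a \<Rightarrow> real) \<Rightarrow> real \<Rightarrow> real \<Rightarrow> real \<Rightarrow> real \<Rightarrow> (nat \<Rightarrow> real) \<Rightarrow> nat \<Rightarrow> (nat \<Rightarrow> real)" where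
  "zstep M W mu sig q Lam cs 0 = (\<lambda>_. 0)"
| "zstep M W mu sig q Lam cs (Suc i) =
     (let z = zstep M W mu sig q Lam cs i;
          G = Gfun M W mu sig q Lam cs z (Suc i)
      in z(Suc i := (LEAST y. y \<in> {y. 0 \<le> y \<and> (\<forall>y'\<ge>0. G y \<le> G y')})))"

(* the optimal threshold function z^* (indexed by i, z^* i = z^*(c_i)) *)
definition zstar :: "'a measure \<Rightarrow> (real \<Rightarrow> 'a \<Rightarrow> real) \<Rightarrow> real \<Rightarrow> real \<Rightarrow> real \<Rightarrow> real \<Rightarrow> (nat \<Rightarrow> real) \<Rightarrow> nat \<Rightarrow> real" where
  "zstar M W mu sig q Lam cs i = zstep M W mu sig q Lam cs i i"

end

theory Submission
  imports Defs "HOL-Real_Asymp.Real_Asymp"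
begin

text \<open>Candidate value functions are built by recursion on the number of rates: below the new threshold the
  previous function is kept, above it an exact exponential solution for the new rate is pasted on.
  The function obtained is concave, continuously differentiable, and a supersolution for its own rate
  which is an exact solution wherever its slope is below \<open>1\<close>; these properties survive the
  next step and locate the minimum of \<open>G\<^sub>i\<close>.

  For the upper bound, an admissible control is frozen on a time grid. A supersolution lies below its
  tangent exact solutions, so Gaussian exponential moments give the supermartingale inequality over
  each grid step; ruin is only monitored on the grid, and the overshoot below \<open>0\<close> is negligible
  after a small upward shift of the surplus.

  For the lower bound, Fatou's lemma along grids yields
  \<open>E exp (- q T') \<le> exp (\<theta>\<^sub>1(c) (p - z)) E exp (- q T)\<close> for the first passage \<open>T'\<close> from
  \<open>p\<close> to \<open>z\<close> after a stopping time \<open>T\<close>. Summing this over the stages of the threshold strategy shows that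
  its value is at least the candidate; the upper bound gives equality.\<close>

subsection \<open>Supersolutions of the one-rate equation\<close>

text \<open>As stated the thresholds are circular: \<open>zstar\<close> minimises functions built
  from expected payoffs of strategies. Candidates and thresholds are therefore chosen by analysis
  alone (\<open>opt_value\<close>, \<open>opt_threshold\<close>) and identified with
  \<open>Wz\<close> and \<open>zstar\<close> only at the end, level by level. The recursion closes
  because of \<open>pde_add_rate\<close>: passing from rate c to c' adds (c' - c)(1 - f') to the
  operator. Where f' \<ge> 1 a supersolution stays a supersolution; where f' < 1 an exact solution
  becomes a strict subsolution, and this forces a positive threshold into the region f' \<ge> 1.
  Hence \<open>profile\<close> asks for equality, and not only for an inequality, below slope 1. The
  obstacle in the upper bound is that between grid times the surplus can fall below 0, where the
  candidates are negative. They decrease at most exponentially there, so the loss per cell is a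
  Gaussian exponential moment; exponent m, mesh 1/m^2 and a fixed shift make it of order exp (- m
  eta), against about m^2 cells per unit of time.\<close>

lemma nonincreasing_except_finite:
  fixes f :: "real \<Rightarrow> real"
  assumes "a \<le> b" "continuous_on {a..b} f" "finite F"
    and deriv: "\<And>x. a < x \<Longrightarrow> x < b \<Longrightarrow> x \<notin> F \<Longrightarrow> (f has_real_derivative f' x) (at x)"
    and nonpos: "\<And>x. a < x \<Longrightarrow> x < b \<Longrightarrow> x \<notin> F \<Longrightarrow> f' x \<le> 0"
  shows "f b \<le> f a"
proof -
  \<comment> \<open>\<open>g\<close> is the derivative with value 0 at the exceptional points and at
    the ends, hence nonpositive throughout. The exceptions will be the pasting points of the
    candidates, where the second derivative may jump and continuity carries the estimate
    across.\<close>
  define g where "g x = (if x \<in> F \<or> x \<le> a \<or> b \<le> x then 0 else f' x)" for x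
  have "(g has_integral (f b - f a)) {a..b}"
    by (rule fundamental_theorem_of_calculus_interior_strong[OF \<open>finite F\<close> \<open>a \<le> b\<close>])
      (use assms deriv in \<open>auto simp: g_def has_real_derivative_iff_has_vector_derivative\<close>)
  moreover have "\<And>x. x \<in> {a..b} \<Longrightarrow> g x \<le> 0"
    using nonpos by (auto simp: g_def)
  ultimately show ?thesis
    using has_integral_le[of g "f b - f a" "{a..b}" "\<lambda>_. 0" 0] by auto
qed

text \<open>These are the points of mesh 1/g just below \<open>r\<close>. One limit serves dyadic
  times, fractions of a time interval and rounded stopping times, hence a real mesh parameter and
  the filter \<open>at_top\<close>.\<close>

lemma floor_quotient_tendsto:
  fixes r :: real
  shows "((\<lambda>g. of_int \<lfloor>g * r\<rfloor> / g) \<longlongrightarrow> r) at_top"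
proof (rule tendsto_sandwich)
  show "\<forall>\<^sub>F g in at_top. r - 1 / g \<le> of_int \<lfloor>g * r\<rfloor> / g"
    using eventually_gt_at_top[of 0]
  proof eventually_elim
    case (elim g)
    have "g * r - 1 \<le> of_int \<lfloor>g * r\<rfloor>" by linarith
    then have "(g * r - 1) / g \<le> of_int \<lfloor>g * r\<rfloor> / g" using elim by (intro divide_right_mono) auto
    then show ?case using elim by (simp add: diff_divide_distrib)
  qed
  show "\<forall>\<^sub>F g in at_top. of_int \<lfloor>g * r\<rfloor> / g \<le> r"
    using eventually_gt_at_top[of 0]
  proof eventually_elim
    case (elim g)
    have "of_int \<lfloor>g * r\<rfloor> \<le> g * r" by linarith
    then show ?case using elim by (simp add: pos_divide_le_eq mult.commute)
  qed
  show "((\<lambda>g. r - 1 / g) \<longlongrightarrow> r) at_top" by real_asymp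
qed auto

lemma ceiling_quotient_tendsto:
  fixes r :: real
  shows "((\<lambda>g. of_int \<lceil>g * r\<rceil> / g) \<longlongrightarrow> r) at_top"
  using tendsto_minus[OF floor_quotient_tendsto[of "- r"]] by (simp add: ceiling_def)

text \<open>Smooth fit: agreement of value and slope at the pasting point suffices, whatever the
  curvatures on the two sides.\<close>

lemma DERIV_if_glue:
  fixes f g :: "real \<Rightarrow> real"
  assumes f: "\<And>x. x \<le> z \<Longrightarrow> (f has_real_derivative f' x) (at x)"
    and g: "\<And>x. z \<le> x \<Longrightarrow> (g has_real_derivative g' x) (at x)"
    and "f z = g z" "f' z = g' z"
  shows "((\<lambda>x. if x \<le> z then f x else g x) has_real_derivative (if x \<le> z then f' x else g' x)) (at x)"
proof -
  have "((\<lambda>x. if x \<in> {..z} then f x else g x) has_vector_derivative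
      (if x \<in> {..z} then f' x else g' x)) (at x within UNIV)"
    by (rule has_vector_derivative_If_within_closures[where T="{z<..}"])
      (use assms f g in \<open>auto simp: has_real_derivative_iff_has_vector_derivative
         intro: has_vector_derivative_at_within\<close>)
  then show ?thesis
    by (simp add: has_real_derivative_iff_has_vector_derivative)
qed

section \<open>Characteristic roots and the operator for one rate\<close>

locale dividend_model =
  fixes mu sig q Lam :: real
  assumes sig_pos: "sig > 0" and q_pos: "q > 0" and Lam_pos: "Lam > 0"
begin

abbreviation "\<theta>\<^sub>1 \<equiv> theta1 mu sig q"

text \<open>The positive root of sig^2 r^2 / 2 + (mu - c) r = q, companion of the negative root
  \<open>theta1\<close>. The candidates are made of decaying exponentials only; the growing one
  enters through tangent solutions with prescribed value and slope.\<close>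

definition \<theta>\<^sub>2 :: "real \<Rightarrow> real" where
  "\<theta>\<^sub>2 c = (c - mu + sqrt ((c - mu)\<^sup>2 + 2 * q * sig\<^sup>2)) / sig\<^sup>2"

lemma sqrt_gt_abs: "\<bar>c - mu\<bar> < sqrt ((c - mu)\<^sup>2 + 2 * q * sig\<^sup>2)"
  using sig_pos q_pos by (intro real_less_rsqrt) simp

lemma theta1_neg: "\<theta>\<^sub>1 c < 0"
  unfolding theta1_def using sqrt_gt_abs[of c] sig_pos by (intro divide_neg_pos) auto

lemma theta2_pos: "0 < \<theta>\<^sub>2 c"
  unfolding \<theta>\<^sub>2_def using sqrt_gt_abs[of c] sig_pos by (intro divide_pos_pos) auto

lemma theta_sum: "\<theta>\<^sub>1 c + \<theta>\<^sub>2 c = 2 * (c - mu) / sig\<^sup>2"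
  unfolding theta1_def \<theta>\<^sub>2_def by (simp add: add_divide_distrib diff_divide_distrib algebra_simps)

lemma theta_prod: "\<theta>\<^sub>1 c * \<theta>\<^sub>2 c = - 2 * q / sig\<^sup>2"
proof -
  define s where "s = sqrt ((c - mu)\<^sup>2 + 2 * q * sig\<^sup>2)"
  have "s\<^sup>2 = (c - mu)\<^sup>2 + 2 * q * sig\<^sup>2"
    unfolding s_def using q_pos by (intro real_sqrt_pow2) auto
  then have "(c - mu - s) * (c - mu + s) = - 2 * q * sig\<^sup>2"
    by (simp add: algebra_simps power2_eq_square)
  then show ?thesis
    unfolding theta1_def \<theta>\<^sub>2_def s_def[symmetric] times_divide_times_eq using sig_pos
    by (simp add: nonzero_divide_eq_eq nonzero_eq_divide_eq)
qed

lemma theta_factor: "sig\<^sup>2 * ((x - \<theta>\<^sub>1 c) * (x - \<theta>\<^sub>2 c)) = sig\<^sup>2 * x\<^sup>2 + 2 * (mu - c) * x - 2 * q"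
proof -
  have "sig\<^sup>2 * ((x - \<theta>\<^sub>1 c) * (x - \<theta>\<^sub>2 c))
    = sig\<^sup>2 * x\<^sup>2 - sig\<^sup>2 * (\<theta>\<^sub>1 c + \<theta>\<^sub>2 c) * x + sig\<^sup>2 * (\<theta>\<^sub>1 c * \<theta>\<^sub>2 c)"
    by (simp add: algebra_simps power2_eq_square)
  also have "\<dots> = sig\<^sup>2 * x\<^sup>2 + 2 * (mu - c) * x - 2 * q"
    unfolding theta_sum theta_prod using sig_pos by (simp add: field_simps)
  finally show ?thesis .
qed

lemma theta1_char: "sig\<^sup>2 * (\<theta>\<^sub>1 c)\<^sup>2 / 2 + (mu - c) * \<theta>\<^sub>1 c = q"
  using theta_factor[of "\<theta>\<^sub>1 c" c] by (simp add: field_simps)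

lemma theta2_char: "sig\<^sup>2 * (\<theta>\<^sub>2 c)\<^sup>2 / 2 + (mu - c) * \<theta>\<^sub>2 c = q"
  using theta_factor[of "\<theta>\<^sub>2 c" c] by (simp add: field_simps)

text \<open>Generator of the surplus at constant rate \<open>c\<close>, discounted at
  \<open>q\<close>, plus the payment rate. The arguments are the numbers f, f', f'' at one point, so
  that a second derivative existing only off a finite set can be inserted.\<close>

definition pde :: "real \<Rightarrow> real \<Rightarrow> real \<Rightarrow> real \<Rightarrow> real" where
  "pde c f0 f1 f2 = sig\<^sup>2 / 2 * f2 + (mu - c) * f1 - q * f0 + c + Lam"

text \<open>The Wronskian of the decaying exponential and f - k, divided by the exponential from
  Abel's formula, so that it is constant along exact solutions when k = (c + Lam) / q. It vanishes
  where \<open>f\<close> touches some k + A exp (\<open>\<theta>\<^sub>1 c\<close> x) with equal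
  slope.\<close>

definition wronski :: "real \<Rightarrow> (real \<Rightarrow> real) \<Rightarrow> (real \<Rightarrow> real) \<Rightarrow> real \<Rightarrow> real \<Rightarrow> real" where
  "wronski c f f' k x = exp (- \<theta>\<^sub>2 c * x) * (f' x - \<theta>\<^sub>1 c * (f x - k))"

text \<open>The factorisation \<open>\<sigma>\<^sup>2/2 (D - \<theta>\<^sub>1) (D - \<theta>\<^sub>2)\<close> of the homogeneous operator.\<close>

lemma wronski_deriv:
  assumes "(f has_real_derivative f' x) (at x)" "(f' has_real_derivative f2) (at x)"
  shows "(wronski c f f' ((c + Lam) / q) has_real_derivative
    exp (- \<theta>\<^sub>2 c * x) * (2 / sig\<^sup>2 * pde c (f x) (f' x) f2)) (at x)"
proof -
  define k where "k = (c + Lam) / q"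
  have kq: "q * k = c + Lam" using q_pos by (simp add: k_def)
  have "(wronski c f f' k has_real_derivative
    exp (- \<theta>\<^sub>2 c * x) * (f2 - \<theta>\<^sub>1 c * f' x)
     + (- \<theta>\<^sub>2 c) * exp (- \<theta>\<^sub>2 c * x) * (f' x - \<theta>\<^sub>1 c * (f x - k))) (at x)"
    unfolding wronski_def[abs_def] using assms
    by (auto intro!: derivative_eq_intros)
  moreover have "exp (- \<theta>\<^sub>2 c * x) * (f2 - \<theta>\<^sub>1 c * f' x)
     + (- \<theta>\<^sub>2 c) * exp (- \<theta>\<^sub>2 c * x) * (f' x - \<theta>\<^sub>1 c * (f x - k))
    = exp (- \<theta>\<^sub>2 c * x) * (f2 - (\<theta>\<^sub>1 c + \<theta>\<^sub>2 c) * f' x + (\<theta>\<^sub>1 c * \<theta>\<^sub>2 c) * (f x - k))"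
    by (simp add: algebra_simps)
  moreover have "f2 - (\<theta>\<^sub>1 c + \<theta>\<^sub>2 c) * f' x + (\<theta>\<^sub>1 c * \<theta>\<^sub>2 c) * (f x - k)
     = 2 / sig\<^sup>2 * (sig\<^sup>2 / 2 * f2 + (mu - c) * f' x - q * f x + q * k)"
    unfolding theta_sum theta_prod using sig_pos by (simp add: field_simps)
  ultimately show ?thesis by (simp add: k_def[symmetric] pde_def kq add.assoc)
qed

lemma wronski_continuous:
  "continuous_on UNIV f \<Longrightarrow> continuous_on UNIV f' \<Longrightarrow> continuous_on A (wronski c f f' k)"
  unfolding wronski_def[abs_def]
  by (rule continuous_on_subset[of UNIV]) (auto intro!: continuous_intros)

text \<open>The properties of the value function with maximal rate \<open>c\<close> that are preserved when a
  further rate is added. Functions live on the whole line, so that increments of the Brownian motion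
  need not be stopped at \<open>0\<close>.\<close>

definition profile :: "real \<Rightarrow> (real \<Rightarrow> real) \<Rightarrow> (real \<Rightarrow> real) \<Rightarrow> bool" where
  "profile c f f' \<longleftrightarrow>
     (\<forall>x. (f has_real_derivative f' x) (at x)) \<and> continuous_on UNIV f' \<and>
     (\<exists>f2 F. finite F \<and> (\<forall>x. x \<notin> F \<longrightarrow> (f' has_real_derivative f2 x) (at x) \<and>
        pde c (f x) (f' x) (f2 x) \<le> 0 \<and> (f' x < 1 \<longrightarrow> pde c (f x) (f' x) (f2 x) = 0))) \<and>
     antimono f' \<and> (\<forall>x. 0 < f' x) \<and> f 0 = 0 \<and> (\<forall>x. f x < (c + Lam) / q) \<and>
     (\<exists>K a. 0 \<le> K \<and> 0 \<le> a \<and> (\<forall>x\<le>0. - K * exp (- a * x) \<le> f x))"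

lemma profile_continuous: "profile c f f' \<Longrightarrow> continuous_on A f"
  unfolding profile_def by (meson DERIV_isCont continuous_at_imp_continuous_on)

lemma profile_deriv_antimono: "profile c f f' \<Longrightarrow> x \<le> y \<Longrightarrow> f' y \<le> f' x"
  unfolding profile_def antimono_def by blast

lemma profile_mono: "profile c f f' \<Longrightarrow> x \<le> y \<Longrightarrow> f x \<le> f y"
  unfolding profile_def by (meson DERIV_nonneg_imp_nondecreasing less_imp_le)

lemma profile_less: "profile c f f' \<Longrightarrow> f x < (c + Lam) / q"
  unfolding profile_def by blast

lemma profile_nonneg: "profile c f f' \<Longrightarrow> 0 \<le> x \<Longrightarrow> 0 \<le> f x"
  using profile_mono[of c f f' 0 x] unfolding profile_def by auto

text \<open>The factor \<open>e\<close> is 1 for supersolutions and -1 for subsolutions. The rate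
  \<open>c'\<close> of the operator is independent of the rate \<open>c\<close> of the profile,
  because the current candidate is to be tested against the next rate.\<close>

lemma wronski_monotone:
  fixes e :: real
  assumes P: "profile c f f'" and "a \<le> b" "finite F"
    and f2: "\<And>x. x \<notin> F \<Longrightarrow> (f' has_real_derivative f2 x) (at x)"
    and e: "\<And>x. a < x \<Longrightarrow> x < b \<Longrightarrow> x \<notin> F \<Longrightarrow> e * pde c' (f x) (f' x) (f2 x) \<le> 0"
  shows "e * wronski c' f f' ((c' + Lam) / q) b \<le> e * wronski c' f f' ((c' + Lam) / q) a"
proof -
  have f': "(f has_real_derivative f' x) (at x)" for x
    using P unfolding profile_def by blast
  show ?thesis
  proof (rule nonincreasing_except_finite[OF \<open>a \<le> b\<close> _ \<open>finite F\<close> DERIV_cmult[OF wronski_deriv[OF f' f2]]])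
    show "continuous_on {a..b} (\<lambda>x. e * wronski c' f f' ((c' + Lam) / q) x)"
      using P profile_continuous[OF P]
      by (intro continuous_on_mult_left wronski_continuous) (auto simp: profile_def)
    fix x assume x: "a < x" "x < b" "x \<notin> F"
    have "exp (- \<theta>\<^sub>2 c' * x) * (2 / sig\<^sup>2) * (e * pde c' (f x) (f' x) (f2 x)) \<le> 0"
      by (rule mult_nonneg_nonpos[OF _ e[OF x]]) simp
    then show "e * (exp (- \<theta>\<^sub>2 c' * x) * (2 / sig\<^sup>2 * pde c' (f x) (f' x) (f2 x))) \<le> 0"
      by (simp only: mult_ac)
  qed
qed

lemma profile_wronski_antimono:
  assumes P: "profile c f f'" and "x \<le> y"
  shows "wronski c f f' ((c + Lam) / q) y \<le> wronski c f f' ((c + Lam) / q) x"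
proof -
  obtain f2 F where "finite F" and F: "\<And>x. x \<notin> F \<Longrightarrow> (f' has_real_derivative f2 x) (at x)"
    "\<And>x. x \<notin> F \<Longrightarrow> pde c (f x) (f' x) (f2 x) \<le> 0"
    using P unfolding profile_def by blast
  then show ?thesis
    using wronski_monotone[OF P \<open>x \<le> y\<close> \<open>finite F\<close> F(1), of 1 c] by simp
qed

text \<open>With k = (c + Lam) / q, the function k + a exp (\<open>\<theta>\<^sub>1 c\<close> t) + b
  exp (\<open>\<theta>\<^sub>2 c\<close> t) has value \<open>f0\<close> and slope \<open>f1\<close>
  at t = 0 exactly for a = \<open>tan_coeff1\<close> and b = \<open>tan_coeff2\<close>.\<close>

definition tan_coeff1 :: "real \<Rightarrow> real \<Rightarrow> real \<Rightarrow> real" where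
  "tan_coeff1 c f0 f1 = (\<theta>\<^sub>2 c * (f0 - (c + Lam) / q) - f1) / (\<theta>\<^sub>2 c - \<theta>\<^sub>1 c)"

definition tan_coeff2 :: "real \<Rightarrow> real \<Rightarrow> real \<Rightarrow> real" where
  "tan_coeff2 c f0 f1 = (f1 - \<theta>\<^sub>1 c * (f0 - (c + Lam) / q)) / (\<theta>\<^sub>2 c - \<theta>\<^sub>1 c)"

lemma tan_coeff_sum: "tan_coeff1 c f0 f1 + tan_coeff2 c f0 f1 = f0 - (c + Lam) / q"
  using theta1_neg[of c] theta2_pos[of c]
  by (simp add: tan_coeff1_def tan_coeff2_def add_divide_distrib[symmetric] nonzero_divide_eq_eq) (simp add: algebra_simps)

text \<open>The dominating functions are combinations of exponentials, whose Gaussian expectations are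
  explicit; this replaces Ito's formula.\<close>

lemma tangent_domination:
  assumes P: "profile c f f'"
  defines "k \<equiv> (c + Lam) / q"
  shows "f x \<le> k + tan_coeff1 c (f y) (f' y) * exp (\<theta>\<^sub>1 c * (x - y))
                + tan_coeff2 c (f y) (f' y) * exp (\<theta>\<^sub>2 c * (x - y))"
proof -
  define a where "a = tan_coeff1 c (f y) (f' y)"
  define b where "b = tan_coeff2 c (f y) (f' y)"
  have ab: "a + b = f y - k" unfolding a_def b_def k_def by (rule tan_coeff_sum)
  have b: "b * (\<theta>\<^sub>2 c - \<theta>\<^sub>1 c) = f' y - \<theta>\<^sub>1 c * (f y - k)"
    using theta1_neg[of c] theta2_pos[of c] unfolding b_def tan_coeff2_def k_def by simp
  \<comment> \<open>Removing the growing part and dividing by the decaying exponential leaves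
    \<open>u\<close>, whose derivative has the sign of \<open>?H x - ?H y\<close>. Since
    \<open>?H\<close> is nonincreasing, \<open>u\<close> is largest at \<open>y\<close>.\<close>
  define u where "u x = (f x - k - b * exp (\<theta>\<^sub>2 c * (x - y))) * exp (- \<theta>\<^sub>1 c * x)" for x
  let ?H = "wronski c f f' k"
  have u': "(u has_real_derivative exp ((\<theta>\<^sub>2 c - \<theta>\<^sub>1 c) * x) * (?H x - ?H y)) (at x)" for x
  proof -
    have f': "(f has_real_derivative f' x) (at x)"
      using P unfolding profile_def by blast
    have "(u has_real_derivative (f' x - b * (\<theta>\<^sub>2 c * exp (\<theta>\<^sub>2 c * (x - y)))) * exp (- \<theta>\<^sub>1 c * x)
       - (f x - k - b * exp (\<theta>\<^sub>2 c * (x - y))) * (\<theta>\<^sub>1 c * exp (- \<theta>\<^sub>1 c * x))) (at x)"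
      unfolding u_def[abs_def] by (auto intro!: derivative_eq_intros f' simp: algebra_simps)
    moreover have "(f' x - b * (\<theta>\<^sub>2 c * exp (\<theta>\<^sub>2 c * (x - y)))) * exp (- \<theta>\<^sub>1 c * x)
       - (f x - k - b * exp (\<theta>\<^sub>2 c * (x - y))) * (\<theta>\<^sub>1 c * exp (- \<theta>\<^sub>1 c * x))
      = exp (- \<theta>\<^sub>1 c * x) * (f' x - \<theta>\<^sub>1 c * (f x - k) - b * (\<theta>\<^sub>2 c - \<theta>\<^sub>1 c) * exp (\<theta>\<^sub>2 c * (x - y)))"
      by (simp add: algebra_simps)
    moreover have "\<dots> = exp ((\<theta>\<^sub>2 c - \<theta>\<^sub>1 c) * x) * (?H x - ?H y)"
      unfolding b wronski_def
      by (simp add: algebra_simps exp_add[symmetric] exp_diff exp_minus field_simps)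
    ultimately show ?thesis by simp
  qed
  have "u x \<le> u y"
  proof (cases "x \<le> y")
    case True
    have "\<And>t. x \<le> t \<Longrightarrow> t \<le> y \<Longrightarrow> 0 \<le> exp ((\<theta>\<^sub>2 c - \<theta>\<^sub>1 c) * t) * (?H t - ?H y)"
      using profile_wronski_antimono[OF P] unfolding k_def by simp
    then show ?thesis using DERIV_nonneg_imp_nondecreasing[OF True] u' by blast
  next
    case False
    have "\<And>t. y \<le> t \<Longrightarrow> t \<le> x \<Longrightarrow> exp ((\<theta>\<^sub>2 c - \<theta>\<^sub>1 c) * t) * (?H t - ?H y) \<le> 0"
      using profile_wronski_antimono[OF P] unfolding k_def
      by (simp add: mult_nonneg_nonpos)
    then show ?thesis using DERIV_nonpos_imp_nonincreasing[of y x u] u' False by (meson linear)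
  qed
  also have "u y = a * exp (- \<theta>\<^sub>1 c * y)"
    using ab by (simp add: u_def)
  also have "\<dots> = a * exp (\<theta>\<^sub>1 c * (x - y)) * exp (- \<theta>\<^sub>1 c * x)"
    by (simp add: algebra_simps exp_add[symmetric])
  finally have "f x - k - b * exp (\<theta>\<^sub>2 c * (x - y)) \<le> a * exp (\<theta>\<^sub>1 c * (x - y))"
    unfolding u_def by simp
  then show ?thesis unfolding a_def b_def by simp
qed

text \<open>The decaying solution through 0 solves the equation exactly everywhere, so the
  conditional equality in \<open>profile\<close> is automatic. It is the starting candidate, and
  again the candidate whenever a new threshold is 0.\<close>

lemma profile_exp:
  assumes "0 \<le> c"
  shows "profile c (\<lambda>x. (c + Lam) / q * (1 - exp (\<theta>\<^sub>1 c * x))) (\<lambda>x. (c + Lam) / q * - \<theta>\<^sub>1 c * exp (\<theta>\<^sub>1 c * x))"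
proof -
  define k where "k = (c + Lam) / q"
  have k: "0 < k" using assms q_pos Lam_pos by (simp add: k_def)
  have kq: "c + Lam = q * k" using q_pos by (simp add: k_def)
  define m where "m = - \<theta>\<^sub>1 c"
  have m: "0 < m" using theta1_neg by (simp add: m_def)
  let ?f = "\<lambda>x. k * (1 - exp (- m * x))"
  let ?f' = "\<lambda>x. k * m * exp (- m * x)"
  let ?f2 = "\<lambda>x. - k * m\<^sup>2 * exp (- m * x)"
  have "pde c (?f x) (?f' x) (?f2 x) = 0" for x
  proof -
    have "pde c (?f x) (?f' x) (?f2 x)
      = - k * exp (- m * x) * (sig\<^sup>2 * m\<^sup>2 / 2 - (mu - c) * m - q)"
      unfolding pde_def add.assoc kq by (simp add: field_simps)
    moreover have "sig\<^sup>2 * m\<^sup>2 / 2 - (mu - c) * m - q = 0"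
      using theta1_char[of c] by (simp add: m_def)
    ultimately show ?thesis by simp
  qed
  moreover have "(?f has_real_derivative ?f' x) (at x)" for x
    by (auto intro!: derivative_eq_intros)
  moreover have "(?f' has_real_derivative ?f2 x) (at x)" for x
    by (auto intro!: derivative_eq_intros simp: power2_eq_square)
  moreover have "antimono ?f'"
    using k m by (intro antimonoI mult_left_mono) auto
  moreover have "- k * exp (- m * x) \<le> ?f x" for x
    using k by (simp add: algebra_simps)
  moreover have "?f x < k" for x
    using mult_strict_left_mono[OF _ k, of "1 - exp (- m * x)" 1] by simp
  ultimately have "profile c ?f ?f'"
    unfolding profile_def k_def[symmetric] using k m
    by (intro conjI exI[of _ ?f2] exI[of _ "{}"] exI[of _ k] exI[of _ m])
       (auto intro!: continuous_intros)
  then show ?thesis by (simp add: k_def m_def)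
qed

section \<open>Adding one further rate\<close>

lemma pde_add_rate: "pde c' f0 f1 f2 = pde c f0 f1 f2 + (c' - c) * (1 - f1)"
  unfolding pde_def by (simp add: algebra_simps)

text \<open>Were the slope at least 1 at \<open>y\<close>, concavity would make it at least 1 on all
  of [0, y], so f y \<ge> y \<ge> (c + Lam) / q against the strict upper bound. This yields a point
  in the low-slope region, without which the threshold could be infinite.\<close>

lemma profile_deriv_lt_one:
  assumes P: "profile c f f'" and y: "(c + Lam) / q \<le> y" "0 \<le> y"
  shows "f' y < 1"
proof (rule ccontr)
  assume "\<not> f' y < 1"
  then have *: "1 \<le> f' t" if "t \<le> y" for t
    using profile_deriv_antimono[OF P that] by simp
  have "f 0 - 0 \<le> f y - y"
  proof (rule DERIV_nonneg_imp_nondecreasing[OF \<open>0 \<le> y\<close>])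
    fix t assume "0 \<le> t" "t \<le> y"
    moreover have "((\<lambda>t. f t - t) has_real_derivative f' t - 1) (at t)"
      using P unfolding profile_def by (auto intro!: derivative_eq_intros)
    ultimately show "\<exists>d. ((\<lambda>t. f t - t) has_real_derivative d) (at t) \<and> 0 \<le> d"
      using *[of t] by auto
  qed
  then have "y \<le> f y" using P by (simp add: profile_def)
  moreover have "f y < (c + Lam) / q" using P by (simp add: profile_def)
  ultimately show False using y by linarith
qed

text \<open>By concavity the slope is at least 1 on the whole of [a, b], where the term (c' - c)(1 -
  f') only helps the supersolution property.\<close>

lemma wronski_next_antimono:
  assumes P: "profile c f f'" and c: "c < c'" and "a \<le> b" and b: "1 \<le> f' b"
  shows "wronski c' f f' ((c' + Lam) / q) b \<le> wronski c' f f' ((c' + Lam) / q) a"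
proof -
  obtain f2 F where "finite F" and F: "\<And>x. x \<notin> F \<Longrightarrow> (f' has_real_derivative f2 x) (at x)"
    "\<And>x. x \<notin> F \<Longrightarrow> pde c (f x) (f' x) (f2 x) \<le> 0"
    using P unfolding profile_def by blast
  have "1 * pde c' (f t) (f' t) (f2 t) \<le> 0" if "t < b" "t \<notin> F" for t
  proof -
    have "1 \<le> f' t" using profile_deriv_antimono[OF P, of t b] b that by simp
    then show ?thesis
      using F(2)[OF \<open>t \<notin> F\<close>] c mult_nonneg_nonpos[of "c' - c" "1 - f' t"]
      unfolding pde_add_rate[of c' _ _ _ c] by simp
  qed
  then show ?thesis
    using wronski_monotone[OF P \<open>a \<le> b\<close> \<open>finite F\<close> F(1), of 1 c'] by simp
qed

text \<open>To the right of \<open>x\<close> the slope stays below 1, so \<open>f\<close> solves the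
  equation for \<open>c\<close> exactly and is a strict subsolution for \<open>c'\<close>; hence
  \<open>wronski\<close> increases there. It is also bounded above by exp (-
  \<open>\<theta>\<^sub>2 c'\<close> y), which tends to 0, so it cannot be positive at
  \<open>x\<close>.\<close>

lemma wronski_next_nonpos:
  assumes P: "profile c f f'" and c: "c < c'" and x: "f' x < 1"
  shows "wronski c' f f' ((c' + Lam) / q) x \<le> 0"
proof -
  let ?k = "(c' + Lam) / q"
  let ?H = "wronski c' f f' ?k"
  obtain f2 F where "finite F" and F: "\<And>x. x \<notin> F \<Longrightarrow> (f' has_real_derivative f2 x) (at x)"
    "\<And>x. x \<notin> F \<Longrightarrow> f' x < 1 \<Longrightarrow> pde c (f x) (f' x) (f2 x) = 0"
    using P unfolding profile_def by blast
  have lt1: "f' t < 1" if "x \<le> t" for t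
    using profile_deriv_antimono[OF P that] x by simp
  have "?H x \<le> exp (- \<theta>\<^sub>2 c' * y)" if "x \<le> y" for y
  proof -
    have "-1 * pde c' (f t) (f' t) (f2 t) \<le> 0" if "x < t" "t \<notin> F" for t
      using F(2)[OF \<open>t \<notin> F\<close>] lt1[of t] c that unfolding pde_add_rate[of c' _ _ _ c] by simp
    then have "-1 * ?H y \<le> -1 * ?H x"
      by (intro wronski_monotone[OF P that \<open>finite F\<close> F(1)])
    then have "?H x \<le> ?H y" by simp
    also have "?H y \<le> exp (- \<theta>\<^sub>2 c' * y) * 1"
      unfolding wronski_def
    proof (rule mult_left_mono)
      have "f y < ?k"
        using profile_less[OF P, of y] c q_pos divide_strict_right_mono[of "c + Lam" "c' + Lam" q]
        by simp
      then have "- \<theta>\<^sub>1 c' * (f y - ?k) \<le> 0"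
        using theta1_neg[of c'] by (intro mult_nonneg_nonpos) auto
      then show "f' y - \<theta>\<^sub>1 c' * (f y - ?k) \<le> 1"
        using lt1[OF that] by simp
    qed simp
    finally show ?thesis by simp
  qed
  then have "\<forall>\<^sub>F y in at_top. ?H x \<le> exp (- \<theta>\<^sub>2 c' * y)"
    by (rule eventually_at_top_linorderI)
  moreover have "((\<lambda>y. exp (- \<theta>\<^sub>2 c' * y)) \<longlongrightarrow> 0) at_top"
    using theta2_pos[of c'] by real_asymp
  ultimately show ?thesis
    by (intro tendsto_lowerbound[of "\<lambda>y. exp (- \<theta>\<^sub>2 c' * y)" 0 at_top]) auto
qed

text \<open>The function G of the problem with an arbitrary \<open>f\<close> as the value at the
  previous rate. The decaying solution equal to \<open>f\<close> at z is (c + Lam) / q * (1 - G(z)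
  exp (\<open>\<theta>\<^sub>1 c\<close> x)); minimising G selects the highest of these
  curves.\<close>

definition gfun :: "real \<Rightarrow> (real \<Rightarrow> real) \<Rightarrow> real \<Rightarrow> real" where
  "gfun c f y = (1 - q / (c + Lam) * f y) * exp (- \<theta>\<^sub>1 c * y)"

definition least_argmin :: "(real \<Rightarrow> real) \<Rightarrow> real" where
  "least_argmin G = (LEAST y. y \<in> {y. 0 \<le> y \<and> (\<forall>y'\<ge>0. G y \<le> G y')})"

text \<open>With z = 0 the exponential is used on the negative half-line as well: smooth fit may
  fail at 0, and keeping \<open>f\<close> on the left would then destroy differentiability.\<close>

definition extend :: "real \<Rightarrow> (real \<Rightarrow> real) \<Rightarrow> real \<Rightarrow> real \<Rightarrow> real" where
  "extend c f z x = (if 0 < z \<and> x \<le> z then f x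
     else (c + Lam) / q * (1 - gfun c f z * exp (\<theta>\<^sub>1 c * x)))"

text \<open>The sign of \<open>G'\<close> is opposite to that of the function \<open>wronski\<close>, which is first positive and
  then nonpositive; so the least minimiser is its first zero, or \<open>0\<close>.\<close>

lemma least_argmin_props:
  assumes P: "profile c f f'" and c: "0 \<le> c" "c < c'"
  defines "k \<equiv> (c' + Lam) / q"
  defines "G \<equiv> gfun c' f"
  defines "Z \<equiv> least_argmin G"
  shows "0 \<le> Z" "\<And>y. 0 \<le> y \<Longrightarrow> G Z \<le> G y"
    "0 < Z \<Longrightarrow> wronski c' f f' k Z = 0" "0 < Z \<Longrightarrow> 1 \<le> f' Z"
proof -
  let ?H = "wronski c' f f' k"
  have k: "0 < k" unfolding k_def using c q_pos Lam_pos by simp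
  have Hcont: "continuous_on A ?H" for A
    using P profile_continuous[OF P] by (intro wronski_continuous) (auto simp: profile_def)
  have neg: "?H y \<le> 0" if "f' y < 1" for y
    using wronski_next_nonpos[OF P c(2) that] unfolding k_def .
  define A where "A = {y \<in> {0..}. ?H y \<le> 0}"
  define Z0 where "Z0 = Inf A"
  \<comment> \<open>At this point the slope is below 1, hence \<open>?H\<close> is nonpositive and
    the infimum \<open>Z0\<close> is taken over a nonempty closed set.\<close>
  have "max 0 ((c + Lam) / q) \<in> A"
    unfolding A_def using neg profile_deriv_lt_one[OF P, of "max 0 ((c + Lam) / q)"] by auto
  moreover have "closed A"
  proof -
    have "A = {0..} \<inter> {y. ?H y \<le> 0}" unfolding A_def by auto
    then show ?thesis
      by (simp only:) (intro closed_Int closed_Collect_le Hcont closed_atLeast continuous_on_const)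
  qed
  moreover have bdd: "bdd_below A" unfolding A_def by (auto intro: bdd_belowI[of _ 0])
  ultimately have Z0A: "Z0 \<in> A"
    unfolding Z0_def by (intro closed_contains_Inf) auto
  then have Z0: "0 \<le> Z0" "?H Z0 \<le> 0" unfolding A_def by auto
  have below: "0 < ?H y" if "0 \<le> y" "y < Z0" for y
  proof (rule ccontr)
    assume "\<not> 0 < ?H y"
    then have "y \<in> A" using that unfolding A_def by simp
    then have "Z0 \<le> y" unfolding Z0_def using bdd by (rule cInf_lower)
    then show False using that by simp
  qed
  \<comment> \<open>Either the slope at \<open>y\<close> is below 1 and \<open>neg\<close> applies,
    or it is at least 1 on all of [Z0, y], where \<open>?H\<close> decreases from a nonpositive
    value.\<close>
  have above: "?H y \<le> 0" if "Z0 \<le> y" for y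
  proof (cases "f' y < 1")
    case False
    then have "?H y \<le> ?H Z0"
      using wronski_next_antimono[OF P c(2) that] unfolding k_def by simp
    then show ?thesis using Z0 by simp
  qed (rule neg)
  have HZ0: "?H Z0 = 0" if "0 < Z0"
  proof (rule ccontr)
    assume "?H Z0 \<noteq> 0"
    then have "?H Z0 < 0" using Z0 by simp
    moreover have "0 < ?H 0" using below[of 0] that by simp
    ultimately have "\<exists>y\<ge>0. y \<le> Z0 \<and> ?H y = 0"
      using that Hcont[of "{0..Z0}"] by (intro IVT2') simp_all
    then obtain y where y: "0 \<le> y" "y \<le> Z0" "?H y = 0" by blast
    then show False using below[of y] \<open>?H Z0 \<noteq> 0\<close> by (cases "y = Z0") auto
  qed
  \<comment> \<open>A slope below 1 would persist slightly to the left of \<open>Z0\<close> and make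
    \<open>?H\<close> nonpositive there, contradicting the choice of \<open>Z0\<close>.\<close>
  have f'Z0: "1 \<le> f' Z0" if "0 < Z0"
  proof (rule ccontr)
    assume *: "\<not> 1 \<le> f' Z0"
    have "isCont f' Z0" using P unfolding profile_def by (simp add: continuous_on_eq_continuous_at)
    then have "\<forall>\<^sub>F y in at_left Z0. f' y < 1"
      using * by (intro order_tendstoD(2)[of f' "f' Z0"]) (auto simp: isCont_def filterlim_at_split)
    moreover have "\<forall>\<^sub>F y in at_left Z0. 0 < y \<and> y < Z0"
      using eventually_at_left[OF that, of "\<lambda>y. 0 < y \<and> y < Z0"] that by blast
    ultimately have "\<forall>\<^sub>F y in at_left Z0. False"
    proof eventually_elim
      case (elim y)
      then show ?case using neg[of y] below[of y] by simp
    qed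
    then show False by (simp add: trivial_limit_at_left_real eventually_False)
  qed
  have G': "(G has_real_derivative - (1 / k) * exp ((\<theta>\<^sub>2 c' - \<theta>\<^sub>1 c') * y) * ?H y) (at y)" for y
  proof -
    have f': "(f has_real_derivative f' y) (at y)"
      using P unfolding profile_def by blast
    have "G = (\<lambda>y. (1 - f y / k) * exp (- \<theta>\<^sub>1 c' * y))"
      unfolding G_def gfun_def k_def by (auto simp: fun_eq_iff)
    moreover have "((\<lambda>y. (1 - f y / k) * exp (- \<theta>\<^sub>1 c' * y)) has_real_derivative
        (1 - f y / k) * (- \<theta>\<^sub>1 c' * exp (- \<theta>\<^sub>1 c' * y)) - f' y / k * exp (- \<theta>\<^sub>1 c' * y)) (at y)"
      using k by (auto intro!: derivative_eq_intros f')
    moreover have "(1 - f y / k) * (- \<theta>\<^sub>1 c' * exp (- \<theta>\<^sub>1 c' * y)) - f' y / k * exp (- \<theta>\<^sub>1 c' * y)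
       = - (1 / k) * exp (- \<theta>\<^sub>1 c' * y) * (f' y - \<theta>\<^sub>1 c' * (f y - k))"
      using k by (simp add: field_simps)
    moreover have "exp (- \<theta>\<^sub>1 c' * y) = exp ((\<theta>\<^sub>2 c' - \<theta>\<^sub>1 c') * y) * exp (- \<theta>\<^sub>2 c' * y)"
      by (simp add: exp_add[symmetric] algebra_simps)
    ultimately show ?thesis unfolding wronski_def by (simp add: mult.assoc)
  qed
  have less: "G Z0 < G y" if "0 \<le> y" "y < Z0" for y
  proof (rule DERIV_neg_imp_decreasing_open[OF \<open>y < Z0\<close>])
    show "\<exists>d. (G has_real_derivative d) (at t) \<and> d < 0" if "y < t" "t < Z0" for t
      using G'[of t] below[of t] that \<open>0 \<le> y\<close> k by (intro exI conjI) (auto simp: divide_less_0_iff)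
    show "continuous_on {y..Z0} G"
      using G' by (meson DERIV_isCont continuous_at_imp_continuous_on)
  qed
  have ge: "G Z0 \<le> G y" if "Z0 \<le> y" for y
  proof (rule DERIV_nonneg_imp_nondecreasing[OF that])
    show "\<exists>d. (G has_real_derivative d) (at t) \<and> 0 \<le> d" if "Z0 \<le> t" "t \<le> y" for t
      using G'[of t] above[of t] that k
      by (intro exI conjI) (auto simp: divide_le_0_iff mult_le_0_iff zero_le_divide_iff)
  qed
  have "Z = Z0"
    unfolding Z_def least_argmin_def
  proof (rule Least_equality)
    show "Z0 \<in> {y. 0 \<le> y \<and> (\<forall>y'\<ge>0. G y \<le> G y')}"
      using Z0 less ge by (auto intro: less_imp_le) (meson less less_imp_le linorder_not_less)
    show "Z0 \<le> y" if "y \<in> {y. 0 \<le> y \<and> (\<forall>y'\<ge>0. G y \<le> G y')}" for y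
      using that less[of y] Z0 by force
  qed
  then show "0 \<le> Z" "\<And>y. 0 \<le> y \<Longrightarrow> G Z \<le> G y" "0 < Z \<Longrightarrow> ?H Z = 0" "0 < Z \<Longrightarrow> 1 \<le> f' Z"
    using Z0 less ge HZ0 f'Z0 by (auto intro: less_imp_le) (meson less less_imp_le linorder_not_less)
qed

text \<open>Below the threshold nothing changes. Elsewhere the inequality is the minimality of G at
  the threshold, multiplied by the decaying exponential and rearranged.\<close>

lemma extend_ge:
  assumes P: "profile c f f'" and c: "0 \<le> c" "c < c'" and y: "0 \<le> y"
  shows "f y \<le> extend c' f (least_argmin (gfun c' f)) y"
proof (cases "0 < least_argmin (gfun c' f) \<and> y \<le> least_argmin (gfun c' f)")
  case False
  let ?m = "gfun c' f (least_argmin (gfun c' f))"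
  have "?m \<le> gfun c' f y" using least_argmin_props(2)[OF P c y] .
  then have "?m * exp (\<theta>\<^sub>1 c' * y) \<le> (1 - q / (c' + Lam) * f y)"
    using mult_right_mono[of ?m "gfun c' f y" "exp (\<theta>\<^sub>1 c' * y)"]
    by (simp add: gfun_def mult.assoc exp_add[symmetric])
  then have "q / (c' + Lam) * f y \<le> 1 - ?m * exp (\<theta>\<^sub>1 c' * y)" by simp
  then have "(c' + Lam) / q * (q / (c' + Lam) * f y) \<le> (c' + Lam) / q * (1 - ?m * exp (\<theta>\<^sub>1 c' * y))"
    using c Lam_pos q_pos by (intro mult_left_mono) auto
  then show ?thesis
    using False c Lam_pos q_pos by (auto simp: extend_def)
qed (simp add: extend_def)

text \<open>On the kept part the slope is at least 1, so the supersolution property passes from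
  \<open>c\<close> to \<open>c'\<close>; on the new part the equation for \<open>c'\<close> is
  exact. Slopes below 1 thus occur only on the new part, which restores the conditional
  equality.\<close>

lemma extend_profile:
  assumes P: "profile c f f'" and c: "0 \<le> c" "c < c'"
  shows "\<exists>g'. profile c' (extend c' f (least_argmin (gfun c' f))) g'"
proof -
  define Z where "Z = least_argmin (gfun c' f)"
  note Z = least_argmin_props[OF P c, folded Z_def]
  show ?thesis
  proof (cases "0 < Z")
    case False
    then have "Z = 0" using Z(1) by simp
    then have "extend c' f Z = (\<lambda>x. (c' + Lam) / q * (1 - exp (\<theta>\<^sub>1 c' * x)))"
      using P by (auto simp: extend_def gfun_def profile_def)
    then show ?thesis
      using profile_exp[of c'] c unfolding Z_def[symmetric] by auto
  next
    case Zpos: True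
    define k where "k = (c' + Lam) / q"
    have k: "0 < k" unfolding k_def using c q_pos Lam_pos by simp
    have kq: "c' + Lam = q * k" using q_pos by (simp add: k_def)
    define m where "m = - \<theta>\<^sub>1 c'"
    have m: "0 < m" using theta1_neg by (simp add: m_def)
    define B where "B = gfun c' f Z"
    let ?e = "\<lambda>x. k * (1 - B * exp (- m * x))"
    let ?e' = "\<lambda>x. k * m * B * exp (- m * x)"
    let ?e2 = "\<lambda>x. - k * m\<^sup>2 * B * exp (- m * x)"
    have f': "(f has_real_derivative f' x) (at x)" for x
      using P unfolding profile_def by blast
    have fk: "f x < k" for x
      using profile_less[OF P, of x] c q_pos divide_strict_right_mono[of "c + Lam" "c' + Lam" q]
      by (simp add: k_def)
    have B: "k * (B * exp (- m * Z)) = k - f Z"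
      using k q_pos unfolding B_def gfun_def kq m_def
      by (simp add: mult.assoc exp_add[symmetric] right_diff_distrib)
    then have Bpos: "0 < B"
      using fk[of Z] k by (metis diff_gt_0_iff_gt exp_gt_zero zero_less_mult_pos zero_less_mult_pos2)
    have e_Z: "?e Z = f Z" using B by (simp add: algebra_simps)
    \<comment> \<open>The coefficient \<open>B\<close> already matches the values at
      \<open>Z\<close>; the vanishing of \<open>wronski\<close> there is precisely the matching of
      slopes.\<close>
    have "f' Z = m * (k - f Z)"
      using Z(3)[OF Zpos] unfolding wronski_def k_def[symmetric] m_def
      by simp (simp add: algebra_simps)
    then have e'_Z: "?e' Z = f' Z" unfolding B[symmetric] by simp
    have e': "(?e has_real_derivative ?e' x) (at x)" for x
      by (auto intro!: derivative_eq_intros)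
    have e2: "(?e' has_real_derivative ?e2 x) (at x)" for x
      by (auto intro!: derivative_eq_intros simp: power2_eq_square)
    have pde_e: "pde c' (?e x) (?e' x) (?e2 x) = 0" for x
    proof -
      have "pde c' (?e x) (?e' x) (?e2 x)
        = - k * B * exp (- m * x) * (sig\<^sup>2 * m\<^sup>2 / 2 - (mu - c') * m - q)"
        unfolding pde_def add.assoc kq by (simp add: field_simps)
      moreover have "sig\<^sup>2 * m\<^sup>2 / 2 - (mu - c') * m - q = 0"
        using theta1_char[of c'] by (simp add: m_def)
      ultimately show ?thesis by simp
    qed
    obtain f2 F where "finite F" and F: "\<And>x. x \<notin> F \<Longrightarrow> (f' has_real_derivative f2 x) (at x)"
      "\<And>x. x \<notin> F \<Longrightarrow> pde c (f x) (f' x) (f2 x) \<le> 0"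
      using P unfolding profile_def by blast
    define g where "g x = (if x \<le> Z then f x else ?e x)" for x
    define g' where "g' x = (if x \<le> Z then f' x else ?e' x)" for x
    define g2 where "g2 x = (if x \<le> Z then f2 x else ?e2 x)" for x
    have ext: "extend c' f Z = g"
      using Zpos by (auto simp: extend_def g_def k_def B_def m_def)
    have f'anti: "f' y \<le> f' x" if "x \<le> y" for x y
      using profile_deriv_antimono[OF P that] .
    have e'anti: "?e' y \<le> ?e' x" if "x \<le> y" for x y
      using k m Bpos that by (intro mult_left_mono) auto
    have "profile c' g g'"
      unfolding profile_def
    proof (intro conjI allI)
      show "(g has_real_derivative g' x) (at x)" for x
        unfolding g_def[abs_def] g'_def using e_Z e'_Z by (intro DERIV_if_glue f' e') auto
      have "continuous_on ({..Z} \<union> {Z..}) g'"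
        unfolding g'_def[abs_def] using P e'_Z
        by (intro continuous_on_If) (auto intro!: continuous_intros simp: profile_def
           intro: continuous_on_subset[of UNIV])
      moreover have "{..Z} \<union> {Z..} = UNIV" by auto
      ultimately show "continuous_on UNIV g'" by simp
      show "\<exists>g2 F. finite F \<and> (\<forall>x. x \<notin> F \<longrightarrow> (g' has_real_derivative g2 x) (at x) \<and>
        pde c' (g x) (g' x) (g2 x) \<le> 0 \<and> (g' x < 1 \<longrightarrow> pde c' (g x) (g' x) (g2 x) = 0))"
      proof (intro exI[of _ g2] exI[of _ "insert Z F"] conjI allI impI)
        show "finite (insert Z F)" using \<open>finite F\<close> by simp
        fix x assume x: "x \<notin> insert Z F"
        show "(g' has_real_derivative g2 x) (at x)"
        proof (cases "x < Z")
          case True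
          have "(f' has_real_derivative g2 x) (at x)"
            using F(1)[of x] x True by (simp add: g2_def)
          moreover have "\<forall>\<^sub>F y in nhds x. f' y = g' y"
            using eventually_nhds_in_open[of "{..<Z}" x] True
            by (auto simp: g'_def elim: eventually_mono)
          ultimately show ?thesis
            by (simp add: DERIV_cong_ev)
        next
          case False
          have "(?e' has_real_derivative g2 x) (at x)"
            using e2[of x] x False by (simp add: g2_def)
          moreover have "\<forall>\<^sub>F y in nhds x. ?e' y = g' y"
            using eventually_nhds_in_open[of "{Z<..}" x] False x
            by (auto simp: g'_def elim: eventually_mono)
          ultimately show ?thesis
            using DERIV_cong_ev[of x x ?e' g' "g2 x" "g2 x"] by simp
        qed
        have *: "1 \<le> f' x" if "x \<le> Z" using Z(4)[OF Zpos] f'anti[OF that] by simp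
        show "pde c' (g x) (g' x) (g2 x) \<le> 0"
        proof (cases "x \<le> Z")
          case True
          then show ?thesis
            using *[OF True] F(2)[of x] x c mult_nonneg_nonpos[of "c' - c" "1 - f' x"]
            unfolding pde_add_rate[of c' _ _ _ c] by (simp add: g_def g'_def g2_def)
        next
          case False
          then show ?thesis using pde_e[of x] unfolding g_def g'_def g2_def by simp
        qed
        assume "g' x < 1"
        then have "\<not> x \<le> Z" using * by (auto simp: g'_def)
        then show "pde c' (g x) (g' x) (g2 x) = 0"
          using pde_e[of x] unfolding g_def g'_def g2_def by simp
      qed
      show "antimono g'"
      proof (rule antimonoI)
        fix x y :: real assume "x \<le> y"
        then show "g' y \<le> g' x"
          using f'anti[of x y] e'anti[of x y] f'anti[of x Z] e'anti[of Z y] e'_Z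
          unfolding g'_def by (auto split: if_splits)
      qed
      show "0 < g' x" for x
        using P k m Bpos unfolding g'_def profile_def by auto
      show "g 0 = 0" using P Zpos by (simp add: g_def profile_def)
      show "g x < (c' + Lam) / q" for x
        using fk[of x] k Bpos mult_strict_left_mono[OF _ k, of "1 - B * exp (- m * x)" 1]
        unfolding g_def k_def[symmetric] by simp
      obtain K a where "0 \<le> K" "0 \<le> a" "\<And>x. x \<le> 0 \<Longrightarrow> - K * exp (- a * x) \<le> f x"
        using P unfolding profile_def by blast
      then show "\<exists>K a. 0 \<le> K \<and> 0 \<le> a \<and> (\<forall>x\<le>0. - K * exp (- a * x) \<le> g x)"
        using Zpos by (intro exI[of _ K] exI[of _ a]) (auto simp: g_def)
    qed
    then show ?thesis using ext unfolding Z_def by auto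
  qed
qed

end

subsection \<open>Brownian increments are independent of the completed past\<close>

text \<open>Exponential tilting of a centred Gaussian moves its mean to a s^2; the constant comes
  from completing the square.\<close>

lemma normal_density_exp:
  fixes a s :: real
  assumes "0 < s"
  shows "normal_density 0 s y * exp (a * y) = exp (a\<^sup>2 * s\<^sup>2 / 2) * normal_density (a * s\<^sup>2) s y"
proof -
  have "- (y - 0)\<^sup>2 / (2 * s\<^sup>2) + a * y = a\<^sup>2 * s\<^sup>2 / 2 + - (y - a * s\<^sup>2)\<^sup>2 / (2 * s\<^sup>2)"
    using assms by (simp add: field_simps power2_eq_square)
  then have "exp (- (y - 0)\<^sup>2 / (2 * s\<^sup>2)) * exp (a * y)
      = exp (a\<^sup>2 * s\<^sup>2 / 2) * exp (- (y - a * s\<^sup>2)\<^sup>2 / (2 * s\<^sup>2))"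
    by (simp only: exp_add[symmetric])
  then show ?thesis unfolding normal_density_def by simp
qed

lemma normal_mgf:
  fixes a s :: real
  assumes "0 < s" and D: "distributed M lborel X (\<lambda>y. ennreal (normal_density 0 s y))"
  shows "integrable M (\<lambda>\<omega>. exp (a * X \<omega>))" (is ?i)
    and "integral\<^sup>L M (\<lambda>\<omega>. exp (a * X \<omega>)) = exp (a\<^sup>2 * s\<^sup>2 / 2)" (is ?e)
proof -
  have *: "(\<lambda>y. normal_density 0 s y * exp (a * y)) = (\<lambda>y. exp (a\<^sup>2 * s\<^sup>2 / 2) * normal_density (a * s\<^sup>2) s y)"
    using normal_density_exp[OF assms(1)] by (simp add: fun_eq_iff)
  have "integrable lborel (\<lambda>y. normal_density 0 s y * exp (a * y))"
    unfolding * using assms(1) by (intro integrable_mult_right integrable_normal_density)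
  then show ?i
    by (subst (asm) distributed_integrable[OF D]) auto
  have "(LINT y|lborel. normal_density 0 s y * exp (a * y)) = exp (a\<^sup>2 * s\<^sup>2 / 2)"
    unfolding * using assms(1) by simp
  then show ?e
    by (subst (asm) distributed_integral[OF D]) auto
qed

lemma Int_stable_vimage: "Int_stable {X -` A \<inter> S |A. A \<in> sets N}"
proof (rule Int_stableI, safe)
  fix A B assume "A \<in> sets N" "B \<in> sets N"
  then show "\<exists>C. X -` A \<inter> S \<inter> (X -` B \<inter> S) = X -` C \<inter> S \<and> C \<in> sets N"
    by (intro exI[of _ "A \<inter> B"]) auto
qed

text \<open>The past seen at finitely many times, so that independence of increments on a finite
  grid applies. Dyadic refinement makes these sigma-algebras nested, so their union is closed under
  intersection.\<close>

definition dyadic_past :: "'a measure \<Rightarrow> (real \<Rightarrow> 'a \<Rightarrow> real) \<Rightarrow> real \<Rightarrow> nat \<Rightarrow> 'a set set" where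
  "dyadic_past M W t m = sigma_sets (space M)
     {W (t * real j / 2 ^ m) -` B \<inter> space M | j B. j \<le> 2 ^ m \<and> B \<in> sets borel}"

lemma dyadic_past_mono: "m \<le> m' \<Longrightarrow> dyadic_past M W t m \<subseteq> dyadic_past M W t m'"
proof -
  assume "m \<le> m'"
  then obtain d where d: "m' = m + d" using le_Suc_ex by blast
  have "\<exists>j'. W (t * real j / 2 ^ m) = W (t * real j' / 2 ^ m') \<and> j' \<le> 2 ^ m'" if "j \<le> 2 ^ m" for j :: nat
    using that by (intro exI[of _ "j * 2 ^ d"]) (simp add: d power_add)
  then show ?thesis
    unfolding dyadic_past_def by (intro sigma_sets_mono' subsetI) (fastforce simp del: times_divide_eq_right)
qed

text \<open>Independence of increments is assumed for strictly increasing times. For t = 0 all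
  dyadic times coincide and the grid collapses to {0, d}; otherwise t + d is appended to the dyadic
  points.\<close>

lemma past_grid:
  fixes t d :: real
  assumes "0 \<le> t" "0 < d"
  shows "\<exists>(K::nat) ts. ts 0 = 0 \<and> (\<forall>j<Suc K. ts j < ts (Suc j)) \<and> ts K = t \<and> ts (Suc K) = t + d \<and>
    (\<forall>j\<le>2 ^ m. \<exists>i\<le>K. t * real j / 2 ^ m = ts i)"
proof (cases "t = 0")
  case True
  then show ?thesis using assms by (intro exI[of _ 0] exI[of _ "\<lambda>j. d * real j"]) auto
next
  case False
  define ts where "ts j = (if j \<le> 2 ^ m then t * real j / 2 ^ m else t + d)" for j :: nat
  show ?thesis
    using False assms
    by (intro exI[of _ "2 ^ m"] exI[of _ ts]) (auto simp: ts_def divide_strict_right_mono not_le less_Suc_eq_le)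
qed

text \<open>Since W starts at 0, its values at the grid times are partial sums of the first
  \<open>K\<close> increments. Every event of the dyadic past is therefore a preimage under the
  vector of those increments, which is independent of the increment number \<open>K\<close>.\<close>

lemma std_BM_dyadic_past_indep:
  assumes BM: "std_BM M W" and t: "0 \<le> t" "0 < d"
    and A: "A \<in> dyadic_past M W t m" and B: "B \<in> sets borel"
  shows "measure M (A \<inter> ((\<lambda>\<omega>. W (t + d) \<omega> - W t \<omega>) -` B \<inter> space M))
    = measure M A * measure M ((\<lambda>\<omega>. W (t + d) \<omega> - W t \<omega>) -` B \<inter> space M)"
    and "A \<in> sets M"
proof -
  interpret prob_space M using BM by (simp add: std_BM_def)
  have W[measurable]: "W u \<in> borel_measurable M" for u
    using BM by (simp add: std_BM_def)
  have W0: "W 0 \<omega> = 0" if "\<omega> \<in> space M" for \<omega>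
    using BM that by (simp add: std_BM_def)
  obtain K :: nat and ts where ts: "ts 0 = 0" "\<And>j. j < Suc K \<Longrightarrow> ts j < ts (Suc j)" "ts K = t"
    "ts (Suc K) = t + d" "\<And>j. j \<le> 2 ^ m \<Longrightarrow> \<exists>i\<le>K. t * real j / 2 ^ m = ts i"
    using past_grid[OF t, of m] by blast
  define inc where "inc j \<omega> = W (ts (Suc j)) \<omega> - W (ts j) \<omega>" for j \<omega>
  have "indep_vars (\<lambda>_. borel) inc {..<Suc K}"
    using BM ts unfolding std_BM_def inc_def[abs_def] by simp
  then have ind: "indep_var (PiM {..<K} (\<lambda>_. borel)) (\<lambda>\<omega>. restrict (\<lambda>i. inc i \<omega>) {..<K})
      (PiM {K} (\<lambda>_. borel)) (\<lambda>\<omega>. restrict (\<lambda>i. inc i \<omega>) {K})"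
    by (rule indep_var_restrict) auto
  let ?v = "\<lambda>\<omega>. restrict (\<lambda>i. inc i \<omega>) {..<K}"
  let ?P = "PiM {..<K} (\<lambda>_. borel :: real measure)"
  let ?V = "vimage_algebra (space M) ?v ?P"
  have v: "?v \<in> space M \<rightarrow> space ?P" by (auto simp: space_PiM)
  have v_meas: "?v \<in> measurable ?V ?P" using v by (rule measurable_vimage_algebra1)
  have W_grid: "W (ts i) \<in> borel_measurable ?V" if "i \<le> K" for i
  proof -
    have sum_inc: "W (ts i) \<omega> = (\<Sum>l<i. inc l \<omega>)" if "\<omega> \<in> space M" for \<omega>
      using W0[OF that] ts(1) sum_lessThan_telescope[of "\<lambda>l. W (ts l) \<omega>" i] by (simp add: inc_def)
    have "(\<lambda>\<omega>. ?v \<omega> l) \<in> borel_measurable ?V" if "l < K" for l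
      using that by (intro measurable_compose[OF v_meas measurable_component_singleton]) simp
    then have "(\<lambda>\<omega>. \<Sum>l<i. ?v \<omega> l) \<in> borel_measurable ?V"
      using \<open>i \<le> K\<close> by (intro borel_measurable_sum) simp
    also have "?this \<longleftrightarrow> ?thesis"
    proof (rule measurable_cong)
      fix w assume "w \<in> space ?V"
      then show "(\<Sum>l<i. ?v w l) = W (ts i) w"
        using sum_inc[of w] \<open>i \<le> K\<close> by (auto intro!: sum.cong)
    qed
    finally show ?thesis .
  qed
  have "dyadic_past M W t m \<subseteq> sets ?V"
    unfolding dyadic_past_def
  proof -
    have "{W (t * real j / 2 ^ m) -` B \<inter> space M |j B. j \<le> 2 ^ m \<and> B \<in> sets borel} \<subseteq> sets ?V"
    proof safe
      fix j B assume "j \<le> (2 ^ m :: nat)" "B \<in> sets (borel :: real measure)"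
      moreover obtain i where "i \<le> K" "t * real j / 2 ^ m = ts i"
        using ts(5)[OF \<open>j \<le> 2 ^ m\<close>] by auto
      ultimately show "W (t * real j / 2 ^ m) -` B \<inter> space M \<in> sets ?V"
        using measurable_sets[OF W_grid[of i], of B] by simp
    qed
    then have "sigma_sets (space ?V) {W (t * real j / 2 ^ m) -` B \<inter> space M |j B. j \<le> 2 ^ m \<and> B \<in> sets borel} \<subseteq> sets ?V"
      by (rule sets.sigma_sets_subset)
    then show "sigma_sets (space M) {W (t * real j / 2 ^ m) -` B \<inter> space M |j B. j \<le> 2 ^ m \<and> B \<in> sets borel} \<subseteq> sets ?V"
      by simp
  qed
  then obtain E where E: "E \<in> sets ?P" "A = ?v -` E \<inter> space M"
    using A v by (auto simp: sets_vimage_algebra2)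
  have inc_K: "inc K = (\<lambda>\<omega>. W (t + d) \<omega> - W t \<omega>)"
    by (simp add: inc_def[abs_def] ts)
  \<comment> \<open>The event is coded by its indicator and recovered from the test set {1}, which
    turns independence of variables into the product formula for sets.\<close>
  have "indep_var borel ((indicator E :: _ \<Rightarrow> real) \<circ> ?v)
      borel ((\<lambda>f. f K) \<circ> (\<lambda>\<omega>. restrict (\<lambda>i. inc i \<omega>) {K}))"
    using E(1) by (intro indep_var_compose[OF ind]) (auto intro: measurable_component_singleton)
  from indep_varD[OF this, of "{1}" B] B
  have "prob ((\<lambda>\<omega>. (indicator E (?v \<omega>) :: real, inc K \<omega>)) -` ({1} \<times> B) \<inter> space M)
    = prob ((\<lambda>\<omega>. indicator E (?v \<omega>) :: real) -` {1} \<inter> space M) * prob (inc K -` B \<inter> space M)"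
    by (simp add: comp_def)
  moreover have "(\<lambda>\<omega>. (indicator E (?v \<omega>) :: real, inc K \<omega>)) -` ({1} \<times> B) \<inter> space M = A \<inter> (inc K -` B \<inter> space M)"
    "(\<lambda>\<omega>. indicator E (?v \<omega>) :: real) -` {1} \<inter> space M = A"
    unfolding E(2) by (auto simp: indicator_def split: if_splits)
  ultimately show "measure M (A \<inter> ((\<lambda>\<omega>. W (t + d) \<omega> - W t \<omega>) -` B \<inter> space M))
    = measure M A * measure M ((\<lambda>\<omega>. W (t + d) \<omega> - W t \<omega>) -` B \<inter> space M)"
    unfolding inc_K by simp
  have "?v \<in> measurable M ?P" unfolding inc_def by measurable
  then show "A \<in> sets M" using E measurable_sets by blast
qed

section \<open>The filtration as an abstract structure\<close>

definition filt_measure :: "'a measure \<Rightarrow> (real \<Rightarrow> 'a \<Rightarrow> real) \<Rightarrow> real \<Rightarrow> real \<Rightarrow> real \<Rightarrow> real \<Rightarrow> 'a measure" where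
  "filt_measure M W mu sig x t = sigma (space M) (filt M W mu sig x t)"

lemma space_filt_measure [simp]: "space (filt_measure M W mu sig x t) = space M"
  by (simp add: filt_measure_def space_measure_of_conv)

lemma sets_filt_measure: "sets (filt_measure M W mu sig x t) = filt M W mu sig x t"
proof -
  have "filt M W mu sig x t \<subseteq> Pow (space M)"
    unfolding filt_def by (auto dest: sigma_sets_into_sp[rotated])
  then have "sets (filt_measure M W mu sig x t) = sigma_sets (space M) (filt M W mu sig x t)"
    unfolding filt_measure_def by (rule sets_measure_of)
  also have "\<dots> = filt M W mu sig x t"
    unfolding filt_def by (rule sigma_sets_sigma_sets_eq) auto
  finally show ?thesis .
qed

text \<open>\<open>N\<close> will be the completion of the given space, since the filtration
  contains all subsets of null sets. Conditional expectations are avoided by stating independence of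
  each increment from every real variable measurable at its starting time.\<close>

locale bm_filtration = prob_space N for N :: "'a measure" +
  fixes W :: "real \<Rightarrow> 'a \<Rightarrow> real" and F :: "real \<Rightarrow> 'a measure"
  assumes W0: "\<omega> \<in> space N \<Longrightarrow> W 0 \<omega> = 0"
    and W_cont: "\<omega> \<in> space N \<Longrightarrow> continuous_on {0..} (\<lambda>t. W t \<omega>)"
    and space_F: "space (F t) = space N"
    and F_sub: "0 \<le> t \<Longrightarrow> sets (F t) \<subseteq> sets N"
    and F_mono: "0 \<le> s \<Longrightarrow> s \<le> t \<Longrightarrow> sets (F s) \<subseteq> sets (F t)"
    and adapted: "0 \<le> t \<Longrightarrow> W t \<in> borel_measurable (F t)"
    and incr_indep: "0 \<le> t \<Longrightarrow> 0 < d \<Longrightarrow> Z \<in> borel_measurable (F t) \<Longrightarrow>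
       indep_var borel (Z :: 'a \<Rightarrow> real) borel (\<lambda>\<omega>. W (t + d) \<omega> - W t \<omega>)"
    and incr_normal: "0 \<le> t \<Longrightarrow> 0 < d \<Longrightarrow>
       distributed N lborel (\<lambda>\<omega>. W (t + d) \<omega> - W t \<omega>) (\<lambda>y. ennreal (normal_density 0 (sqrt d) y))"
begin

text \<open>Plays the role of conditioning on the past: the next increment is integrated out against
  an arbitrary integrable weight known at its start.\<close>

lemma incr_mgf:
  fixes Z :: "'a \<Rightarrow> real"
  assumes "0 \<le> t" "0 < d" "Z \<in> borel_measurable (F t)" "integrable N Z"
  shows "integrable N (\<lambda>\<omega>. Z \<omega> * exp (a * (W (t + d) \<omega> - W t \<omega>)))"
    and "expectation (\<lambda>\<omega>. Z \<omega> * exp (a * (W (t + d) \<omega> - W t \<omega>))) = expectation Z * exp (a\<^sup>2 * d / 2)"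
proof -
  have "indep_var borel (id \<circ> Z) borel ((\<lambda>y. exp (a * y)) \<circ> (\<lambda>\<omega>. W (t + d) \<omega> - W t \<omega>))"
    by (rule indep_var_compose[OF incr_indep[OF assms(1-3)]]) auto
  then have ind: "indep_var borel Z borel (\<lambda>\<omega>. exp (a * (W (t + d) \<omega> - W t \<omega>)))"
    by (simp add: comp_def)
  note mgf = normal_mgf[OF _ incr_normal[OF assms(1,2)], of a]
  show "integrable N (\<lambda>\<omega>. Z \<omega> * exp (a * (W (t + d) \<omega> - W t \<omega>)))"
    using assms by (intro indep_var_integrable[OF ind] mgf) auto
  show "expectation (\<lambda>\<omega>. Z \<omega> * exp (a * (W (t + d) \<omega> - W t \<omega>))) = expectation Z * exp (a\<^sup>2 * d / 2)"
    using assms mgf by (subst indep_var_lebesgue_integral[OF ind]) auto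
qed

end

text \<open>\<open>R\<close> collects the events equal almost surely to an event of some dyadic
  past. It is closed under intersection, so independence extends to the sigma-algebra it generates.
  That one contains all null sets and, by continuity of paths along dyadic times, every W s with s
  \<le> t, hence all of \<open>filt\<close>.\<close>

lemma std_BM_past_indep:
  fixes W :: "real \<Rightarrow> 'a \<Rightarrow> real"
  assumes BM: "std_BM M W" and t: "0 \<le> t" "0 < d"
  shows "prob_space.indep_set (completion M) (filt M W mu sig x t)
     {(\<lambda>\<omega>. W (t + d) \<omega> - W t \<omega>) -` B \<inter> space M | B. B \<in> sets borel}"
proof -
  interpret P: prob_space M using BM by (simp add: std_BM_def)
  interpret prob_space "completion M" by (rule P.prob_space_completion)
  have W[measurable]: "W u \<in> borel_measurable M" for u
    using BM by (simp add: std_BM_def)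
  let ?inc = "\<lambda>\<omega>. W (t + d) \<omega> - W t \<omega>"
  define Q where "Q = {?inc -` B \<inter> space M | B. B \<in> sets borel}"
  define R where "R = {A \<in> sets (completion M). \<exists>m. \<exists>A'\<in>dyadic_past M W t m.
     AE \<omega> in completion M. \<omega> \<in> A \<longleftrightarrow> \<omega> \<in> A'}"
  have dyadic_sets: "dyadic_past M W t m \<subseteq> sets M" for m
    using std_BM_dyadic_past_indep(2)[OF BM t, of _ m UNIV] by auto
  have Q_sets: "Q \<subseteq> sets M" unfolding Q_def by auto
  have indep: "indep_set R Q"
  proof (rule indep_setI)
    show "R \<subseteq> sets (completion M)" "Q \<subseteq> sets (completion M)"
      using Q_sets by (auto simp: R_def)
    fix A b assume A: "A \<in> R" and b: "b \<in> Q"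
    then obtain m A' where A': "A' \<in> dyadic_past M W t m" "AE \<omega> in completion M. \<omega> \<in> A \<longleftrightarrow> \<omega> \<in> A'"
      unfolding R_def by auto
    have s: "A \<in> sets (completion M)" "A' \<in> sets M" "b \<in> sets M" "A' \<in> sets (completion M)" "b \<in> sets (completion M)"
      using A A' b dyadic_sets Q_sets by (auto simp: R_def)
    have "prob (A \<inter> b) = prob (A' \<inter> b)"
      using s A'(2) by (intro finite_measure_eq_AE) (auto elim: AE_mp)
    also have "\<dots> = P.prob (A' \<inter> b)" using s by (simp add: measure_completion)
    also have "\<dots> = P.prob A' * P.prob b"
      using b std_BM_dyadic_past_indep(1)[OF BM t A'(1)] unfolding Q_def by auto
    also have "\<dots> = prob A' * prob b" using s by (simp add: measure_completion)
    also have "prob A' = prob A"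
      using s A'(2) by (intro finite_measure_eq_AE) (auto elim: AE_mp)
    finally show "prob (A \<inter> b) = prob A * prob b" .
  qed
  have R_stable: "Int_stable R"
  proof (rule Int_stableI)
    fix A B assume "A \<in> R" "B \<in> R"
    then obtain m1 A' m2 B' where *: "A \<in> sets (completion M)" "B \<in> sets (completion M)"
      "A' \<in> dyadic_past M W t m1" "AE \<omega> in completion M. \<omega> \<in> A \<longleftrightarrow> \<omega> \<in> A'"
      "B' \<in> dyadic_past M W t m2" "AE \<omega> in completion M. \<omega> \<in> B \<longleftrightarrow> \<omega> \<in> B'"
      unfolding R_def by blast
    have "A' \<in> dyadic_past M W t (max m1 m2)" "B' \<in> dyadic_past M W t (max m1 m2)"
      using *(3,5) dyadic_past_mono[of m1 "max m1 m2" M W t] dyadic_past_mono[of m2 "max m1 m2" M W t] by auto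
    moreover have "sigma_algebra (space M) (dyadic_past M W t (max m1 m2))"
      unfolding dyadic_past_def by (rule sigma_algebra_sigma_sets) auto
    ultimately have "A' \<inter> B' \<in> dyadic_past M W t (max m1 m2)"
      by (meson sigma_algebra.axioms(1) algebra.axioms(1) ring_of_sets.axioms(1) semiring_of_sets.Int)
    moreover have "AE \<omega> in completion M. \<omega> \<in> A \<inter> B \<longleftrightarrow> \<omega> \<in> A' \<inter> B'"
      using *(4,6) by eventually_elim auto
    ultimately show "A \<inter> B \<in> R" using *(1,2) unfolding R_def by blast
  qed
  have Q_stable: "Int_stable Q" unfolding Q_def by (rule Int_stable_vimage)
  have "indep_set (sigma_sets (space (completion M)) R) (sigma_sets (space (completion M)) Q)"
    by (rule indep_set_sigma_sets[OF indep R_stable Q_stable])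
  then have big: "indep_set (sigma_sets (space M) R) (sigma_sets (space M) Q)" by simp
  let ?S = "sigma (space M) R"
  have R_Pow: "R \<subseteq> Pow (space M)" using sets.sets_into_space[of _ "completion M"] by (auto simp: R_def)
  then have sets_S: "sets ?S = sigma_sets (space M) R" and space_S: "space ?S = space M" by auto
  have W_grid: "W (t * real j / 2 ^ m) \<in> borel_measurable ?S" if "j \<le> 2 ^ m" for j m :: nat
  proof (rule measurableI)
    fix B assume "B \<in> sets (borel :: real measure)"
    then have "W (t * real j / 2 ^ m) -` B \<inter> space M \<in> dyadic_past M W t m"
      unfolding dyadic_past_def using that by blast
    then have "W (t * real j / 2 ^ m) -` B \<inter> space M \<in> R"
      using dyadic_sets unfolding R_def
      by (intro CollectI conjI exI[of _ m] bexI[of _ "W (t * real j / 2 ^ m) -` B \<inter> space M"]) auto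
    then show "W (t * real j / 2 ^ m) -` B \<inter> space ?S \<in> sets ?S" unfolding sets_S space_S by auto
  qed auto
  have W_S: "W s \<in> borel_measurable ?S" if s: "0 \<le> s" "s \<le> t" for s
  proof (cases "t = 0")
    case True
    then show ?thesis using W_grid[of 0 0] s by simp
  next
    case False
    then have "0 < t" using t by simp
    define j where "j m = nat \<lfloor>2 ^ m * s / t\<rfloor>" for m :: nat
    have rj: "real (j m) = of_int \<lfloor>2 ^ m * s / t\<rfloor>" for m
      using s \<open>0 < t\<close> unfolding j_def by (simp add: of_nat_nat)
    have j: "j m \<le> 2 ^ m" for m
    proof -
      have "2 ^ m * s / t \<le> 2 ^ m" using s \<open>0 < t\<close> by (simp add: field_simps)
      moreover have "real (j m) \<le> 2 ^ m * s / t" unfolding rj by linarith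
      ultimately have "real (j m) \<le> real (2 ^ m)" by (simp only: of_nat_power of_nat_numeral)
      then show ?thesis by (simp only: of_nat_le_iff)
    qed
    have lim: "(\<lambda>m. t * real (j m) / 2 ^ m) \<longlonglongrightarrow> s"
    proof -
      have "filterlim (\<lambda>m::nat. 2 ^ m :: real) at_top sequentially" by real_asymp
      from filterlim_compose[OF floor_quotient_tendsto[of "s / t"] this]
      have "(\<lambda>m. real (j m) / 2 ^ m) \<longlonglongrightarrow> s / t" unfolding rj by simp
      from tendsto_mult_left[OF this, of t] show ?thesis using \<open>0 < t\<close> by simp
    qed
    show ?thesis
    proof (rule borel_measurable_LIMSEQ_real)
      fix \<omega> assume "\<omega> \<in> space ?S"
      then have "continuous_on {0..} (\<lambda>u. W u \<omega>)"
        using BM unfolding std_BM_def space_S by simp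
      then show "(\<lambda>m. W (t * real (j m) / 2 ^ m) \<omega>) \<longlonglongrightarrow> W s \<omega>"
        using lim s t by (intro continuous_on_tendsto_compose[where s="{0..}" and f="\<lambda>u. W u \<omega>"]) auto
    qed (rule W_grid[OF j])
  qed
  have "filt M W mu sig x t \<subseteq> sigma_sets (space M) R"
    unfolding filt_def
  proof (rule sigma_sets_mono, rule subsetI)
    fix G assume "G \<in> {Xproc W mu sig x s -` B \<inter> space M |s B. 0 \<le> s \<and> s \<le> t \<and> B \<in> sets borel} \<union>
      {N. N \<subseteq> space M \<and> (\<exists>A\<in>sets M. N \<subseteq> A \<and> emeasure M A = 0)}"
    then show "G \<in> sigma_sets (space M) R"
    proof
      assume "G \<in> {Xproc W mu sig x s -` B \<inter> space M |s B. 0 \<le> s \<and> s \<le> t \<and> B \<in> sets borel}"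
      then obtain s B where G: "G = Xproc W mu sig x s -` B \<inter> space M" "0 \<le> s" "s \<le> t" "B \<in> sets borel" by blast
      have "Xproc W mu sig x s \<in> borel_measurable ?S"
        using W_S[OF G(2,3)] unfolding Xproc_def[abs_def] by measurable
      then show ?thesis using measurable_sets[of _ ?S borel B] G sets_S space_S by metis
    next
      assume "G \<in> {N. N \<subseteq> space M \<and> (\<exists>A\<in>sets M. N \<subseteq> A \<and> emeasure M A = 0)}"
      then obtain A where A: "A \<in> null_sets M" "G \<subseteq> A" by (auto simp: null_sets_def)
      then have "G \<in> null_sets (completion M)"
        using null_sets_completion_subset[OF A(2)] null_sets_completionI by blast
      then have "AE \<omega> in completion M. \<omega> \<notin> G" "G \<in> sets (completion M)"
        by (auto intro: AE_not_in)
      moreover have "{} \<in> dyadic_past M W t 0" unfolding dyadic_past_def by (rule sigma_sets.Empty)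
      ultimately have "G \<in> R" unfolding R_def by (intro CollectI conjI exI bexI[of _ "{}"]) auto
      then show ?thesis by blast
    qed
  qed
  moreover have "Q \<subseteq> sigma_sets (space M) Q" by auto
  ultimately show ?thesis
    using big unfolding Q_def[symmetric] indep_set_def
    by (intro indep_sets_mono_sets[OF big[unfolded indep_set_def]]) (auto split: bool.split)
qed

theorem std_BM_bm_filtration:
  assumes BM: "std_BM M W" and sig: "0 < sig"
  shows "bm_filtration (completion M) W (filt_measure M W mu sig x)"
proof -
  interpret P: prob_space M using BM by (simp add: std_BM_def)
  interpret prob_space "completion M" by (rule P.prob_space_completion)
  have W[measurable]: "W u \<in> borel_measurable M" for u
    using BM by (simp add: std_BM_def)
  show ?thesis
  proof
    show "W 0 \<omega> = 0" "continuous_on {0..} (\<lambda>t. W t \<omega>)" if "\<omega> \<in> space (completion M)" for \<omega>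
      using BM that by (auto simp: std_BM_def)
    show "space (filt_measure M W mu sig x t) = space (completion M)" for t by simp
    show sub: "sets (filt_measure M W mu sig x t) \<subseteq> sets (completion M)" if "0 \<le> t" for t
      using indep_setD_ev1[OF std_BM_past_indep[OF BM that, of 1]] unfolding sets_filt_measure by simp
    show "sets (filt_measure M W mu sig x s) \<subseteq> sets (filt_measure M W mu sig x t)" if "0 \<le> s" "s \<le> t" for s t
      unfolding sets_filt_measure filt_def using that
      by (intro sigma_sets_mono') (auto intro: order_trans)
    show "W t \<in> borel_measurable (filt_measure M W mu sig x t)" if "0 \<le> t" for t
    proof -
      have "Xproc W mu sig x t \<in> borel_measurable (filt_measure M W mu sig x t)"
        by (rule measurableI) (use that in \<open>auto simp: sets_filt_measure filt_def intro!: sigma_sets.Basic\<close>)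
      \<comment> \<open>The filtration is generated by the drifted process; W is recovered from it
        because sig is positive.\<close>
      then have "(\<lambda>\<omega>. (Xproc W mu sig x t \<omega> - x - mu * t) / sig) \<in> borel_measurable (filt_measure M W mu sig x t)"
        by measurable
      moreover have "(\<lambda>\<omega>. (Xproc W mu sig x t \<omega> - x - mu * t) / sig) = W t"
        using sig by (auto simp: Xproc_def)
      ultimately show ?thesis by simp
    qed
    show "distributed (completion M) lborel (\<lambda>\<omega>. W (t + d) \<omega> - W t \<omega>) (\<lambda>y. ennreal (normal_density 0 (sqrt d) y))"
      if "0 \<le> t" "0 < d" for t d
    proof -
      have D: "distributed M lborel (\<lambda>\<omega>. W (t + d) \<omega> - W t \<omega>) (\<lambda>y. ennreal (normal_density 0 (sqrt (t + d - t)) y))"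
        using BM that unfolding std_BM_def by (metis less_add_same_cancel1)
      have "distr (completion M) lborel (\<lambda>\<omega>. W (t + d) \<omega> - W t \<omega>) = distr M lborel (\<lambda>\<omega>. W (t + d) \<omega> - W t \<omega>)"
        by (rule distr_completion) measurable
      then show ?thesis using D unfolding distributed_def by (auto intro: measurable_completion)
    qed
    show "indep_var borel Z borel (\<lambda>\<omega>. W (t + d) \<omega> - W t \<omega>)"
      if t: "0 \<le> t" "0 < d" and Z: "Z \<in> borel_measurable (filt_measure M W mu sig x t)" for t d and Z :: "_ \<Rightarrow> real"
    proof -
      let ?inc = "\<lambda>\<omega>. W (t + d) \<omega> - W t \<omega>"
      have Zsets: "Z -` A \<inter> space M \<in> filt M W mu sig x t" if "A \<in> sets borel" for A
        using measurable_sets[OF Z that] by (simp add: sets_filt_measure)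
      have Zm: "Z \<in> borel_measurable (completion M)"
        using measurable_sets[OF Z] sub[OF t(1)] by (intro measurableI) auto
      have incm: "?inc \<in> borel_measurable (completion M)"
        by (intro measurable_completion) measurable
      note I = std_BM_past_indep[OF BM t, of mu sig x]
      have "indep_set (sigma_sets (space (completion M)) {Z -` A \<inter> space (completion M) |A. A \<in> sets borel})
        (sigma_sets (space (completion M)) {?inc -` A \<inter> space (completion M) |A. A \<in> sets borel})"
      proof (rule indep_set_sigma_sets)
        show "indep_set {Z -` A \<inter> space (completion M) |A. A \<in> sets borel} {?inc -` A \<inter> space (completion M) |A. A \<in> sets borel}"
          unfolding indep_set_def
          by (rule indep_sets_mono_sets[OF I[unfolded indep_set_def]]) (auto split: bool.split intro: Zsets)
      qed (rule Int_stable_vimage)+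
      then show ?thesis unfolding indep_var_eq using Zm incm by simp
    qed
  qed
qed

subsection \<open>Upper bound for admissible controls\<close>

lemma exp_tail_integral:
  fixes q a :: real
  assumes "0 < q"
  shows "has_bochner_integral lborel (\<lambda>s. indicator {a..} s * exp (- q * s)) (exp (- q * a) / q)"
proof (rule has_bochner_integral_nn_integral)
  have "(\<integral>\<^sup>+ s. ennreal (exp (- q * s)) * indicator {a..} s \<partial>lborel) = ennreal (0 - (- exp (- q * a) / q))"
  proof (rule nn_integral_FTC_atLeast)
    show "((\<lambda>s. - exp (- q * s) / q) has_real_derivative exp (- q * s)) (at s)" for s
      using assms by (auto intro!: derivative_eq_intros)
    show "((\<lambda>s. - exp (- q * s) / q) \<longlongrightarrow> 0) at_top"
      using assms by real_asymp
  qed auto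
  then show "(\<integral>\<^sup>+ s. ennreal (indicator {a..} s * exp (- q * s)) \<partial>lborel) = ennreal (exp (- q * a) / q)"
    by (simp add: ennreal_mult'' mult.commute ennreal_indicator ennreal_mult)
qed (use assms in auto)

lemma exp_segment_integral:
  fixes q a b :: real
  assumes "0 < q" "a \<le> b"
  shows "has_bochner_integral lborel (\<lambda>s. indicator {a..<b} s * exp (- q * s)) ((exp (- q * a) - exp (- q * b)) / q)"
proof -
  have "has_bochner_integral lborel (\<lambda>s. indicator {a..} s * exp (- q * s) - indicator {b..} s * exp (- q * s))
     (exp (- q * a) / q - exp (- q * b) / q)"
    by (intro has_bochner_integral_diff exp_tail_integral assms)
  moreover have "(\<lambda>s. indicator {a..} s * exp (- q * s) - indicator {b..} s * exp (- q * s))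
    = (\<lambda>s. indicator {a..<b} s * exp (- q * s))"
    using assms by (auto simp: indicator_def fun_eq_iff)
  ultimately show ?thesis by (simp add: diff_divide_distrib)
qed

lemma discounted_constant_integral:
  fixes q k r :: real
  assumes "0 < q"
  shows "(\<integral>s. (indicator {0..} s * exp (- q * s)) * k \<partial>lborel) = k / q"
    and "0 \<le> r \<Longrightarrow> (\<integral>s. (indicator {0..<r} s * exp (- q * s)) * k \<partial>lborel) = k / q * (1 - exp (- q * r))"
  using has_bochner_integral_integral_eq[OF exp_tail_integral[OF assms, of 0]]
    has_bochner_integral_integral_eq[OF exp_segment_integral[OF assms, of 0 r]]
  unfolding integral_mult_left_zero by simp_all

lemma antimono_set_integrable:
  fixes g :: "real \<Rightarrow> real"
  assumes g: "\<And>s t. 0 \<le> s \<Longrightarrow> s \<le> t \<Longrightarrow> g t \<le> g s" and "\<And>t. 0 \<le> t \<Longrightarrow> 0 \<le> g t" and a: "0 \<le> a"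
  shows "set_integrable lborel {a..b} g"
proof -
  \<comment> \<open>Composing with max 0 freezes \<open>g\<close> at its value at 0 for negative
    times, where it is arbitrary; the result is monotone on the line and hence Borel.\<close>
  have "mono (\<lambda>t. - g (max 0 t))" using g by (intro monoI) auto
  then have "(\<lambda>t. - (- g (max 0 t))) \<in> borel_measurable borel"
    by (intro borel_measurable_uminus borel_measurable_mono)
  then have m: "(\<lambda>t. g (max 0 t)) \<in> borel_measurable lborel" by simp
  have "integrable lborel (\<lambda>t. indicator {a..b} t * g (max 0 t))"
  proof (rule integrableI_bounded_set[where A="{a..b}" and B="g 0"])
    show "AE t in lborel. t \<in> {a..b} \<longrightarrow> norm (indicator {a..b} t * g (max 0 t)) \<le> g 0"
      using assms by (auto simp: indicator_def)
  qed (use m in \<open>auto simp: emeasure_lborel_Icc_eq\<close>)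
  moreover have "indicator {a..b} t * g (max 0 t) = indicator {a..b} t *\<^sub>R g t" for t
    using a by (auto simp: indicator_def)
  ultimately show ?thesis unfolding set_integrable_def by simp
qed

lemma antimono_integral_step:
  fixes g :: "real \<Rightarrow> real"
  assumes g: "\<And>s t. 0 \<le> s \<Longrightarrow> s \<le> t \<Longrightarrow> g t \<le> g s" "\<And>t. 0 \<le> t \<Longrightarrow> 0 \<le> g t" and s: "0 \<le> s" "0 \<le> d"
  shows "(LINT u:{0..s}|lborel. g u) + d * g (s + d) \<le> (LINT u:{0..s+d}|lborel. g u)"
proof -
  have i: "set_integrable lborel {a..b} g" if "0 \<le> a" for a b
    using antimono_set_integrable[of g a b] g that by auto
  have "(LINT u:{0..s}|lborel. g u) + (LINT u:{s..s+d}|lborel. g u) = (LINT u:{0..s+d}|lborel. g u)"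
  proof -
    have "(LINT u:{0..s} \<union> {s..s+d}|lborel. g u) = (LINT u:{0..s}|lborel. g u) + (LINT u:{s..s+d}|lborel. g u)"
      using s by (intro set_integral_Un_AE i) (auto intro!: AE_I[where N="{s}"])
    moreover have "{0..s} \<union> {s..s+d} = {0..s+d}" using s by auto
    ultimately show ?thesis by simp
  qed
  moreover have "(LINT u:{s..s+d}|lborel. g (s + d)) \<le> (LINT u:{s..s+d}|lborel. g u)"
    using g s by (intro set_integral_mono i) (auto simp: set_integrable_def)
  moreover have "(LINT u:{s..s+d}|lborel. g (s + d)) = d * g (s + d)"
    using s by (simp add: set_lebesgue_integral_def)
  ultimately show ?thesis by simp
qed

text \<open>Right-endpoint sums lie below the integral of a nonincreasing function, and the
  left-endpoint sum exceeds the right one by the telescoping boundary term d (g 0 - g (k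
  d)).\<close>

lemma antimono_integral_riemann:
  fixes g :: "real \<Rightarrow> real"
  assumes g: "\<And>s t. 0 \<le> s \<Longrightarrow> s \<le> t \<Longrightarrow> g t \<le> g s" "\<And>t. 0 \<le> t \<Longrightarrow> 0 \<le> g t" and d: "0 \<le> d"
  shows "d * (\<Sum>l<k. g (real l * d)) - d * (g 0 - g (real k * d)) \<le> (LINT u:{0..real k * d}|lborel. g u)"
proof (induction k)
  case 0
  have "AE u in lborel. indicator {0..0} u *\<^sub>R g u = 0"
    by (rule AE_I[where N="{0}"]) (auto simp: indicator_def)
  then have "(LINT u:{0..0}|lborel. g u) = 0"
    unfolding set_lebesgue_integral_def by (rule integral_eq_zero_AE)
  then show ?case by simp
next
  case (Suc k)
  have "(LINT u:{0..real k * d}|lborel. g u) + d * g (real k * d + d) \<le> (LINT u:{0..real k * d+d}|lborel. g u)"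
    using d by (intro antimono_integral_step g) auto
  with Suc show ?case by (simp add: algebra_simps)
qed

locale dividend_setting = dividend_model mu sig q Lam + bm_filtration N W F
  for mu sig q Lam :: real and N :: "'a measure" and W F

context dividend_setting
begin

lemma F_measurable_mono:
  assumes "0 \<le> s" "s \<le> t" "f \<in> measurable (F s) K"
  shows "f \<in> measurable (F t) K"
  using assms F_mono[OF assms(1,2)] space_F by (auto simp: measurable_def)

lemma F_N_measurable: "0 \<le> t \<Longrightarrow> f \<in> measurable (F t) K \<Longrightarrow> f \<in> measurable N K"
  using F_sub[of t] space_F[of t] by (auto simp: measurable_def)

end

section \<open>Controls frozen on a time grid\<close>

text \<open>Candidates are indexed by the rate itself, because the current rate is random and is
  plugged in as the index. Their comparison is assumed on [0, \<infinity>) only, which is where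
  minimality of G provides it.\<close>

locale controlled = dividend_setting mu sig q Lam N W F
  for mu sig q Lam :: real and N :: "'a measure" and W F +
  fixes S :: "real set" and V V' :: "real \<Rightarrow> real \<Rightarrow> real" and C :: "real \<Rightarrow> 'a \<Rightarrow> real" and cm :: real
  assumes S: "finite S" "cm \<in> S" "\<And>c. c \<in> S \<Longrightarrow> 0 \<le> c" "\<And>c. c \<in> S \<Longrightarrow> c \<le> cm"
    and V: "\<And>c. c \<in> S \<Longrightarrow> profile c (V c) (V' c)"
    and V_mono: "\<And>c c' y. c \<in> S \<Longrightarrow> c' \<in> S \<Longrightarrow> c \<le> c' \<Longrightarrow> 0 \<le> y \<Longrightarrow> V c y \<le> V c' y"
    and C_S: "\<And>t \<omega>. 0 \<le> t \<Longrightarrow> \<omega> \<in> space N \<Longrightarrow> C t \<omega> \<in> S"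
    and C_anti: "\<And>s t \<omega>. 0 \<le> s \<Longrightarrow> s \<le> t \<Longrightarrow> \<omega> \<in> space N \<Longrightarrow> C t \<omega> \<le> C s \<omega>"
    and C_adapted: "\<And>t. 0 \<le> t \<Longrightarrow> C t \<in> borel_measurable (F t)"
begin

lemma growth: "\<exists>K a. 0 \<le> K \<and> 0 \<le> a \<and> (\<forall>c\<in>S. \<forall>x\<le>0. - K * exp (- a * x) \<le> V c x)"
proof -
  have "\<forall>c\<in>S. \<exists>K a. 0 \<le> K \<and> 0 \<le> a \<and> (\<forall>x\<le>0. - K * exp (- a * x) \<le> V c x)"
    using V unfolding profile_def by blast
  then obtain K a where Ka: "\<And>c. c \<in> S \<Longrightarrow> 0 \<le> K c \<and> 0 \<le> a c \<and> (\<forall>x\<le>0. - K c * exp (- a c * x) \<le> V c x)"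
    by metis
  show ?thesis
  proof (rule exI[of _ "\<Sum>c\<in>S. K c"], rule exI[of _ "\<Sum>c\<in>S. a c"], intro conjI ballI allI impI)
    show nn: "0 \<le> (\<Sum>c\<in>S. K c)" "0 \<le> (\<Sum>c\<in>S. a c)" using Ka by (auto intro: sum_nonneg)
    fix c x assume c: "c \<in> S" and x: "x \<le> (0::real)"
    have "K c \<le> (\<Sum>c\<in>S. K c)" "a c \<le> (\<Sum>c\<in>S. a c)"
      using c Ka S by (auto intro!: member_le_sum)
    then have "K c * exp (a c * (- x)) \<le> (\<Sum>c\<in>S. K c) * exp ((\<Sum>c\<in>S. a c) * (- x))"
      using c Ka x nn by (intro mult_mono) (auto intro!: mult_right_mono_neg)
    moreover have "- K c * exp (- a c * x) \<le> V c x"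
      using Ka[OF c] x by blast
    ultimately show "- (\<Sum>c\<in>S. K c) * exp (- (\<Sum>c\<in>S. a c) * x) \<le> V c x"
      by simp
  qed
qed

text \<open>The rate of each cell is read off at its left endpoint and is therefore known when the
  cell starts, independently of the Brownian increment over the cell.\<close>

definition X :: "real \<Rightarrow> real \<Rightarrow> nat \<Rightarrow> 'a \<Rightarrow> real" where
  "X y d k \<omega> = y + mu * (real k * d) + sig * W (real k * d) \<omega> - d * (\<Sum>l<k. C (real l * d) \<omega>)"

definition alive :: "real \<Rightarrow> real \<Rightarrow> nat \<Rightarrow> 'a \<Rightarrow> real" where
  "alive y d k \<omega> = (if \<forall>l\<le>k. 0 \<le> X y d l \<omega> then 1 else 0)"

lemma X_Suc: "X y d (Suc k) \<omega> = X y d k \<omega> + (mu - C (real k * d) \<omega>) * d + sig * (W (real k * d + d) \<omega> - W (real k * d) \<omega>)"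
  by (simp add: X_def algebra_simps)

lemma X_measurable: "0 \<le> d \<Longrightarrow> X y d k \<in> borel_measurable (F (real k * d))"
proof -
  assume d: "0 \<le> d"
  have "C (real l * d) \<in> borel_measurable (F (real k * d))" if "l < k" for l
    using d that by (intro F_measurable_mono[OF _ _ C_adapted]) (auto intro: mult_right_mono)
  moreover have "W (real k * d) \<in> borel_measurable (F (real k * d))"
    using d by (intro adapted) auto
  ultimately show ?thesis unfolding X_def[abs_def] by measurable
qed

lemma alive_measurable: "0 \<le> d \<Longrightarrow> alive y d k \<in> borel_measurable (F (real k * d))"
proof -
  assume d: "0 \<le> d"
  have [measurable]: "X y d l \<in> borel_measurable (F (real k * d))" if "l \<in> {..k}" for l
    using d that by (intro F_measurable_mono[OF _ _ X_measurable]) (auto intro: mult_right_mono)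
  have "Measurable.pred (F (real k * d)) (\<lambda>\<omega>. \<forall>l\<in>{..k}. 0 \<le> X y d l \<omega>)"
    by measurable
  then show ?thesis unfolding alive_def[abs_def] by simp
qed

lemma profile_bounds:
  assumes "c \<in> S" "0 \<le> y"
  shows "\<bar>V c y\<bar> \<le> (cm + Lam) / q" "\<bar>V' c y\<bar> \<le> (\<Sum>c\<in>S. V' c 0)"
proof -
  have "(c + Lam) / q \<le> (cm + Lam) / q" using S(4)[OF assms(1)] q_pos by (simp add: divide_right_mono)
  then show "\<bar>V c y\<bar> \<le> (cm + Lam) / q"
    using profile_nonneg[OF V[OF assms(1)] assms(2)] profile_less[OF V[OF assms(1)], of y] by simp
  have pos: "0 \<le> V' c' x" if "c' \<in> S" for c' x using V[OF that] unfolding profile_def by (simp add: less_imp_le)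
  have "V' c y \<le> V' c 0" using profile_deriv_antimono[OF V[OF assms(1)] assms(2)] .
  also have "\<dots> \<le> (\<Sum>c\<in>S. V' c 0)" using assms pos S by (intro member_le_sum) auto
  finally show "\<bar>V' c y\<bar> \<le> (\<Sum>c\<in>S. V' c 0)" using pos[OF assms(1)] by simp
qed

text \<open>Given the rate c at the start of the cell, the candidate after the cell is at most its
  tangent exact solution at the current point. Both exponentials of that solution have mean growth
  exp (q d), so the bound recombines into the current value and the reward. The last term pays for
  paths that fall below 0 during the cell, where the candidate may be negative.\<close>

lemma one_step:
  assumes d: "0 < d" and eta: "0 \<le> eta" and K: "0 \<le> K" and lam: "0 \<le> lam"
    and growth: "\<And>c x. c \<in> S \<Longrightarrow> x \<le> 0 \<Longrightarrow> - K * exp (- lam * x) \<le> V c x"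
  shows "expectation (\<lambda>\<omega>. alive y d (Suc k) \<omega> * V (C (real (Suc k) * d) \<omega>) (X y d (Suc k) \<omega> + eta))
     \<le> exp (q * d) * expectation (\<lambda>\<omega>. alive y d k \<omega> * V (C (real k * d) \<omega>) (X y d k \<omega> + eta))
       - (exp (q * d) - 1) * expectation (\<lambda>\<omega>. alive y d k \<omega> * ((C (real k * d) \<omega> + Lam) / q))
       + K * exp (- lam * (eta + (mu - cm) * d) + lam\<^sup>2 * sig\<^sup>2 * d / 2)"
proof -
  let ?t = "real k * d"
  have t: "0 \<le> ?t" using d by simp
  let ?a = "alive y d k" and ?X = "\<lambda>\<omega>. X y d k \<omega> + eta" and ?C = "C ?t"
  let ?D = "\<lambda>\<omega>. W (?t + d) \<omega> - W ?t \<omega>"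
  \<comment> \<open>Splitting over the finitely many rates makes roots and coefficients constant,
    while the weights \<open>Z1\<close>, \<open>Z2\<close> remain measurable at the start of the
    cell.\<close>
  define I where "I c \<omega> = ?a \<omega> * (if ?C \<omega> = c then 1 else 0)" for c \<omega>
  define Z1 where "Z1 c \<omega> = I c \<omega> * tan_coeff1 c (V c (?X \<omega>)) (V' c (?X \<omega>))" for c \<omega>
  define Z2 where "Z2 c \<omega> = I c \<omega> * tan_coeff2 c (V c (?X \<omega>)) (V' c (?X \<omega>))" for c \<omega>
  have [measurable]: "?C \<in> borel_measurable (F ?t)" "X y d k \<in> borel_measurable (F ?t)" "?a \<in> borel_measurable (F ?t)"
    using C_adapted[OF t] X_measurable[of d y k] alive_measurable[of d y k] d by auto
  have a01: "?a \<omega> = 0 \<or> ?a \<omega> = 1" "?a \<omega> = 1 \<longleftrightarrow> (\<forall>l\<le>k. 0 \<le> X y d l \<omega>)" for \<omega> by (auto simp: alive_def)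
  have Xpos: "0 \<le> ?X \<omega>" if "?a \<omega> \<noteq> 0" for \<omega> using that eta a01[of \<omega>] by auto
  have V_meas[measurable]: "V c \<in> borel_measurable borel" "V' c \<in> borel_measurable borel" if "c \<in> S" for c
    using profile_continuous[OF V[OF that], of UNIV] V[OF that] unfolding profile_def
    by (auto intro: borel_measurable_continuous_onI)
  have sum_I: "(\<Sum>c\<in>S. I c \<omega> * f c) = ?a \<omega> * f (?C \<omega>)" if "\<omega> \<in> space N" for \<omega> and f :: "real \<Rightarrow> real"
  proof -
    have "(\<Sum>c\<in>S. I c \<omega> * f c) = (\<Sum>c\<in>S. if ?C \<omega> = c then ?a \<omega> * f c else 0)"
      by (intro sum.cong) (auto simp: I_def)
    then show ?thesis using C_S[OF t that] S(1) by simp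
  qed
  have I_meas[measurable]: "I c \<in> borel_measurable (F ?t)" for c unfolding I_def[abs_def] by measurable
  have VX_meas: "(\<lambda>\<omega>. V c (?X \<omega>)) \<in> borel_measurable (F ?t)" "(\<lambda>\<omega>. V' c (?X \<omega>)) \<in> borel_measurable (F ?t)" if "c \<in> S" for c
    using that by measurable
  have I_int: "integrable N (\<lambda>\<omega>. I c \<omega> * g \<omega>)"
    if "g \<in> borel_measurable (F ?t)" "\<And>\<omega>. 0 \<le> ?X \<omega> \<Longrightarrow> \<bar>g \<omega>\<bar> \<le> B" "0 \<le> B" for c g B
  proof (rule integrable_const_bound[of _ B])
    show "AE \<omega> in N. norm (I c \<omega> * g \<omega>) \<le> B"
    proof (rule AE_I2)
      fix \<omega>
      show "norm (I c \<omega> * g \<omega>) \<le> B"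
        using that(2)[of \<omega>] that(3) Xpos[of \<omega>] a01(1)[of \<omega>] by (auto simp: I_def)
    qed
    show "(\<lambda>\<omega>. I c \<omega> * g \<omega>) \<in> borel_measurable N"
      using that(1) by (intro F_N_measurable[OF t]) measurable
  qed
  have IV: "integrable N (\<lambda>\<omega>. I c \<omega> * V c (?X \<omega>))" "integrable N (\<lambda>\<omega>. I c \<omega> * V' c (?X \<omega>))" if "c \<in> S" for c
    using I_int[OF VX_meas(1)[OF that], of "(cm + Lam) / q" c] I_int[OF VX_meas(2)[OF that], of "\<Sum>c\<in>S. V' c 0" c]
      profile_bounds[OF that] order_trans[OF abs_ge_zero profile_bounds(1)[OF that, of 0]]
      order_trans[OF abs_ge_zero profile_bounds(2)[OF that, of 0]] by auto
  have II: "integrable N (I c)" for c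
    using I_int[of "\<lambda>_. 1" 1 c] by simp
  have Z1: "Z1 c \<in> borel_measurable (F ?t)" "integrable N (Z1 c)" if "c \<in> S" for c
  proof -
    show "Z1 c \<in> borel_measurable (F ?t)"
      unfolding Z1_def[abs_def] tan_coeff1_def using VX_meas[OF that] by measurable
    have "Z1 c = (\<lambda>\<omega>. (\<theta>\<^sub>2 c * (I c \<omega> * V c (?X \<omega>) - I c \<omega> * ((c + Lam) / q)) - I c \<omega> * V' c (?X \<omega>)) / (\<theta>\<^sub>2 c - \<theta>\<^sub>1 c))"
      unfolding Z1_def tan_coeff1_def by (auto simp: algebra_simps)
    then show "integrable N (Z1 c)" using IV[OF that] II by simp
  qed
  have Z2: "Z2 c \<in> borel_measurable (F ?t)" "integrable N (Z2 c)" if "c \<in> S" for c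
  proof -
    show "Z2 c \<in> borel_measurable (F ?t)"
      unfolding Z2_def[abs_def] tan_coeff2_def using VX_meas[OF that] by measurable
    have "Z2 c = (\<lambda>\<omega>. (I c \<omega> * V' c (?X \<omega>) - \<theta>\<^sub>1 c * (I c \<omega> * V c (?X \<omega>) - I c \<omega> * ((c + Lam) / q))) / (\<theta>\<^sub>2 c - \<theta>\<^sub>1 c))"
      unfolding Z2_def tan_coeff2_def by (auto simp: algebra_simps)
    then show "integrable N (Z2 c)" using IV[OF that] II by simp
  qed
  \<comment> \<open>The condition on \<open>r\<close> is the characteristic equation, so either root
    produces the same factor exp (q d).\<close>
  have mgf: "integrable N (\<lambda>\<omega>. Z \<omega> * exp (r * ((mu - c) * d + sig * ?D \<omega>)))"
    "expectation (\<lambda>\<omega>. Z \<omega> * exp (r * ((mu - c) * d + sig * ?D \<omega>))) = expectation Z * exp (q * d)"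
    if "Z \<in> borel_measurable (F ?t)" "integrable N Z" "sig\<^sup>2 * r\<^sup>2 / 2 + (mu - c) * r = q" for Z r c
  proof -
    have *: "(\<lambda>\<omega>. Z \<omega> * exp (r * ((mu - c) * d + sig * ?D \<omega>))) = (\<lambda>\<omega>. exp (r * (mu - c) * d) * (Z \<omega> * exp ((r * sig) * ?D \<omega>)))"
      by (auto simp: exp_add[symmetric] algebra_simps)
    note m = incr_mgf[OF t d that(1,2), of "r * sig"]
    show "integrable N (\<lambda>\<omega>. Z \<omega> * exp (r * ((mu - c) * d + sig * ?D \<omega>)))"
      unfolding * using m(1) by simp
    have "r * (mu - c) * d + (r * sig)\<^sup>2 * d / 2 = q * d"
      unfolding that(3)[symmetric] by (simp add: algebra_simps power2_eq_square)
    then show "expectation (\<lambda>\<omega>. Z \<omega> * exp (r * ((mu - c) * d + sig * ?D \<omega>))) = expectation Z * exp (q * d)"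
      unfolding * integral_mult_right_zero m(2) by (simp only: exp_add[symmetric] mult.left_commute)
  qed
  \<comment> \<open>This is exp (- lam y) at the lowest level reachable from a nonnegative surplus:
    start at \<open>eta\<close> and drift down at the largest rate \<open>cm\<close>.\<close>
  let ?E = "\<lambda>\<omega>. exp (- lam * (eta + (mu - cm) * d)) * (1 * exp ((- lam * sig) * ?D \<omega>))"
  have E: "integrable N ?E" "expectation ?E = exp (- lam * (eta + (mu - cm) * d) + lam\<^sup>2 * sig\<^sup>2 * d / 2)"
  proof -
    note m = incr_mgf[OF t d, of "\<lambda>_. 1" "- lam * sig"]
    show "integrable N ?E" by (intro integrable_mult_right m(1)) auto
    have "expectation ?E = exp (- lam * (eta + (mu - cm) * d)) * expectation (\<lambda>\<omega>. 1 * exp ((- lam * sig) * ?D \<omega>))"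
      by (rule integral_mult_right_zero)
    also have "\<dots> = exp (- lam * (eta + (mu - cm) * d)) * exp ((- lam * sig)\<^sup>2 * d / 2)"
      by (subst m(2)) (auto simp: prob_space)
    finally show "expectation ?E = exp (- lam * (eta + (mu - cm) * d) + lam\<^sup>2 * sig\<^sup>2 * d / 2)"
      by (simp only: exp_add[symmetric] power_mult_distrib power2_minus)
  qed
  let ?R = "\<lambda>\<omega>. (\<Sum>c\<in>S. I c \<omega> * ((c + Lam) / q) + Z1 c \<omega> * exp (\<theta>\<^sub>1 c * ((mu - c) * d + sig * ?D \<omega>))
      + Z2 c \<omega> * exp (\<theta>\<^sub>2 c * ((mu - c) * d + sig * ?D \<omega>))) + K * ?E \<omega>"
  have R_int: "integrable N ?R"
    using II Z1 Z2 E mgf(1) theta1_char theta2_char by (intro Bochner_Integration.integrable_add Bochner_Integration.integrable_sum integrable_mult_left integrable_mult_right) auto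
  have le: "alive y d (Suc k) \<omega> * V (C (real (Suc k) * d) \<omega>) (X y d (Suc k) \<omega> + eta) \<le> ?R \<omega>"
    if \<omega>: "\<omega> \<in> space N" for \<omega>
  proof -
    let ?c = "?C \<omega>" and ?Y = "X y d (Suc k) \<omega> + eta"
    have c: "?c \<in> S" using C_S[OF t \<omega>] .
    have "?R \<omega> = ?a \<omega> * ((?c + Lam) / q + tan_coeff1 ?c (V ?c (?X \<omega>)) (V' ?c (?X \<omega>)) * exp (\<theta>\<^sub>1 ?c * (?Y - ?X \<omega>))
        + tan_coeff2 ?c (V ?c (?X \<omega>)) (V' ?c (?X \<omega>)) * exp (\<theta>\<^sub>2 ?c * (?Y - ?X \<omega>))) + K * ?E \<omega>"
    proof -
      have "?Y - ?X \<omega> = (mu - ?c) * d + sig * ?D \<omega>" unfolding X_Suc by simp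
      then show ?thesis
        using sum_I[OF \<omega>, of "\<lambda>c. (c + Lam) / q + tan_coeff1 c (V c (?X \<omega>)) (V' c (?X \<omega>)) * exp (\<theta>\<^sub>1 c * ((mu - c) * d + sig * ?D \<omega>))
        + tan_coeff2 c (V c (?X \<omega>)) (V' c (?X \<omega>)) * exp (\<theta>\<^sub>2 c * ((mu - c) * d + sig * ?D \<omega>))"]
        by (simp add: Z1_def Z2_def distrib_left mult.assoc)
    qed
    then have R: "?a \<omega> * V ?c ?Y + K * ?E \<omega> \<le> ?R \<omega>"
      using tangent_domination[OF V[OF c], of ?Y "?X \<omega>"] a01(1)[of \<omega>] by auto
    have E0: "0 \<le> K * ?E \<omega>" using K by simp
    show ?thesis
    proof (cases "?a \<omega> = 0")
      case True
      then have "alive y d (Suc k) \<omega> = 0"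
        by (auto simp: alive_def split: if_splits) (meson le_SucI)
      then show ?thesis using R True E0 by simp
    next
      case False
      then have a1: "?a \<omega> = 1" and Xk: "0 \<le> X y d k \<omega>" using a01[of \<omega>] by auto
      show ?thesis
      proof (cases "0 \<le> X y d (Suc k) \<omega>")
        case True
        \<comment> \<open>The rate may have dropped during the cell; monotonicity of the candidates
          in the rate absorbs this, and it is here that ratcheting enters.\<close>
        have "V (C (real (Suc k) * d) \<omega>) ?Y \<le> V ?c ?Y"
          using d \<omega> c True eta by (intro V_mono C_S C_anti) (auto intro: mult_right_mono)
        moreover have "alive y d (Suc k) \<omega> = 1"
          using a1 True unfolding a01(2) by (auto simp: alive_def le_Suc_eq)
        ultimately show ?thesis using R a1 E0 by simp
      next
        case False
        then have "alive y d (Suc k) \<omega> = 0" by (auto simp: alive_def)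
        \<comment> \<open>Ruin is detected at the new grid point, so the left side is 0, while the
          tangent bound still dominates a possibly negative V; the growth bound and
          \<open>?E\<close> restore nonnegativity.\<close>
        moreover have "0 \<le> V ?c ?Y + K * ?E \<omega>"
        proof (cases "0 \<le> ?Y")
          case True
          then show ?thesis using profile_nonneg[OF V[OF c] True] E0 by simp
        next
          case False
          have "(mu - cm) * d \<le> (mu - ?c) * d" using S(4)[OF c] d by (intro mult_right_mono) auto
          then have "eta + (mu - cm) * d + sig * ?D \<omega> \<le> ?Y" unfolding X_Suc using Xk by simp
          then have "exp (- lam * ?Y) \<le> exp (- lam * (eta + (mu - cm) * d + sig * ?D \<omega>))"
            using lam by (simp add: mult_left_mono)
          also have "\<dots> = ?E \<omega>" by (simp add: exp_add[symmetric] algebra_simps)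
          finally have "K * exp (- lam * ?Y) \<le> K * ?E \<omega>" using K by (intro mult_left_mono)
          then show ?thesis using growth[OF c, of ?Y] False by simp
        qed
        ultimately show ?thesis using R a1 by simp
      qed
    qed
  qed
  have V0: "0 \<le> alive y d (Suc k) \<omega> * V (C (real (Suc k) * d) \<omega>) (X y d (Suc k) \<omega> + eta)" if "\<omega> \<in> space N" for \<omega>
    using d eta that by (auto simp: alive_def intro!: profile_nonneg[OF V] C_S)
  have "expectation (\<lambda>\<omega>. alive y d (Suc k) \<omega> * V (C (real (Suc k) * d) \<omega>) (X y d (Suc k) \<omega> + eta)) \<le> expectation ?R"
    using le V0 by (intro integral_mono'[OF R_int]) (auto intro: order_trans)
  also have "expectation ?R = (\<Sum>c\<in>S. expectation (I c) * ((c + Lam) / q) + expectation (Z1 c) * exp (q * d)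
      + expectation (Z2 c) * exp (q * d)) + K * exp (- lam * (eta + (mu - cm) * d) + lam\<^sup>2 * sig\<^sup>2 * d / 2)"
  proof -
    have int: "integrable N (\<lambda>\<omega>. I c \<omega> * ((c + Lam) / q))"
      "integrable N (\<lambda>\<omega>. Z1 c \<omega> * exp (\<theta>\<^sub>1 c * ((mu - c) * d + sig * ?D \<omega>)))"
      "integrable N (\<lambda>\<omega>. Z2 c \<omega> * exp (\<theta>\<^sub>2 c * ((mu - c) * d + sig * ?D \<omega>)))" if "c \<in> S" for c
      using II Z1[OF that] Z2[OF that] mgf(1) theta1_char theta2_char by auto
    have "expectation ?R = (\<Sum>c\<in>S. expectation (\<lambda>\<omega>. I c \<omega> * ((c + Lam) / q))
      + expectation (\<lambda>\<omega>. Z1 c \<omega> * exp (\<theta>\<^sub>1 c * ((mu - c) * d + sig * ?D \<omega>)))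
      + expectation (\<lambda>\<omega>. Z2 c \<omega> * exp (\<theta>\<^sub>2 c * ((mu - c) * d + sig * ?D \<omega>)))) + K * expectation ?E"
      using int E(1)
      by (subst Bochner_Integration.integral_add)
         (auto simp: Bochner_Integration.integral_sum Bochner_Integration.integral_add intro!: Bochner_Integration.integrable_sum sum.cong)
    also have "\<dots> = (\<Sum>c\<in>S. expectation (I c) * ((c + Lam) / q) + expectation (Z1 c) * exp (q * d)
      + expectation (Z2 c) * exp (q * d)) + K * exp (- lam * (eta + (mu - cm) * d) + lam\<^sup>2 * sig\<^sup>2 * d / 2)"
      unfolding E(2) using Z1 Z2 mgf(2) theta1_char theta2_char
      by (intro arg_cong2[where f="(+)"] sum.cong refl) auto
    finally show ?thesis .
  qed
  \<comment> \<open>By \<open>tan_coeff_sum\<close> the two coefficients add up to V - (c + Lam) /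
    q, so the exponential terms collapse to the value at the start of the cell.\<close>
  also have "(\<Sum>c\<in>S. expectation (I c) * ((c + Lam) / q) + expectation (Z1 c) * exp (q * d) + expectation (Z2 c) * exp (q * d))
    = (\<Sum>c\<in>S. exp (q * d) * expectation (\<lambda>\<omega>. I c \<omega> * V c (?X \<omega>)) - (exp (q * d) - 1) * expectation (\<lambda>\<omega>. I c \<omega> * ((c + Lam) / q)))"
  proof (rule sum.cong[OF refl])
    fix c assume c: "c \<in> S"
    have "expectation (Z1 c) + expectation (Z2 c) = expectation (\<lambda>\<omega>. Z1 c \<omega> + Z2 c \<omega>)"
      using Z1 Z2 c by simp
    also have "\<dots> = expectation (\<lambda>\<omega>. I c \<omega> * V c (?X \<omega>) - I c \<omega> * ((c + Lam) / q))"
      unfolding Z1_def Z2_def distrib_left[symmetric] tan_coeff_sum by (simp add: right_diff_distrib)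
    also have "\<dots> = expectation (\<lambda>\<omega>. I c \<omega> * V c (?X \<omega>)) - expectation (I c) * ((c + Lam) / q)"
      using IV[OF c] II by simp
    finally have *: "expectation (Z1 c) + expectation (Z2 c) = expectation (\<lambda>\<omega>. I c \<omega> * V c (?X \<omega>)) - expectation (I c) * ((c + Lam) / q)" .
    have **: "expectation (\<lambda>\<omega>. I c \<omega> * ((c + Lam) / q)) = expectation (I c) * ((c + Lam) / q)"
      by (rule integral_mult_left_zero)
    have algebra: "i + z1 * e + z2 * e = e * v - (e - 1) * i" if "z1 + z2 = v - i" for i z1 z2 e v :: real
    proof -
      have "z1 * e + z2 * e = (v - i) * e" unfolding that[symmetric] by (rule distrib_right[symmetric])
      then show ?thesis by (simp add: algebra_simps)
    qed
    show "expectation (I c) * ((c + Lam) / q) + expectation (Z1 c) * exp (q * d) + expectation (Z2 c) * exp (q * d)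
      = exp (q * d) * expectation (\<lambda>\<omega>. I c \<omega> * V c (?X \<omega>)) - (exp (q * d) - 1) * expectation (\<lambda>\<omega>. I c \<omega> * ((c + Lam) / q))"
      unfolding ** by (rule algebra[OF *])
  qed
  also have "\<dots> = exp (q * d) * (\<Sum>c\<in>S. expectation (\<lambda>\<omega>. I c \<omega> * V c (?X \<omega>))) - (exp (q * d) - 1) * (\<Sum>c\<in>S. expectation (\<lambda>\<omega>. I c \<omega> * ((c + Lam) / q)))"
    by (simp only: sum_subtractf sum_distrib_left)
  also have "(\<Sum>c\<in>S. expectation (\<lambda>\<omega>. I c \<omega> * V c (?X \<omega>))) = expectation (\<lambda>\<omega>. ?a \<omega> * V (?C \<omega>) (?X \<omega>))"
    using sum_I by (subst Bochner_Integration.integral_sum[symmetric]) (auto intro!: IV Bochner_Integration.integral_cong)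
  also have "(\<Sum>c\<in>S. expectation (\<lambda>\<omega>. I c \<omega> * ((c + Lam) / q))) = expectation (\<lambda>\<omega>. ?a \<omega> * ((?C \<omega> + Lam) / q))"
  proof (subst Bochner_Integration.integral_sum[symmetric])
    show "integrable N (\<lambda>\<omega>. I c \<omega> * ((c + Lam) / q))" for c by (rule integrable_mult_left[OF II])
    show "expectation (\<lambda>\<omega>. \<Sum>c\<in>S. I c \<omega> * ((c + Lam) / q)) = expectation (\<lambda>\<omega>. ?a \<omega> * ((?C \<omega> + Lam) / q))"
      by (intro Bochner_Integration.integral_cong refl sum_I)
  qed
  finally show ?thesis .
qed

end

definition payoff :: "(real \<Rightarrow> 'a \<Rightarrow> real) \<Rightarrow> real \<Rightarrow> real \<Rightarrow> real \<Rightarrow> real \<Rightarrow> real \<Rightarrow> (real \<Rightarrow> 'a \<Rightarrow> real) \<Rightarrow> 'a \<Rightarrow> real" where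
  "payoff W mu sig q Lam x C \<omega> =
     (LINT s:{s. 0 \<le> s \<and> ereal s < ruin W mu sig x C \<omega>}|lborel. exp (- q * s) * (C s \<omega> + Lam))"

context controlled
begin

abbreviation "surplus_value y d eta k \<equiv>
  expectation (\<lambda>\<omega>. alive y d k \<omega> * V (C (real k * d) \<omega>) (X y d k \<omega> + eta))"

abbreviation "reward y d k \<equiv> expectation (\<lambda>\<omega>. alive y d k \<omega> * ((C (real k * d) \<omega> + Lam) / q))"

lemma alive_cases: "alive y d k \<omega> = 0 \<or> alive y d k \<omega> = 1 \<and> 0 \<le> X y d k \<omega>"
  by (auto simp: alive_def)

lemma surplus_value_nonneg: "0 \<le> d \<Longrightarrow> 0 \<le> eta \<Longrightarrow> 0 \<le> surplus_value y d eta k"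
proof (rule integral_nonneg_AE, rule AE_I2)
  fix \<omega> assume *: "0 \<le> d" "0 \<le> eta" "\<omega> \<in> space N"
  then have "C (real k * d) \<omega> \<in> S" by (intro C_S) auto
  then show "0 \<le> alive y d k \<omega> * V (C (real k * d) \<omega>) (X y d k \<omega> + eta)"
    using alive_cases[of y d k \<omega>] * by (auto intro!: profile_nonneg[OF V] add_nonneg_nonneg)
qed

lemma surplus_value_0: "0 \<le> y \<Longrightarrow> 0 \<le> eta \<Longrightarrow> surplus_value y d eta 0 \<le> V cm (y + eta)"
proof -
  assume y: "0 \<le> y" "0 \<le> eta"
  have "surplus_value y d eta 0 \<le> expectation (\<lambda>_. V cm (y + eta))"
  proof (rule integral_mono')
    show "0 \<le> V cm (y + eta)" using y S by (intro profile_nonneg[OF V]) auto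
    fix \<omega> assume \<omega>: "\<omega> \<in> space N"
    have c: "C 0 \<omega> \<in> S" using \<omega> by (intro C_S) auto
    have X0: "X y d 0 \<omega> = y" by (simp add: X_def W0[OF \<omega>])
    show "alive y d 0 \<omega> * V (C (real 0 * d) \<omega>) (X y d 0 \<omega> + eta) \<le> V cm (y + eta)"
      using V_mono[OF c S(2) S(4)[OF c], of "y + eta"] y by (simp add: alive_def X0)
  qed simp
  then show ?thesis by (simp add: prob_space)
qed

text \<open>Discounting \<open>one_step\<close> by p per cell makes the values telescope, and the
  errors form a geometric series. Since \<open>reward\<close> carries the factor 1/q, (1 - p) times
  it is exactly the payment over one cell discounted to the start of the cell.\<close>

lemma iterated_step:
  assumes d: "0 < d" and eta: "0 \<le> eta" and K: "0 \<le> K" and lam: "0 \<le> lam"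
    and growth: "\<And>c x. c \<in> S \<Longrightarrow> x \<le> 0 \<Longrightarrow> - K * exp (- lam * x) \<le> V c x" and y: "0 \<le> y"
  defines "p \<equiv> exp (- q * d)"
  defines "err \<equiv> K * exp (- lam * (eta + (mu - cm) * d) + lam\<^sup>2 * sig\<^sup>2 * d / 2)"
  shows "(1 - p) * (\<Sum>k<n. p ^ k * reward y d k) \<le> V cm (y + eta) + err * p / (1 - p)"
proof -
  have p: "0 < p" "p < 1" using d q_pos by (auto simp: p_def)
  have err: "0 \<le> err" using K by (simp add: err_def)
  have ep: "exp (q * d) = 1 / p" by (simp add: p_def exp_minus field_simps)
  have step: "p * surplus_value y d eta (Suc k)
     \<le> surplus_value y d eta k - (1 - p) * reward y d k + p * err" for k
  proof -
    have "p * surplus_value y d eta (Suc k) \<le> p * (1 / p * surplus_value y d eta k - (1 / p - 1) * reward y d k + err)"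
      using one_step[OF d eta K lam growth, of y k] p
      unfolding err_def ep by (intro mult_left_mono) auto
    also have "\<dots> = surplus_value y d eta k - (1 - p) * reward y d k + p * err"
    proof -
      have "p * (1 / p * A - (1 / p - 1) * R + e) = A - (1 - p) * R + p * e" for A R e
        using p by (simp add: algebra_simps)
      then show ?thesis .
    qed
    finally show ?thesis .
  qed
  have "(1 - p) * (\<Sum>k<n. p ^ k * reward y d k) + p ^ n * surplus_value y d eta n
     \<le> surplus_value y d eta 0 + err * p * (\<Sum>k<n. p ^ k)"
  proof (induction n)
    case (Suc n)
    have "p ^ n * (p * surplus_value y d eta (Suc n))
        \<le> p ^ n * (surplus_value y d eta n - (1 - p) * reward y d n + p * err)"
      using step[of n] p by (intro mult_left_mono) auto
    then show ?case using Suc by (simp add: algebra_simps)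
  qed simp
  moreover have "0 \<le> p ^ n * surplus_value y d eta n"
    using p surplus_value_nonneg[of d eta y n] d eta by simp
  moreover have "err * p * (\<Sum>k<n. p ^ k) \<le> err * p * (1 / (1 - p))"
  proof (rule mult_left_mono)
    have "(\<Sum>k<n. p ^ k) = (1 - p ^ n) / (1 - p)" using p by (simp add: sum_gp_strict)
    also have "\<dots> \<le> 1 / (1 - p)" using p by (intro divide_right_mono) auto
    finally show "(\<Sum>k<n. p ^ k) \<le> 1 / (1 - p)" .
  qed (use err p in auto)
  ultimately show ?thesis using surplus_value_0[OF y eta, of d] by simp
qed

text \<open>Freezing the rate on each grid cell increases it, at the price of lowering the surplus by at
  most \<open>d * cm\<close>; raising the initial surplus by this amount compensates for it.\<close>

lemma alive_before_ruin:
  assumes \<omega>: "\<omega> \<in> space N" and d: "0 < d" and s: "real k * d \<le> s" "ereal s < ruin W mu sig x C \<omega>"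
  shows "alive (x + d * cm) d k \<omega> = 1"
proof -
  have "0 \<le> X (x + d * cm) d l \<omega>" if "l \<le> k" for l
  proof -
    have ld: "0 \<le> real l * d" "real l * d \<le> s"
      using that d order_trans[OF mult_right_mono[of "real l" "real k" d] s(1)] by auto
    have "0 \<le> Xctrl W mu sig x C (real l * d) \<omega>"
    proof (rule ccontr)
      assume "\<not> ?thesis"
      then have "ruin W mu sig x C \<omega> \<le> ereal (real l * d)"
        unfolding ruin_def using ld by (intro Inf_lower) auto
      also have "\<dots> \<le> ereal s" using ld by simp
      finally show False using s(2) by simp
    qed
    moreover have "d * (\<Sum>i<l. C (real i * d) \<omega>) - d * (C 0 \<omega> - C (real l * d) \<omega>)
        \<le> (LINT u:{0..real l * d}|lborel. C u \<omega>)"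
      using \<omega> d C_S S(3) by (intro antimono_integral_riemann C_anti) auto
    moreover have "d * (C 0 \<omega> - C (real l * d) \<omega>) \<le> d * cm"
      using d S(4)[OF C_S[OF _ \<omega>, of 0]] S(3)[OF C_S[OF ld(1) \<omega>]] by (intro mult_left_mono) auto
    ultimately show ?thesis
      unfolding Xctrl_def Xproc_def X_def by simp
  qed
  then show ?thesis by (simp add: alive_def)
qed

lemma payoff_le_grid:
  assumes \<omega>: "\<omega> \<in> space N" and d: "0 < d"
  defines "p \<equiv> exp (- q * d)"
  shows "payoff W mu sig q Lam x C \<omega>
    \<le> (1 - p) * (\<Sum>k<n. p ^ k * (alive (x + d * cm) d k \<omega> * ((C (real k * d) \<omega> + Lam) / q)))
      + p ^ n * ((cm + Lam) / q)"
proof -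
  let ?a = "\<lambda>k. alive (x + d * cm) d k \<omega>"
  define g where "g s = (\<Sum>k<n. (?a k * (C (real k * d) \<omega> + Lam)) * (indicator {real k * d..<real (Suc k) * d} s * exp (- q * s)))
     + (cm + Lam) * (indicator {real n * d..} s * exp (- q * s))" for s
  have pk: "exp (- q * (real k * d)) = p ^ k" for k
    unfolding p_def exp_of_nat_mult[symmetric] by (simp add: algebra_simps)
  have g: "has_bochner_integral lborel g
    ((\<Sum>k<n. (?a k * (C (real k * d) \<omega> + Lam)) * ((exp (- q * (real k * d)) - exp (- q * (real (Suc k) * d))) / q))
     + (cm + Lam) * (exp (- q * (real n * d)) / q))"
    unfolding g_def
    by (intro has_bochner_integral_add has_bochner_integral_sum has_bochner_integral_mult_right
        exp_segment_integral exp_tail_integral q_pos) (use d in \<open>auto intro: mult_right_mono\<close>)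
  have C0: "0 \<le> C t \<omega>" "C t \<omega> \<le> cm" if "0 \<le> t" for t
    using S(3,4) C_S[OF that \<omega>] by auto
  have a01: "0 \<le> ?a k" for k by (simp add: alive_def)
  have cm0: "0 \<le> cm" using S by auto
  have "payoff W mu sig q Lam x C \<omega> \<le> integral\<^sup>L lborel g"
    unfolding payoff_def set_lebesgue_integral_def
  proof (rule integral_mono')
    show "integrable lborel g" using g by (rule integrable.intros)
    fix s :: real
    have terms0: "0 \<le> (?a k * (C (real k * d) \<omega> + Lam)) * (indicator {real k * d..<real (Suc k) * d} s * exp (- q * s))" for k
      using C0(1)[of "real k * d"] a01 Lam_pos d by (intro mult_nonneg_nonneg) auto
    have tail0: "0 \<le> (cm + Lam) * (indicator {real n * d..} s * exp (- q * s))"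
      using cm0 Lam_pos by simp
    show g0: "0 \<le> g s" unfolding g_def using terms0 tail0 by (intro add_nonneg_nonneg sum_nonneg) auto
    show "indicator {s. 0 \<le> s \<and> ereal s < ruin W mu sig x C \<omega>} s *\<^sub>R (exp (- q * s) * (C s \<omega> + Lam)) \<le> g s"
    proof (cases "0 \<le> s \<and> ereal s < ruin W mu sig x C \<omega>")
      case True
      then have s: "0 \<le> s" "ereal s < ruin W mu sig x C \<omega>" by auto
      show ?thesis
      proof (cases "real n * d \<le> s")
        case True
        have "exp (- q * s) * (C s \<omega> + Lam) \<le> (cm + Lam) * (indicator {real n * d..} s * exp (- q * s))"
          using True C0[OF s(1)] by (simp add: mult.commute)
        also have "\<dots> \<le> g s" unfolding g_def using terms0 by (intro add_increasing sum_nonneg) auto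
        finally show ?thesis using s by simp
      next
        case False
        define k where "k = nat \<lfloor>s / d\<rfloor>"
        have rk: "real k = of_int \<lfloor>s / d\<rfloor>" using s d by (simp add: k_def)
        have "real k \<le> s / d" "s / d < real k + 1" unfolding rk by linarith+
        then have k: "real k * d \<le> s" "s < real (Suc k) * d" using d by (auto simp: field_simps)
        have "real k * d < real n * d" using False k by linarith
        then have kn: "k < n" using d by simp
        have a1: "?a k = 1" using alive_before_ruin[OF \<omega> d k(1) s(2)] .
        have "exp (- q * s) * (C s \<omega> + Lam) \<le> exp (- q * s) * (C (real k * d) \<omega> + Lam)"
          using C_anti[OF _ k(1) \<omega>] d by (intro mult_left_mono) auto
        also have "\<dots> = (?a k * (C (real k * d) \<omega> + Lam)) * (indicator {real k * d..<real (Suc k) * d} s * exp (- q * s))"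
          using k a1 by simp
        also have "\<dots> \<le> (\<Sum>k<n. (?a k * (C (real k * d) \<omega> + Lam)) * (indicator {real k * d..<real (Suc k) * d} s * exp (- q * s)))"
          using kn terms0 by (intro member_le_sum) auto
        also have "\<dots> \<le> g s" unfolding g_def using tail0 by simp
        finally show ?thesis using s by simp
      qed
    next
      case False
      then show ?thesis using g0 by (auto simp: indicator_def)
    qed
  qed
  also have "integral\<^sup>L lborel g = (\<Sum>k<n. (?a k * (C (real k * d) \<omega> + Lam)) * ((p ^ k - p ^ Suc k) / q))
     + (cm + Lam) * (p ^ n / q)"
    using has_bochner_integral_integral_eq[OF g] unfolding pk .
  also have "\<dots> = (1 - p) * (\<Sum>k<n. p ^ k * (?a k * ((C (real k * d) \<omega> + Lam) / q))) + p ^ n * ((cm + Lam) / q)"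
    unfolding sum_distrib_left
    by (intro arg_cong2[where f="(+)"] sum.cong refl) (use q_pos in \<open>simp_all add: field_simps\<close>)
  finally show ?thesis .
qed

text \<open>With mesh and shift fixed, the number of cells tends to infinity and the discounted
  remainder disappears.\<close>

lemma payoff_bound_grid:
  assumes d: "0 < d" and eta: "0 \<le> eta" and K: "0 \<le> K" and lam: "0 \<le> lam"
    and growth: "\<And>c x. c \<in> S \<Longrightarrow> x \<le> 0 \<Longrightarrow> - K * exp (- lam * x) \<le> V c x" and x: "0 \<le> x"
  defines "p \<equiv> exp (- q * d)"
  defines "err \<equiv> K * exp (- lam * (eta + (mu - cm) * d) + lam\<^sup>2 * sig\<^sup>2 * d / 2)"
  shows "expectation (payoff W mu sig q Lam x C) \<le> V cm (x + d * cm + eta) + err * p / (1 - p)"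
proof -
  have p: "0 < p" "p < 1" using d q_pos by (auto simp: p_def)
  have cm0: "0 \<le> cm" using S by auto
  let ?y = "x + d * cm"
  have y: "0 \<le> ?y" using x d cm0 by simp
  have "expectation (payoff W mu sig q Lam x C) \<le> V cm (?y + eta) + err * p / (1 - p) + p ^ n * ((cm + Lam) / q)" for n
  proof -
    let ?r = "\<lambda>k \<omega>. alive ?y d k \<omega> * ((C (real k * d) \<omega> + Lam) / q)"
    have r: "integrable N (?r k)" for k
    proof (rule integrable_const_bound[of _ "(cm + Lam) / q"])
      show "AE \<omega> in N. norm (?r k \<omega>) \<le> (cm + Lam) / q"
      proof (rule AE_I2)
        fix \<omega> assume \<omega>: "\<omega> \<in> space N"
        have "C (real k * d) \<omega> \<in> S" using C_S[OF _ \<omega>] d by simp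
        then have "0 \<le> C (real k * d) \<omega>" "C (real k * d) \<omega> \<le> cm" using S by auto
        then show "norm (?r k \<omega>) \<le> (cm + Lam) / q"
          using alive_cases[of ?y d k \<omega>] q_pos Lam_pos cm0 by (auto intro: divide_right_mono)
      qed
      have "0 \<le> real k * d" using d by simp
      moreover have "?r k \<in> borel_measurable (F (real k * d))"
      proof -
        note [measurable] = alive_measurable[of d ?y k, OF less_imp_le[OF d]] C_adapted[OF \<open>0 \<le> real k * d\<close>]
        show ?thesis by measurable
      qed
      ultimately show "?r k \<in> borel_measurable N" by (rule F_N_measurable)
    qed
    have r0: "0 \<le> ?r k \<omega>" if "\<omega> \<in> space N" for k \<omega>
      using C_S[OF _ that, of "real k * d"] S(3) d q_pos Lam_pos by (auto simp: alive_def)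
    have "expectation (payoff W mu sig q Lam x C)
      \<le> expectation (\<lambda>\<omega>. (1 - p) * (\<Sum>k<n. p ^ k * ?r k \<omega>) + p ^ n * ((cm + Lam) / q))"
    proof (rule integral_mono')
      show "integrable N (\<lambda>\<omega>. (1 - p) * (\<Sum>k<n. p ^ k * ?r k \<omega>) + p ^ n * ((cm + Lam) / q))"
        by (intro Bochner_Integration.integrable_add integrable_mult_right Bochner_Integration.integrable_sum r) auto
      fix \<omega> assume \<omega>: "\<omega> \<in> space N"
      show "payoff W mu sig q Lam x C \<omega> \<le> (1 - p) * (\<Sum>k<n. p ^ k * ?r k \<omega>) + p ^ n * ((cm + Lam) / q)"
        using payoff_le_grid[OF \<omega> d] unfolding p_def .
      show "0 \<le> (1 - p) * (\<Sum>k<n. p ^ k * ?r k \<omega>) + p ^ n * ((cm + Lam) / q)"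
        using p q_pos Lam_pos cm0
        by (intro add_nonneg_nonneg mult_nonneg_nonneg sum_nonneg r0 \<omega>) auto
    qed
    also have "\<dots> = (1 - p) * (\<Sum>k<n. p ^ k * reward ?y d k) + p ^ n * ((cm + Lam) / q)"
    proof -
      have "integrable N (\<lambda>\<omega>. (1 - p) * (\<Sum>k<n. p ^ k * ?r k \<omega>))"
        by (intro integrable_mult_right Bochner_Integration.integrable_sum r)
      moreover have "expectation (\<lambda>\<omega>. (1 - p) * (\<Sum>k<n. p ^ k * ?r k \<omega>)) = (1 - p) * (\<Sum>k<n. p ^ k * reward ?y d k)"
        unfolding integral_mult_right_zero
        by (subst Bochner_Integration.integral_sum) (intro integrable_mult_right r, simp only: integral_mult_right_zero)
      ultimately show ?thesis
        by (subst Bochner_Integration.integral_add) (auto simp: prob_space)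
    qed
    also have "\<dots> \<le> V cm (?y + eta) + err * p / (1 - p) + p ^ n * ((cm + Lam) / q)"
      using iterated_step[OF d eta K lam growth y, of n] unfolding p_def err_def by simp
    finally show ?thesis .
  qed
  moreover have "(\<lambda>n. V cm (?y + eta) + err * p / (1 - p) + p ^ n * ((cm + Lam) / q)) \<longlonglongrightarrow> V cm (?y + eta) + err * p / (1 - p) + 0 * ((cm + Lam) / q)"
    using p by (intro tendsto_intros LIMSEQ_power_zero) auto
  ultimately have "expectation (payoff W mu sig q Lam x C) \<le> V cm (?y + eta) + err * p / (1 - p) + 0 * ((cm + Lam) / q)"
    by (intro tendsto_lowerbound[where F = sequentially]) (auto intro!: always_eventually)
  then show ?thesis by simp
qed

theorem payoff_bound:
  assumes x: "0 \<le> x"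
  shows "expectation (payoff W mu sig q Lam x C) \<le> V cm x"
proof -
  obtain K a where K: "0 \<le> K" "0 \<le> a" "\<And>c x. c \<in> S \<Longrightarrow> x \<le> 0 \<Longrightarrow> - K * exp (- a * x) \<le> V c x"
    using growth by blast
  have cont: "isCont (V cm) y" for y
    using profile_continuous[OF V[OF S(2)], of UNIV] by (simp add: continuous_on_eq_continuous_at)
  have *: "expectation (payoff W mu sig q Lam x C) \<le> V cm (x + eta)" if eta: "0 < eta" for eta
  proof -
    \<comment> \<open>Growth exponent m and mesh 1/m^2 are coupled: the Gaussian term m^2 sig^2 d /
      2 stays bounded, and exp (- m eta) beats 1 / (1 - p), which is of order m^2.\<close>
    let ?err = "\<lambda>m::nat. K * exp (- real m * (eta + (mu - cm) * (1 / (real m)\<^sup>2)) + (real m)\<^sup>2 * sig\<^sup>2 * (1 / (real m)\<^sup>2) / 2)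
       * exp (- q * (1 / (real m)\<^sup>2)) / (1 - exp (- q * (1 / (real m)\<^sup>2)))"
    let ?b = "\<lambda>m. V cm (x + 1 / (real m)\<^sup>2 * cm + eta) + ?err m"
    have "?err \<longlonglongrightarrow> 0" using eta q_pos by real_asymp
    moreover have "(\<lambda>m. V cm (x + 1 / (real m)\<^sup>2 * cm + eta)) \<longlonglongrightarrow> V cm (x + eta)"
      by (rule isCont_tendsto_compose[OF cont]) real_asymp
    ultimately have lim: "?b \<longlonglongrightarrow> V cm (x + eta) + 0" by (intro tendsto_add)
    \<comment> \<open>A larger growth exponent weakens the lower bound on the negative half-line, so
      every m beyond \<open>a\<close> is legitimate; m \<ge> 1 keeps the mesh positive.\<close>
    have le: "expectation (payoff W mu sig q Lam x C) \<le> ?b m" if "max a 1 \<le> real m" for m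
    proof (rule payoff_bound_grid)
      show "0 < 1 / (real m)\<^sup>2" "0 \<le> real m" using that by auto
      fix c z assume c: "c \<in> S" and z: "z \<le> (0::real)"
      have "exp (a * - z) \<le> exp (real m * - z)"
        using that z by (simp only: exp_le_cancel_iff) (intro mult_right_mono, auto)
      then have "K * exp (- a * z) \<le> K * exp (- real m * z)"
        using K by (intro mult_left_mono) auto
      then show "- K * exp (- real m * z) \<le> V c z"
        using K(3)[OF c z] by simp
    qed (use eta K x in auto)
    have "\<forall>\<^sub>F m in sequentially. max a 1 \<le> real m"
      by real_asymp
    then have "\<forall>\<^sub>F m in sequentially. expectation (payoff W mu sig q Lam x C) \<le> ?b m"
      by eventually_elim (rule le)
    then show ?thesis
      using tendsto_lowerbound[OF lim] by simp
  qed
  have "(\<lambda>m::nat. V cm (x + 1 / (real m + 1))) \<longlonglongrightarrow> V cm x"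
    by (rule isCont_tendsto_compose[OF cont]) real_asymp
  then show ?thesis
    by (rule tendsto_lowerbound) (auto intro!: always_eventually *)
qed

end

subsection \<open>First passage after a stopping time\<close>

text \<open>The set of times is kept rather than its infimum, since emptiness means that the level
  is never reached and a real infimum would not show it.\<close>

definition hits :: "(real \<Rightarrow> real) \<Rightarrow> real \<Rightarrow> real \<Rightarrow> real \<Rightarrow> real set" where
  "hits Y c p z = {s. 0 \<le> s \<and> p + Y s - c * s \<le> z}"

lemma hits_closed:
  assumes "continuous_on {0..} Y"
  shows "closed (hits Y c p z)"
proof -
  have "closed {s \<in> {0..}. p + Y s - c * s \<le> z}"
    by (intro continuous_on_closed_Collect_le closed_atLeast continuous_intros assms)
  then show ?thesis by (simp add: hits_def)
qed

text \<open>The path starts strictly above \<open>z\<close> and is continuous, so passage happens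
  without overshoot; the hitting set is closed, so the infimum is attained.\<close>

lemma hits_Inf:
  assumes Y: "continuous_on {0..} Y" "Y 0 = 0" and "z < p" and ne: "hits Y c p z \<noteq> {}"
  defines "h \<equiv> Inf (hits Y c p z)"
  shows "0 \<le> h" "p + Y h - c * h = z" "\<And>s. 0 \<le> s \<Longrightarrow> s < h \<Longrightarrow> z < p + Y s - c * s"
    "h \<in> hits Y c p z" "\<And>s. s \<in> hits Y c p z \<Longrightarrow> h \<le> s"
proof -
  have bdd: "bdd_below (hits Y c p z)" by (auto simp: hits_def intro: bdd_belowI[of _ 0])
  show h: "h \<in> hits Y c p z"
    unfolding h_def by (rule closed_contains_Inf[OF ne bdd hits_closed[OF Y(1)]])
  show lower: "h \<le> s" if "s \<in> hits Y c p z" for s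
    unfolding h_def by (rule cInf_lower[OF that bdd])
  show "0 \<le> h" using h by (simp add: hits_def)
  show below: "z < p + Y s - c * s" if "0 \<le> s" "s < h" for s
    using lower[of s] that by (force simp: hits_def)
  show "p + Y h - c * h = z"
  proof (rule ccontr)
    assume "p + Y h - c * h \<noteq> z"
    then have lt: "p + Y h - c * h < z" using h by (simp add: hits_def)
    have "continuous_on {0..h} (\<lambda>s. p + Y s - c * s)"
      by (intro continuous_intros continuous_on_subset[OF Y(1)]) auto
    then have "\<exists>s\<ge>0. s \<le> h \<and> p + Y s - c * s = z"
      using \<open>0 \<le> h\<close> lt \<open>z < p\<close> Y(2) by (intro IVT2'[of "\<lambda>s. p + Y s - c * s"]) auto
    then obtain s where "0 \<le> s" "s \<le> h" "p + Y s - c * s = z" by blast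
    then show False using below[of s] lt by (cases "s = h") auto
  qed
qed

definition shift :: "(real \<Rightarrow> real) \<Rightarrow> real \<Rightarrow> real \<Rightarrow> real" where
  "shift Y a s = Y (a + s) - Y a"

text \<open>Flattens nested restarts: however many levels have been passed, the remaining path is
  the original one restarted at a single stopping time.\<close>

lemma shift_shift: "shift (shift Y a) b = shift Y (a + b)"
  by (auto simp: shift_def fun_eq_iff add.assoc)

lemma shift_continuous: "continuous_on {0..} Y \<Longrightarrow> 0 \<le> a \<Longrightarrow> continuous_on {0..} (shift Y a)"
  unfolding shift_def[abs_def]
  by (intro continuous_on_diff continuous_on_const
      continuous_on_compose2[where f = "\<lambda>s. a + s" and s = "{0..}" and g = Y and t = "{0..}"])
    (auto intro: continuous_on_add continuous_on_const continuous_on_id)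

lemma shift_zero [simp]: "shift Y a 0 = 0"
  by (simp add: shift_def)

text \<open>A continuous path reaches \<open>z\<close> on [0, t] iff its minimum is at most
  \<open>z\<close>, which countably many sample values decide up to tolerances 1/(n+1). Sampling at
  fractions of \<open>t\<close> instead of fixed times allows the random length t - T later.\<close>

lemma hits_before_iff_grid:
  assumes Y: "continuous_on {0..} Y" and t: "0 \<le> t"
  shows "(\<exists>s\<in>hits Y c p z. s \<le> t) \<longleftrightarrow>
     (\<forall>n::nat. \<exists>m::nat. \<exists>j\<le>m. p + Y (t * (real j / real m)) - c * (t * (real j / real m)) < z + 1 / real (Suc n))"
    (is "?L \<longleftrightarrow> ?R")
proof
  let ?g = "\<lambda>s. p + Y s - c * s"
  have g: "continuous_on {0..t} ?g"
    by (intro continuous_intros continuous_on_subset[OF Y]) auto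
  assume ?L
  then obtain s where s: "0 \<le> s" "s \<le> t" "?g s \<le> z" by (auto simp: hits_def)
  show ?R
  proof
    fix n :: nat
    define r where "r = (if t = 0 then 0 else s / t)"
    have r: "0 \<le> r" "r \<le> 1" "t * r = s" using s t by (auto simp: r_def)
    define j where "j m = nat \<lfloor>real m * r\<rfloor>" for m
    have rj: "real (j m) = of_int \<lfloor>real m * r\<rfloor>" for m using r by (simp add: j_def)
    have j1: "real (j m) \<le> real m * r" for m
      unfolding rj by linarith
    have j: "j m \<le> m" for m
      using j1[of m] mult_left_mono[OF r(2), of "real m"] by (simp add: of_nat_le_iff[symmetric, where 'a=real] del: of_nat_le_iff)
    have "(\<lambda>m. real (j m) / real m) \<longlonglongrightarrow> r"
      unfolding rj by (rule filterlim_compose[OF floor_quotient_tendsto filterlim_real_sequentially])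
    then have "(\<lambda>m. t * (real (j m) / real m)) \<longlonglongrightarrow> s"
      unfolding r(3)[symmetric] by (intro tendsto_intros)
    moreover have "t * (real (j m) / real m) \<in> {0..t}" for m
    proof -
      have "real (j m) / real m \<le> 1" using j[of m] by (cases "m = 0") auto
      then show ?thesis using t mult_left_mono[of "real (j m) / real m" 1 t] by simp
    qed
    ultimately have "(\<lambda>m. ?g (t * (real (j m) / real m))) \<longlonglongrightarrow> ?g s"
      using s by (intro continuous_on_tendsto_compose[OF g]) auto
    then have "\<forall>\<^sub>F m in sequentially. ?g (t * (real (j m) / real m)) < z + 1 / real (Suc n)"
      using s(3) by (intro order_tendstoD(2)[where y="?g s"]) (auto intro: le_less_trans)
    then obtain m where "?g (t * (real (j m) / real m)) < z + 1 / real (Suc n)"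
      by (auto simp: eventually_sequentially)
    then show "\<exists>m. \<exists>j\<le>m. ?g (t * (real j / real m)) < z + 1 / real (Suc n)" using j by blast
  qed
next
  let ?g = "\<lambda>s. p + Y s - c * s"
  have g: "continuous_on {0..t} ?g"
    by (intro continuous_intros continuous_on_subset[OF Y]) auto
  assume R: ?R
  obtain s where s: "s \<in> {0..t}" "\<And>y. y \<in> {0..t} \<Longrightarrow> ?g s \<le> ?g y"
    using continuous_attains_inf[OF compact_Icc _ g] t by auto
  have "?g s \<le> z + 1 / real (Suc n)" for n
  proof -
    obtain m j where "j \<le> m" "?g (t * (real j / real m)) < z + 1 / real (Suc n)" using R by blast
    moreover have "t * (real j / real m) \<in> {0..t}"
    proof -
      have "real j / real m \<le> 1" using \<open>j \<le> m\<close> by (cases "m = 0") auto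
      then show ?thesis using t mult_left_mono[of "real j / real m" 1 t] by simp
    qed
    ultimately show ?thesis using s(2) by force
  qed
  moreover have "(\<lambda>n. z + 1 / real (Suc n)) \<longlonglongrightarrow> z" by real_asymp
  ultimately have "?g s \<le> z" by (intro tendsto_lowerbound[where F=sequentially]) (auto intro: always_eventually)
  then show ?L using s(1) by (auto simp: hits_def)
qed

text \<open>The functions \<open>f\<close> have controlled means but need not converge;
  \<open>h\<close> is an explicit pathwise minorant which does converge, and which need only lie
  below \<open>f\<close> from some index on that depends on the point.\<close>

lemma integral_le_Fatou:
  fixes f :: "nat \<Rightarrow> 'a \<Rightarrow> real"
  assumes f: "\<And>m. integrable M (f m)" "\<And>m x. x \<in> space M \<Longrightarrow> 0 \<le> f m x" "\<And>m. integral\<^sup>L M (f m) \<le> b"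
    and g: "g \<in> borel_measurable M" "\<And>x. x \<in> space M \<Longrightarrow> 0 \<le> g x"
    and h: "\<And>x. x \<in> space M \<Longrightarrow> (\<lambda>m. h m x) \<longlonglongrightarrow> g x"
       "\<And>x. x \<in> space M \<Longrightarrow> \<forall>\<^sub>F m in sequentially. h m x \<le> f m x"
  shows "integral\<^sup>L M g \<le> b"
proof -
  have "0 \<le> integral\<^sup>L M (f 0)" by (intro integral_nonneg_AE AE_I2 f(2))
  then have b: "0 \<le> b" using f(3)[of 0] by simp
  have "(\<integral>\<^sup>+x. ennreal (g x) \<partial>M) \<le> (\<integral>\<^sup>+x. liminf (\<lambda>m. ennreal (f m x)) \<partial>M)"
  proof (rule nn_integral_mono)
    fix x assume x: "x \<in> space M"
    have "(\<lambda>m. ennreal (h m x)) \<longlonglongrightarrow> ennreal (g x)" using h(1)[OF x] by (rule tendsto_ennrealI)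
    then have "ennreal (g x) = liminf (\<lambda>m. ennreal (h m x))" by (simp add: lim_imp_Liminf)
    also have "\<dots> \<le> liminf (\<lambda>m. ennreal (f m x))"
      using h(2)[OF x] by (intro Liminf_mono) (auto elim!: eventually_mono intro: ennreal_leI)
    finally show "ennreal (g x) \<le> liminf (\<lambda>m. ennreal (f m x))" .
  qed
  also have "\<dots> \<le> liminf (\<lambda>m. \<integral>\<^sup>+x. ennreal (f m x) \<partial>M)"
    using f(1) by (intro nn_integral_liminf) auto
  also have "\<dots> \<le> liminf (\<lambda>m. ennreal b)"
    using f by (intro Liminf_mono always_eventually allI) (subst nn_integral_eq_integral, auto intro!: ennreal_leI)
  also have "\<dots> = ennreal b" by (simp add: Liminf_const)
  finally have "(\<integral>\<^sup>+x. ennreal (g x) \<partial>M) \<le> ennreal b" .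
  then show ?thesis
    using g b by (intro integral_real_bounded) (auto simp: enn2real_leI)
qed

context dividend_setting
begin

definition drift_path :: "'a \<Rightarrow> real \<Rightarrow> real" where
  "drift_path \<omega> s = mu * s + sig * W s \<omega>"

lemma drift_path_continuous: "\<omega> \<in> space N \<Longrightarrow> continuous_on {0..} (drift_path \<omega>)"
  unfolding drift_path_def[abs_def] by (intro continuous_intros W_cont)

lemma drift_path_0 [simp]: "\<omega> \<in> space N \<Longrightarrow> drift_path \<omega> 0 = 0"
  by (simp add: drift_path_def W0)

text \<open>A stopping time with values in \<open>[0, \<infinity>]\<close> is given by the event \<open>D\<close> that it is
  finite and by its values \<open>T\<close> on \<open>D\<close>.\<close>

definition stopping :: "'a set \<Rightarrow> ('a \<Rightarrow> real) \<Rightarrow> bool" where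
  "stopping D T \<longleftrightarrow> D \<subseteq> space N \<and> (\<forall>\<omega>\<in>D. 0 \<le> T \<omega>) \<and> (\<forall>t\<ge>0. {\<omega> \<in> D. T \<omega> \<le> t} \<in> sets (F t))"

text \<open>Progressive measurability: rounding \<open>S\<close> down to a countable set of times
  reduces to fixed times, and path continuity passes to the limit. The truncation to [0, t] keeps
  rounded times inside the past.\<close>

lemma sample_measurable:
  assumes S: "S \<in> borel_measurable (F t)" "\<And>\<omega>. \<omega> \<in> space N \<Longrightarrow> 0 \<le> S \<omega> \<and> S \<omega> \<le> t" and t: "0 \<le> t"
  shows "(\<lambda>\<omega>. drift_path \<omega> (S \<omega>)) \<in> borel_measurable (F t)"
proof -
  have W_t: "W s \<in> borel_measurable (F t)" if "0 \<le> s" "s \<le> t" for s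
    using adapted[OF that(1)] F_mono[OF that] by (auto simp: measurable_def space_F)
  define r where "r m k = max 0 (min t (of_int k / real (Suc m)))" for m :: nat and k :: int
  have "(\<lambda>\<omega>. W (S \<omega>) \<omega>) \<in> borel_measurable (F t)"
  proof (rule borel_measurable_LIMSEQ_real)
    fix \<omega> assume \<omega>: "\<omega> \<in> space (F t)"
    have "(\<lambda>m. max 0 (min t (of_int \<lfloor>real (Suc m) * S \<omega>\<rfloor> / real (Suc m)))) \<longlonglongrightarrow> max 0 (min t (S \<omega>))"
    proof (intro tendsto_max tendsto_min tendsto_const)
      show "(\<lambda>m. of_int \<lfloor>real (Suc m) * S \<omega>\<rfloor> / real (Suc m)) \<longlonglongrightarrow> S \<omega>"
        by (rule filterlim_compose[OF floor_quotient_tendsto]) real_asymp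
    qed
    then have "(\<lambda>m. r m \<lfloor>real (Suc m) * S \<omega>\<rfloor>) \<longlonglongrightarrow> S \<omega>"
      using S(2)[of \<omega>] \<omega> unfolding r_def by (simp add: space_F)
    then show "(\<lambda>m. W (r m \<lfloor>real (Suc m) * S \<omega>\<rfloor>) \<omega>) \<longlonglongrightarrow> W (S \<omega>) \<omega>"
      using W_cont[of \<omega>] \<omega> S(2)[of \<omega>]
      by (intro continuous_on_tendsto_compose[where s="{0..}" and f="\<lambda>u. W u \<omega>"]) (auto simp: r_def space_F)
  next
    fix m
    have "(\<lambda>\<omega>. \<lfloor>real (Suc m) * S \<omega>\<rfloor>) \<in> measurable (F t) (count_space UNIV)"
      using S(1) by measurable
    moreover have "W (r m k) \<in> borel_measurable (F t)" for k using t by (intro W_t) (auto simp: r_def)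
    ultimately show "(\<lambda>\<omega>. W (r m \<lfloor>real (Suc m) * S \<omega>\<rfloor>) \<omega>) \<in> borel_measurable (F t)"
      by (rule measurable_compose_countable[where f="\<lambda>k. W (r m k)" and g="\<lambda>\<omega>. \<lfloor>real (Suc m) * S \<omega>\<rfloor>", rotated])
  qed
  then show ?thesis unfolding drift_path_def using S(1) by measurable
qed

lemma stopping_sets: "stopping D T \<Longrightarrow> D \<in> sets N"
proof -
  assume s: "stopping D T"
  have "{\<omega> \<in> D. T \<omega> \<le> real n} \<in> sets N" for n
    using s F_sub[of "real n"] unfolding stopping_def by auto
  then have "(\<Union>n. {\<omega> \<in> D. T \<omega> \<le> real n}) \<in> sets N" by (intro sets.countable_UN) auto
  moreover have "(\<Union>n. {\<omega> \<in> D. T \<omega> \<le> real n}) = D" using real_arch_simple by auto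
  ultimately show ?thesis by simp
qed

text \<open>The default \<open>t\<close> makes the remaining interval from the stopping time to
  \<open>t\<close> degenerate, instead of undefined, when the stopping time has not
  occurred.\<close>

lemma stopping_min_measurable:
  assumes s: "stopping D T" and t: "0 \<le> t"
  shows "(\<lambda>\<omega>. if \<omega> \<in> D \<and> T \<omega> \<le> t then T \<omega> else t) \<in> borel_measurable (F t)"
proof (rule borel_measurableI_le)
  fix a :: real
  have D: "\<omega> \<in> space N" "0 \<le> T \<omega>" if "\<omega> \<in> D" for \<omega> using s that by (auto simp: stopping_def)
  have "\<omega> \<in> {\<omega> \<in> space (F t). (if \<omega> \<in> D \<and> T \<omega> \<le> t then T \<omega> else t) \<le> a} \<longleftrightarrow>
    \<omega> \<in> (if a < 0 then {} else if a < t then {\<omega> \<in> D. T \<omega> \<le> a} else space (F t))" for \<omega>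
    using D[of \<omega>] t by (cases "\<omega> \<in> D") (auto simp: space_F)
  then have "{\<omega> \<in> space (F t). (if \<omega> \<in> D \<and> T \<omega> \<le> t then T \<omega> else t) \<le> a} =
    (if a < 0 then {} else if a < t then {\<omega> \<in> D. T \<omega> \<le> a} else space (F t))"
    by (rule set_eqI)
  also have "\<dots> \<in> sets (F t)"
  proof (cases "0 \<le> a \<and> a < t")
    case True
    then have "{\<omega> \<in> D. T \<omega> \<le> a} \<in> sets (F a)" using s unfolding stopping_def by blast
    then show ?thesis using True F_mono[of a t] by auto
  qed auto
  finally show "{\<omega> \<in> space (F t). (if \<omega> \<in> D \<and> T \<omega> \<le> t then T \<omega> else t) \<le> a} \<in> sets (F t)" .
qed

definition hit_set :: "real \<Rightarrow> real \<Rightarrow> real \<Rightarrow> 'a set \<Rightarrow> ('a \<Rightarrow> real) \<Rightarrow> 'a set" where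
  "hit_set c p z D T = {\<omega> \<in> D. hits (shift (drift_path \<omega>) (T \<omega>)) c p z \<noteq> {}}"

definition hit_time :: "real \<Rightarrow> real \<Rightarrow> real \<Rightarrow> ('a \<Rightarrow> real) \<Rightarrow> 'a \<Rightarrow> real" where
  "hit_time c p z T \<omega> = T \<omega> + Inf (hits (shift (drift_path \<omega>) (T \<omega>)) c p z)"

text \<open>"Hit by time t" is tested on the restarted path over the random interval [T, t]. Its
  sample times S + (t - S) r never exceed t, so \<open>sample_measurable\<close> applies to each,
  and countable operations do the rest.\<close>

lemma stopping_hit:
  assumes s: "stopping D T" and zp: "z < p"
  shows "stopping (hit_set c p z D T) (hit_time c p z T)"
proof -
  let ?Y = "\<lambda>\<omega>. shift (drift_path \<omega>) (T \<omega>)"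
  have D: "\<omega> \<in> space N" "0 \<le> T \<omega>" if "\<omega> \<in> D" for \<omega> using s that by (auto simp: stopping_def)
  have Y: "continuous_on {0..} (?Y \<omega>)" if "\<omega> \<in> D" for \<omega>
    using D[OF that] by (intro shift_continuous drift_path_continuous)
  note H = hits_Inf[OF Y _ zp, simplified]
  have "{\<omega> \<in> hit_set c p z D T. hit_time c p z T \<omega> \<le> t} \<in> sets (F t)" if t: "0 \<le> t" for t
  proof -
    define A where "A = {\<omega> \<in> D. T \<omega> \<le> t}"
    have A: "A \<in> sets (F t)" using s t by (simp add: stopping_def A_def)
    define S where "S \<omega> = (if \<omega> \<in> D \<and> T \<omega> \<le> t then T \<omega> else t)" for \<omega>
    have S[measurable]: "S \<in> borel_measurable (F t)"
      unfolding S_def[abs_def] by (rule stopping_min_measurable[OF s t])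
    have S0: "0 \<le> S \<omega>" "S \<omega> \<le> t" for \<omega> using D t by (auto simp: S_def)
    define g where "g r \<omega> = p + (drift_path \<omega> (S \<omega> + (t - S \<omega>) * r) - drift_path \<omega> (S \<omega>)) - c * ((t - S \<omega>) * r)" for r \<omega>
    have g: "g r \<in> borel_measurable (F t)" if "0 \<le> r" "r \<le> 1" for r
    proof -
      have "(t - S \<omega>) * r \<le> t - S \<omega>" for \<omega> using S0[of \<omega>] that mult_left_mono[of r 1 "t - S \<omega>"] by simp
      then have "S \<omega> + (t - S \<omega>) * r \<le> t" for \<omega> by (metis add.commute le_diff_eq)
      then have [measurable]: "(\<lambda>\<omega>. drift_path \<omega> (S \<omega> + (t - S \<omega>) * r)) \<in> borel_measurable (F t)"
        using S0 that t by (intro sample_measurable) auto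
      have [measurable]: "(\<lambda>\<omega>. drift_path \<omega> (S \<omega>)) \<in> borel_measurable (F t)"
        using S0 t by (intro sample_measurable) auto
      show ?thesis unfolding g_def[abs_def] by measurable
    qed
    have g_sets: "{\<omega> \<in> space (F t). g (real j / real m) \<omega> < z + 1 / real (Suc n)} \<in> sets (F t)"
      if "j \<le> m" for n m j
    proof -
      have "real j / real m \<le> 1" using that by (cases "m = 0") auto
      then have [measurable]: "g (real j / real m) \<in> borel_measurable (F t)" by (intro g) auto
      show ?thesis by measurable
    qed
    have "{\<omega> \<in> hit_set c p z D T. hit_time c p z T \<omega> \<le> t}
      = A \<inter> (\<Inter>n. \<Union>m. \<Union>j\<in>{..m}. {\<omega> \<in> space (F t). g (real j / real m) \<omega> < z + 1 / real (Suc n)})"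
      (is "?L = A \<inter> ?R")
    proof (intro set_eqI)
      fix \<omega>
      have iff: "\<omega> \<in> ?R \<longleftrightarrow> (\<exists>s\<in>hits (?Y \<omega>) c p z. s \<le> t - T \<omega>)" if \<omega>: "\<omega> \<in> A"
      proof -
        have \<omega>D: "\<omega> \<in> D" and Tt: "T \<omega> \<le> t" using \<omega> by (auto simp: A_def)
        have "S \<omega> = T \<omega>" using \<omega>D Tt by (simp add: S_def)
        then have "g r \<omega> = p + ?Y \<omega> ((t - T \<omega>) * r) - c * ((t - T \<omega>) * r)" for r
          unfolding g_def shift_def by simp
        then show ?thesis
          using hits_before_iff_grid[OF Y[OF \<omega>D], of "t - T \<omega>" c p z] Tt D[OF \<omega>D]
          by (auto simp: space_F Bex_def)
      qed
      show "\<omega> \<in> ?L \<longleftrightarrow> \<omega> \<in> A \<inter> ?R"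
      proof
        assume "\<omega> \<in> ?L"
        then have *: "\<omega> \<in> D" "hits (?Y \<omega>) c p z \<noteq> {}" "T \<omega> + Inf (hits (?Y \<omega>) c p z) \<le> t"
          by (auto simp: hit_set_def hit_time_def)
        note h = H[OF *(1,2)]
        have "\<omega> \<in> A" using * h(1) by (simp add: A_def)
        moreover have "\<exists>s\<in>hits (?Y \<omega>) c p z. s \<le> t - T \<omega>"
          using h(4) *(3) by (intro bexI[of _ "Inf (hits (?Y \<omega>) c p z)"]) auto
        ultimately show "\<omega> \<in> A \<inter> ?R" using iff by blast
      next
        assume R: "\<omega> \<in> A \<inter> ?R"
        then obtain s where s: "s \<in> hits (?Y \<omega>) c p z" "s \<le> t - T \<omega>" using iff by blast
        have \<omega>D: "\<omega> \<in> D" using R by (simp add: A_def)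
        have ne: "hits (?Y \<omega>) c p z \<noteq> {}" using s by auto
        show "\<omega> \<in> ?L"
          using H(5)[OF \<omega>D ne s(1)] s \<omega>D ne by (simp add: hit_set_def hit_time_def)
      qed
    qed
    also have "\<dots> \<in> sets (F t)"
    proof (rule sets.Int[OF A], rule sets.countable_INT, intro image_subsetI, rule sets.countable_UN, intro image_subsetI)
      show "(\<Union>j\<in>{..m}. {\<omega> \<in> space (F t). g (real j / real m) \<omega> < z + 1 / real (Suc n)}) \<in> sets (F t)" for n m
        by (rule sets.finite_UN) (use g_sets in auto)
    qed auto
    finally show ?thesis .
  qed
  moreover have "0 \<le> hit_time c p z T \<omega>" if "\<omega> \<in> hit_set c p z D T" for \<omega>
    using that D[of \<omega>] H(1)[of \<omega>] by (simp add: hit_set_def hit_time_def)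
  ultimately show ?thesis
    using D unfolding stopping_def by (auto simp: hit_set_def)
qed

text \<open>\<open>T\<close> is arbitrary off \<open>D\<close>, so measurability is taken from the
  truncations at integers, which stabilise at each point of \<open>D\<close>.\<close>

lemma stopping_exp_measurable:
  assumes s: "stopping D T"
  shows "(\<lambda>\<omega>. indicator D \<omega> * exp (- q * T \<omega>)) \<in> borel_measurable N"
proof -
  have [measurable]: "D \<in> sets N" by (rule stopping_sets[OF s])
  have "(\<lambda>\<omega>. if \<omega> \<in> D \<and> T \<omega> \<le> real n then T \<omega> else real n) \<in> borel_measurable N" for n
    using stopping_min_measurable[OF s, of "real n"] F_sub[of "real n"] by (auto simp: measurable_def space_F)
  then have "(\<lambda>\<omega>. indicator D \<omega> * exp (- q * (if \<omega> \<in> D \<and> T \<omega> \<le> real n then T \<omega> else real n))) \<in> borel_measurable N" for n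
    by measurable
  then show ?thesis
  proof (rule borel_measurable_LIMSEQ_real[rotated])
    fix \<omega> assume "\<omega> \<in> space N"
    obtain n0 :: nat where "T \<omega> \<le> real n0" using real_arch_simple by blast
    then have "\<forall>\<^sub>F n in sequentially. indicator D \<omega> * exp (- q * (if \<omega> \<in> D \<and> T \<omega> \<le> real n then T \<omega> else real n)) = indicator D \<omega> * exp (- q * T \<omega>)"
      by (intro eventually_mono[OF eventually_ge_at_top[of n0]]) (auto simp: indicator_def)
    then show "(\<lambda>n. indicator D \<omega> * exp (- q * (if \<omega> \<in> D \<and> T \<omega> \<le> real n then T \<omega> else real n))) \<longlonglongrightarrow> indicator D \<omega> * exp (- q * T \<omega>)"
      by (rule tendsto_eventually)
  qed
qed

lemma stopping_exp_integrable:
  assumes s: "stopping D T"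
  shows "integrable N (\<lambda>\<omega>. indicator D \<omega> * exp (- q * T \<omega>))"
proof (rule integrable_const_bound[of _ 1])
  show "AE \<omega> in N. norm (indicator D \<omega> * exp (- q * T \<omega>)) \<le> 1"
    using s q_pos unfolding stopping_def by (intro AE_I2) (auto simp: indicator_def)
qed (rule stopping_exp_measurable[OF s])

end

lemma ceiling_grid_tendsto:
  fixes T :: real
  assumes "0 \<le> T"
  shows "(\<lambda>m. real (nat \<lceil>T / (1 / real (Suc m))\<rceil>) * (1 / real (Suc m))) \<longlonglongrightarrow> T"
proof -
  have "filterlim (\<lambda>m. real (Suc m)) at_top sequentially" by real_asymp
  from filterlim_compose[OF ceiling_quotient_tendsto[of T] this] show ?thesis
    using assms by (simp add: mult.commute of_nat_nat)
qed

section \<open>A killed exponential martingale on the grid\<close>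

context dividend_setting
begin

definition by_time :: "'a set \<Rightarrow> ('a \<Rightarrow> real) \<Rightarrow> real \<Rightarrow> 'a \<Rightarrow> real" where
  "by_time D T t \<omega> = (if \<omega> \<in> D \<and> T \<omega> \<le> t then 1 else 0)"

text \<open>The exponential martingale \<open>exp (\<theta>\<^sub>1 B\<^sub>t - q t)\<close> sampled on the grid, started
  (with the discount factor as its value) at the first grid point after \<open>T\<close> and killed at the first
  grid point after \<open>T'\<close>.\<close>

primrec grid_mart :: "real \<Rightarrow> 'a set \<Rightarrow> ('a \<Rightarrow> real) \<Rightarrow> 'a set \<Rightarrow> ('a \<Rightarrow> real) \<Rightarrow> real \<Rightarrow> nat \<Rightarrow> 'a \<Rightarrow> real" where
  "grid_mart c D T D' T' d 0 \<omega> = by_time D T 0 \<omega>"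
| "grid_mart c D T D' T' d (Suc k) \<omega> =
     grid_mart c D T D' T' d k \<omega> * (1 - by_time D' T' (real k * d) \<omega>)
       * exp (\<theta>\<^sub>1 c * ((mu - c) * d + sig * (W (real k * d + d) \<omega> - W (real k * d) \<omega>)) - q * d)
     + (by_time D T (real k * d + d) \<omega> - by_time D T (real k * d) \<omega>) * exp (- q * (real k * d + d))"

lemma by_time_cases: "by_time D T t \<omega> = 0 \<or> by_time D T t \<omega> = 1 \<and> \<omega> \<in> D \<and> T \<omega> \<le> t"
  by (auto simp: by_time_def)

lemma by_time_mono: "s \<le> t \<Longrightarrow> by_time D T s \<omega> \<le> by_time D T t \<omega>"
  by (auto simp: by_time_def)

lemma by_time_measurable:
  assumes "stopping D T" "0 \<le> s" "s \<le> t"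
  shows "by_time D T s \<in> borel_measurable (F t)"
proof -
  have "{\<omega> \<in> D. T \<omega> \<le> s} \<in> sets (F t)" using assms F_mono[of s t] by (auto simp: stopping_def)
  moreover have "{\<omega> \<in> space (F t). \<omega> \<in> D \<and> T \<omega> \<le> s} = {\<omega> \<in> D. T \<omega> \<le> s}"
    using assms(1) by (auto simp: stopping_def space_F)
  ultimately show ?thesis
    unfolding by_time_def[abs_def] by (intro measurable_If) (auto simp: pred_def)
qed

context
  fixes D D' :: "'a set" and T T' :: "'a \<Rightarrow> real" and c d :: real
  assumes s: "stopping D T" and s': "stopping D' T'" and d: "0 < d"
begin

private abbreviation "L \<equiv> grid_mart c D T D' T' d"
private abbreviation "a \<equiv> \<lambda>k. by_time D T (real k * d)"
private abbreviation "b \<equiv> \<lambda>k. by_time D' T' (real k * d)"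

lemma grid_mart_nonneg: "0 \<le> L k \<omega>"
proof (induction k)
  case (Suc k)
  have "0 \<le> 1 - b k \<omega>" using by_time_cases[of D' T' "real k * d" \<omega>] by auto
  then show ?case
    using Suc by_time_mono[of "real k * d" "real k * d + d" D T \<omega>] d
    by (auto intro!: add_nonneg_nonneg mult_nonneg_nonneg)
qed (auto simp: by_time_def)

lemma grid_mart_measurable: "L k \<in> borel_measurable (F (real k * d))"
proof (induction k)
  case 0
  then show ?case using by_time_measurable[OF s, of 0 0] by simp
next
  case (Suc k)
  let ?t = "real k * d"
  have t: "0 \<le> ?t" "?t \<le> ?t + d" "0 \<le> ?t + d" using d by auto
  have mono: "f \<in> borel_measurable (F (?t + d))" if "f \<in> borel_measurable (F ?t)" for f :: "'a \<Rightarrow> real"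
    using F_mono[OF t(1,2)] that by (auto simp: measurable_def space_F)
  have [measurable]: "L k \<in> borel_measurable (F (?t + d))" "W ?t \<in> borel_measurable (F (?t + d))"
    "W (?t + d) \<in> borel_measurable (F (?t + d))" "by_time D T ?t \<in> borel_measurable (F (?t + d))"
    "by_time D T (?t + d) \<in> borel_measurable (F (?t + d))" "by_time D' T' ?t \<in> borel_measurable (F (?t + d))"
    using mono[OF Suc] mono[OF adapted[OF t(1)]] adapted[OF t(3)] by_time_measurable[OF s] by_time_measurable[OF s'] t by auto
  have e: "real (Suc k) * d = ?t + d" by (simp add: algebra_simps)
  show ?case unfolding e grid_mart.simps[abs_def] by measurable
qed

lemma by_time_k_measurable: "a k \<in> borel_measurable (F (real k * d))" "b k \<in> borel_measurable (F (real k * d))"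
  using by_time_measurable[OF s, of "real k * d" "real k * d"] by_time_measurable[OF s', of "real k * d" "real k * d"] d by auto

lemma by_time_integrable:
  assumes "stopping E U" "0 \<le> t" "g \<in> borel_measurable N" "\<And>\<omega>. \<omega> \<in> E \<Longrightarrow> U \<omega> \<le> t \<Longrightarrow> \<bar>g \<omega>\<bar> \<le> B" "0 \<le> B"
  shows "integrable N (\<lambda>\<omega>. by_time E U t \<omega> * g \<omega>)"
proof (rule integrable_const_bound[of _ B])
  show "AE \<omega> in N. norm (by_time E U t \<omega> * g \<omega>) \<le> B"
    using assms(4,5) by (intro AE_I2) (auto simp: by_time_def)
  have "by_time E U t \<in> borel_measurable N"
    using by_time_measurable[OF assms(1,2) order_refl] F_N_measurable[OF assms(2)] by blast
  then show "(\<lambda>\<omega>. by_time E U t \<omega> * g \<omega>) \<in> borel_measurable N" using assms(3) by measurable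
qed

text \<open>The multiplicative factor of one cell has mean 1 by \<open>theta1_char\<close>, so the
  expectation changes only through killing and through new entries.\<close>

lemma grid_mart_step:
  assumes i: "integrable N (L k)"
  shows "integrable N (\<lambda>\<omega>. L k \<omega> * b k \<omega>)" "integrable N (L (Suc k))"
    "expectation (L (Suc k)) = expectation (L k) - expectation (\<lambda>\<omega>. L k \<omega> * b k \<omega>)
       + expectation (\<lambda>\<omega>. (a (Suc k) \<omega> - a k \<omega>) * exp (- q * (real (Suc k) * d)))"
proof -
  let ?t = "real k * d"
  have t: "0 \<le> ?t" "0 \<le> ?t + d" using d by auto
  let ?Z = "\<lambda>\<omega>. L k \<omega> * (1 - b k \<omega>)"
  let ?D = "\<lambda>\<omega>. W (?t + d) \<omega> - W ?t \<omega>"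
  have Zm: "?Z \<in> borel_measurable (F ?t)"
    using grid_mart_measurable[of k] by_time_k_measurable[of k] by measurable
  have b01: "b k \<omega> = 0 \<or> b k \<omega> = 1" for \<omega> by (auto simp: by_time_def)
  have "(\<lambda>\<omega>. L k \<omega> * b k \<omega>) \<in> borel_measurable (F ?t)"
    using grid_mart_measurable[of k] by_time_k_measurable[of k] by measurable
  then have "(\<lambda>\<omega>. L k \<omega> * b k \<omega>) \<in> borel_measurable N" by (rule F_N_measurable[OF t(1)])
  then show Lb: "integrable N (\<lambda>\<omega>. L k \<omega> * b k \<omega>)"
  proof (rule Bochner_Integration.integrable_bound[OF i])
    show "AE \<omega> in N. norm (L k \<omega> * b k \<omega>) \<le> norm (L k \<omega>)"
    proof (rule AE_I2)
      fix \<omega> show "norm (L k \<omega> * b k \<omega>) \<le> norm (L k \<omega>)" using b01[of \<omega>] by auto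
    qed
  qed
  have Zi: "integrable N ?Z" using i Lb by (simp add: right_diff_distrib)
  note m = incr_mgf[OF t(1) d Zm Zi, of "\<theta>\<^sub>1 c * sig"]
  let ?e = "exp (\<theta>\<^sub>1 c * ((mu - c) * d) - q * d)"
  have e: "?Z \<omega> * exp (\<theta>\<^sub>1 c * ((mu - c) * d + sig * ?D \<omega>) - q * d) = ?e * (?Z \<omega> * exp (\<theta>\<^sub>1 c * sig * ?D \<omega>))" for \<omega>
  proof -
    have "\<theta>\<^sub>1 c * ((mu - c) * d + sig * ?D \<omega>) - q * d = (\<theta>\<^sub>1 c * ((mu - c) * d) - q * d) + \<theta>\<^sub>1 c * sig * ?D \<omega>"
      by (simp add: algebra_simps)
    then show ?thesis by (simp only: exp_add mult.left_commute)
  qed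
  have "\<theta>\<^sub>1 c * ((mu - c) * d) - q * d + (\<theta>\<^sub>1 c * sig)\<^sup>2 * d / 2 = (sig\<^sup>2 * (\<theta>\<^sub>1 c)\<^sup>2 / 2 + (mu - c) * \<theta>\<^sub>1 c - q) * d"
    by (simp add: algebra_simps power2_eq_square)
  then have one: "?e * exp ((\<theta>\<^sub>1 c * sig)\<^sup>2 * d / 2) = 1"
    unfolding theta1_char by (simp add: exp_add[symmetric])
  have e1: "integrable N (\<lambda>\<omega>. ?Z \<omega> * exp (\<theta>\<^sub>1 c * ((mu - c) * d + sig * ?D \<omega>) - q * d))"
    unfolding e by (rule integrable_mult_right[OF m(1)])
  have e2: "expectation (\<lambda>\<omega>. ?Z \<omega> * exp (\<theta>\<^sub>1 c * ((mu - c) * d + sig * ?D \<omega>) - q * d)) = expectation ?Z"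
    unfolding e integral_mult_right_zero m(2) using one by (simp add: mult.left_commute)
  have st: "real (Suc k) * d = ?t + d" by (simp add: algebra_simps)
  have a_int: "integrable N (\<lambda>\<omega>. (a (Suc k) \<omega> - a k \<omega>) * exp (- q * (real (Suc k) * d)))"
    using by_time_integrable[OF s, of ?t "\<lambda>_. 1" 1] by_time_integrable[OF s, of "?t + d" "\<lambda>_. 1" 1] t
    unfolding st by (intro integrable_mult_left Bochner_Integration.integrable_diff) auto
  have L: "L (Suc k) = (\<lambda>\<omega>. ?Z \<omega> * exp (\<theta>\<^sub>1 c * ((mu - c) * d + sig * ?D \<omega>) - q * d)
      + (a (Suc k) \<omega> - a k \<omega>) * exp (- q * (real (Suc k) * d)))"
    unfolding st by (simp add: fun_eq_iff)
  show "integrable N (L (Suc k))" unfolding L by (rule Bochner_Integration.integrable_add[OF e1 a_int])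
  have "expectation ?Z = expectation (L k) - expectation (\<lambda>\<omega>. L k \<omega> * b k \<omega>)"
    using i Lb by (simp add: right_diff_distrib)
  then show "expectation (L (Suc k)) = expectation (L k) - expectation (\<lambda>\<omega>. L k \<omega> * b k \<omega>)
       + expectation (\<lambda>\<omega>. (a (Suc k) \<omega> - a k \<omega>) * exp (- q * (real (Suc k) * d)))"
    unfolding L Bochner_Integration.integral_add[OF e1 a_int] e2 by simp
qed

lemma grid_mart_integrable: "integrable N (L k)"
proof (induction k)
  case 0
  then show ?case using by_time_integrable[OF s, of 0 "\<lambda>_. 1" 1] by simp
next
  case (Suc k)
  then show ?case by (rule grid_mart_step(2))
qed

text \<open>What is killed cannot exceed what has entered. Entries occur at the first grid point
  after \<open>T\<close> and so carry a weight of at most exp (- q T).\<close>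

lemma killed_mass:
  "(\<Sum>k<n. expectation (\<lambda>\<omega>. L k \<omega> * b k \<omega>)) \<le> expectation (\<lambda>\<omega>. indicator D \<omega> * exp (- q * T \<omega>))"
proof -
  let ?e = "\<lambda>\<omega>. indicator D \<omega> * exp (- q * T \<omega>)"
  have D0: "0 \<le> T \<omega>" if "\<omega> \<in> D" for \<omega> using s that by (simp add: stopping_def)
  have em: "?e \<in> borel_measurable N" by (rule stopping_exp_measurable[OF s])
  have ai: "integrable N (\<lambda>\<omega>. a k \<omega> * ?e \<omega>)" for k
    using D0 d q_pos by (intro by_time_integrable[OF s _ em, of _ 1]) auto
  have "(\<Sum>k<n. expectation (\<lambda>\<omega>. L k \<omega> * b k \<omega>)) + expectation (L n) \<le> expectation (\<lambda>\<omega>. a n \<omega> * ?e \<omega>)"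
  proof (induction n)
    case 0
    have "expectation (L 0) = expectation (\<lambda>\<omega>. a 0 \<omega> * ?e \<omega>)"
      using D0 by (intro Bochner_Integration.integral_cong refl) (force simp: by_time_def)
    then show ?case unfolding lessThan_0 sum.empty add_0 by (rule eq_refl)
  next
    case (Suc n)
    have "expectation (\<lambda>\<omega>. (a (Suc n) \<omega> - a n \<omega>) * exp (- q * (real (Suc n) * d)))
       \<le> expectation (\<lambda>\<omega>. a (Suc n) \<omega> * ?e \<omega> - a n \<omega> * ?e \<omega>)"
    proof (rule integral_mono')
      show "integrable N (\<lambda>\<omega>. a (Suc n) \<omega> * ?e \<omega> - a n \<omega> * ?e \<omega>)"
        by (rule Bochner_Integration.integrable_diff[OF ai ai])
      fix \<omega>
      have nd: "real n * d \<le> real (Suc n) * d" using d by (intro mult_right_mono) auto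
      have "(a (Suc n) \<omega> - a n \<omega>) * exp (- q * (real (Suc n) * d)) \<le> (a (Suc n) \<omega> - a n \<omega>) * ?e \<omega>"
      proof (cases "\<omega> \<in> D \<and> T \<omega> \<le> real (Suc n) * d")
        case True
        then have "exp (- q * (real (Suc n) * d)) \<le> ?e \<omega>" using q_pos by simp
        then show ?thesis using by_time_mono[OF nd, of D T \<omega>] by (intro mult_left_mono) auto
      next
        case False
        then have "a (Suc n) \<omega> = 0" "a n \<omega> = 0" using nd by (auto simp: by_time_def)
        then show ?thesis by simp
      qed
      then show "(a (Suc n) \<omega> - a n \<omega>) * exp (- q * (real (Suc n) * d)) \<le> a (Suc n) \<omega> * ?e \<omega> - a n \<omega> * ?e \<omega>"
        by (simp only: left_diff_distrib)
      have "0 \<le> (a (Suc n) \<omega> - a n \<omega>) * ?e \<omega>"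
        using by_time_mono[OF nd, of D T \<omega>] by (intro mult_nonneg_nonneg) auto
      then show "0 \<le> a (Suc n) \<omega> * ?e \<omega> - a n \<omega> * ?e \<omega>" by (simp only: left_diff_distrib)
    qed
    also have "\<dots> = expectation (\<lambda>\<omega>. a (Suc n) \<omega> * ?e \<omega>) - expectation (\<lambda>\<omega>. a n \<omega> * ?e \<omega>)"
      by (rule Bochner_Integration.integral_diff[OF ai ai])
    finally show ?case
      using Suc unfolding grid_mart_step(3)[OF grid_mart_integrable] by simp
  qed
  moreover have "0 \<le> expectation (L n)" by (intro integral_nonneg_AE AE_I2 grid_mart_nonneg)
  moreover have "expectation (\<lambda>\<omega>. a n \<omega> * ?e \<omega>) \<le> expectation ?e"
    by (rule integral_mono'[OF stopping_exp_integrable[OF s]]) (auto simp: by_time_def)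
  ultimately show ?thesis by simp
qed

text \<open>Between the first grid points \<open>k0\<close> after \<open>T\<close> and
  \<open>k1\<close> after \<open>T'\<close> the factors telescope: their discounts join the entry
  weight to give exp (- q k1 d), their exponents give the increment of \<open>B\<close>. For
  \<open>k0\<close> = \<open>k1\<close> only the entry weight remains.\<close>

lemma grid_mart_path:
  assumes \<omega>: "\<omega> \<in> D" "\<omega> \<in> D'" and TT': "T \<omega> \<le> T' \<omega>"
  defines "B \<equiv> \<lambda>u. drift_path \<omega> u - c * u"
  defines "k0 \<equiv> nat \<lceil>T \<omega> / d\<rceil>"
  defines "k1 \<equiv> nat \<lceil>T' \<omega> / d\<rceil>"
  shows "L k1 \<omega> * b k1 \<omega> = exp (- q * (real k1 * d) + \<theta>\<^sub>1 c * (B (real k1 * d) - B (real k0 * d)))"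
proof -
  have T0: "0 \<le> T \<omega>" using s \<omega> by (simp add: stopping_def)
  have grid: "U \<le> real k * d \<longleftrightarrow> nat \<lceil>U / d\<rceil> \<le> k" if "0 \<le> U" for U k
    using d that by (simp add: nat_le_iff ceiling_le_iff pos_divide_le_eq)
  have a: "a k \<omega> = (if k0 \<le> k then 1 else 0)" and b: "b k \<omega> = (if k1 \<le> k then 1 else 0)" for k
    using grid[OF T0, of k] grid[of "T' \<omega>" k] T0 TT' \<omega> unfolding k0_def k1_def by (auto simp: by_time_def)
  have st: "real k * d + d = real (Suc k) * d" for k by (simp add: algebra_simps)
  have before: "L k \<omega> = 0" if "k < k0" for k
    using that
  proof (induction k)
    case 0
    then show ?case using a[of 0] by simp
  next
    case (Suc k)
    then show ?case using a[of k] a[of "Suc k"] unfolding grid_mart.simps st by simp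
  qed
  have start: "L k0 \<omega> = exp (- q * (real k0 * d))"
  proof (cases k0)
    case 0
    then show ?thesis using a[of 0] by simp
  next
    case (Suc k)
    then show ?thesis using before[of k] a[of k] a[of "Suc k"] unfolding Suc grid_mart.simps st by simp
  qed
  have k01: "k0 \<le> k1" unfolding k0_def k1_def using TT' d by (intro nat_mono ceiling_mono divide_right_mono) auto
  have "L k \<omega> = exp (- q * (real k * d) + \<theta>\<^sub>1 c * (B (real k * d) - B (real k0 * d)))" if "k0 \<le> k" "k \<le> k1" for k
    using that
  proof (induction k rule: dec_induct)
    case base
    then show ?case using start by simp
  next
    case (step k)
    have "B (real (Suc k) * d) - B (real k * d) = (mu - c) * d + sig * (W (real k * d + d) \<omega> - W (real k * d) \<omega>)"
      unfolding B_def drift_path_def st by (simp add: algebra_simps)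
    moreover have "L (Suc k) \<omega> = L k \<omega> * exp (\<theta>\<^sub>1 c * ((mu - c) * d + sig * (W (real k * d + d) \<omega> - W (real k * d) \<omega>)) - q * d)"
      using a[of k] a[of "Suc k"] b[of k] step unfolding grid_mart.simps st by simp
    ultimately have "L (Suc k) \<omega> = exp (- q * (real k * d) + \<theta>\<^sub>1 c * (B (real k * d) - B (real k0 * d)))
        * exp (\<theta>\<^sub>1 c * (B (real (Suc k) * d) - B (real k * d)) - q * d)"
      using step by simp
    also have "\<dots> = exp (- q * (real (Suc k) * d) + \<theta>\<^sub>1 c * (B (real (Suc k) * d) - B (real k0 * d)))"
      unfolding exp_add[symmetric] by (simp add: algebra_simps)
    finally show ?case .
  qed
  from this[OF k01 order_refl] show ?thesis using b[of k1] by simp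
qed

end

lemma first_passage_laplace:
  assumes s: "stopping D T" and zp: "z < p"
  shows "expectation (\<lambda>\<omega>. indicator (hit_set c p z D T) \<omega> * exp (- q * hit_time c p z T \<omega>))
    \<le> exp (\<theta>\<^sub>1 c * (p - z)) * expectation (\<lambda>\<omega>. indicator D \<omega> * exp (- q * T \<omega>))"
proof -
  let ?D' = "hit_set c p z D T" and ?T' = "hit_time c p z T"
  have s': "stopping ?D' ?T'" by (rule stopping_hit[OF s zp])
  define B where "B \<omega> u = drift_path \<omega> u - c * u" for \<omega> u
  define d where "d m = 1 / real (Suc m)" for m
  have d: "0 < d m" for m by (simp add: d_def)
  \<comment> \<open>Here Suc m * Suc m cells of width 1 / Suc m reach time m + 1, so the horizon
    grows while the mesh shrinks.\<close>
  define f where "f m \<omega> = (\<Sum>k<Suc m * Suc m. grid_mart c D T ?D' ?T' (d m) k \<omega> * by_time ?D' ?T' (real k * d m) \<omega>)" for m \<omega>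
  \<comment> \<open>Between \<open>T\<close> and \<open>T'\<close> the drifted path \<open>B\<close>
    drops by exactly p - z, so the exponential of its increment is the constant exp (-
    \<open>\<theta>\<^sub>1 c\<close> (p - z)).\<close>
  define g where "g \<omega> = indicator ?D' \<omega> * exp (- q * ?T' \<omega>) * exp (- \<theta>\<^sub>1 c * (p - z))" for \<omega>
  \<comment> \<open>The single summand of \<open>f\<close> at the first grid point after
    \<open>T'\<close>, in closed form; the other summands are nonnegative and are dropped.\<close>
  define h where "h m \<omega> = (if \<omega> \<in> ?D' then
      exp (- q * (real (nat \<lceil>?T' \<omega> / d m\<rceil>) * d m)
        + \<theta>\<^sub>1 c * (B \<omega> (real (nat \<lceil>?T' \<omega> / d m\<rceil>) * d m) - B \<omega> (real (nat \<lceil>T \<omega> / d m\<rceil>) * d m)))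
      else 0)" for m \<omega>
  note i = grid_mart_step(1)[OF s s' d grid_mart_integrable[OF s s' d]]
  have D': "\<omega> \<in> D" "\<omega> \<in> space N" "0 \<le> T \<omega>" "T \<omega> \<le> ?T' \<omega>" "B \<omega> (?T' \<omega>) - B \<omega> (T \<omega>) = z - p" if "\<omega> \<in> ?D'" for \<omega>
  proof -
    show D: "\<omega> \<in> D" using that by (simp add: hit_set_def)
    show N: "\<omega> \<in> space N" and T0: "0 \<le> T \<omega>" using s D by (auto simp: stopping_def)
    have Y: "continuous_on {0..} (shift (drift_path \<omega>) (T \<omega>))"
      by (intro shift_continuous drift_path_continuous N T0)
    note H = hits_Inf[OF Y shift_zero zp, of c]
    have ne: "hits (shift (drift_path \<omega>) (T \<omega>)) c p z \<noteq> {}" using that by (simp add: hit_set_def)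
    show "T \<omega> \<le> ?T' \<omega>" using H(1)[OF ne] by (simp add: hit_time_def)
    show "B \<omega> (?T' \<omega>) - B \<omega> (T \<omega>) = z - p"
      using H(2)[OF ne] unfolding B_def hit_time_def shift_def by (simp add: algebra_simps)
  qed
  have mart0: "0 \<le> grid_mart c D T ?D' ?T' (d m) k \<omega> * by_time ?D' ?T' (real k * d m) \<omega>" for m k \<omega>
    using grid_mart_nonneg[OF s s' d] by (auto simp: by_time_def)
  have "expectation g \<le> expectation (\<lambda>\<omega>. indicator D \<omega> * exp (- q * T \<omega>))"
  proof (rule integral_le_Fatou[where f = f and h = h])
    show "integrable N (f m)" for m unfolding f_def[abs_def] by (rule Bochner_Integration.integrable_sum[OF i])
    show "0 \<le> f m \<omega>" for m \<omega> unfolding f_def by (intro sum_nonneg mart0)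
    show "expectation (f m) \<le> expectation (\<lambda>\<omega>. indicator D \<omega> * exp (- q * T \<omega>))" for m
      unfolding f_def Bochner_Integration.integral_sum[OF i] by (rule killed_mass[OF s s' d])
    show "g \<in> borel_measurable N"
      unfolding g_def[abs_def] by (intro borel_measurable_times stopping_exp_measurable[OF s']) auto
    show "0 \<le> g \<omega>" for \<omega> by (simp add: g_def)
    fix \<omega>
    show "(\<lambda>m. h m \<omega>) \<longlonglongrightarrow> g \<omega>"
    proof (cases "\<omega> \<in> ?D'")
      case True
      note D = D'[OF True]
      have B_lim: "(\<lambda>m. B \<omega> (real (nat \<lceil>U / d m\<rceil>) * d m)) \<longlonglongrightarrow> B \<omega> U" if "0 \<le> U" for U
      proof -
        have "continuous_on {0..} (B \<omega>)"
          unfolding B_def[abs_def] by (intro continuous_intros drift_path_continuous D)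
        then show ?thesis
        proof (rule continuous_on_tendsto_compose)
          show "(\<lambda>m. real (nat \<lceil>U / d m\<rceil>) * d m) \<longlonglongrightarrow> U"
            unfolding d_def by (rule ceiling_grid_tendsto[OF that])
          show "\<forall>\<^sub>F m in sequentially. real (nat \<lceil>U / d m\<rceil>) * d m \<in> {0..}"
            using d by (intro always_eventually) (simp add: less_imp_le)
        qed (use that in simp)
      qed
      have "(\<lambda>m. h m \<omega>) \<longlonglongrightarrow> exp (- q * ?T' \<omega> + \<theta>\<^sub>1 c * (B \<omega> (?T' \<omega>) - B \<omega> (T \<omega>)))"
      proof -
        have T'0: "0 \<le> ?T' \<omega>" using D by simp
        have "(\<lambda>m. real (nat \<lceil>?T' \<omega> / d m\<rceil>) * d m) \<longlonglongrightarrow> ?T' \<omega>"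
          unfolding d_def by (rule ceiling_grid_tendsto[OF T'0])
        then show ?thesis
          unfolding h_def if_P[OF True] by (intro tendsto_intros B_lim T'0 D(3))
      qed
      moreover have "exp (- q * ?T' \<omega> + \<theta>\<^sub>1 c * (B \<omega> (?T' \<omega>) - B \<omega> (T \<omega>))) = g \<omega>"
        unfolding D(5) g_def using True by (simp add: exp_add[symmetric] algebra_simps)
      ultimately show ?thesis by simp
    qed (simp add: h_def g_def)
    show "\<forall>\<^sub>F m in sequentially. h m \<omega> \<le> f m \<omega>"
    proof (cases "\<omega> \<in> ?D'")
      case True
      note D = D'[OF True]
      obtain m0 :: nat where m0: "?T' \<omega> < real m0" using reals_Archimedean2 by blast
      have "h m \<omega> \<le> f m \<omega>" if "m0 \<le> m" for m
      proof -
        let ?k = "nat \<lceil>?T' \<omega> / d m\<rceil>"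
        have hm: "h m \<omega> = grid_mart c D T ?D' ?T' (d m) ?k \<omega> * by_time ?D' ?T' (real ?k * d m) \<omega>"
          using grid_mart_path[OF s s' d D(1) True D(4), of c m] True unfolding h_def B_def by simp
        have "?k \<in> {..<Suc m * Suc m}"
        proof -
          have "real ?k < ?T' \<omega> / d m + 1"
            using D d[of m] by (simp add: of_nat_nat) linarith
          also have "\<dots> = ?T' \<omega> * real (Suc m) + 1" by (simp add: d_def)
          also have "\<dots> \<le> real m * real (Suc m) + 1"
            using m0 that by (intro add_right_mono mult_right_mono) auto
          also have "\<dots> \<le> real (Suc m * Suc m)" by (simp add: algebra_simps)
          finally show ?thesis by (simp only: of_nat_less_iff lessThan_iff)
        qed
        then show ?thesis
          unfolding f_def hm by (rule member_le_sum) (use mart0 in auto)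
      qed
      then show ?thesis by (intro eventually_sequentiallyI[of m0]) auto
    next
      case False
      moreover have "0 \<le> f m \<omega>" for m
        unfolding f_def by (intro sum_nonneg mart0)
      ultimately show ?thesis by (simp add: h_def)
    qed
  qed
  then have "exp (- \<theta>\<^sub>1 c * (p - z)) * expectation (\<lambda>\<omega>. indicator ?D' \<omega> * exp (- q * ?T' \<omega>))
      \<le> expectation (\<lambda>\<omega>. indicator D \<omega> * exp (- q * T \<omega>))"
    unfolding g_def integral_mult_left_zero by (simp add: mult.commute)
  then have "exp (\<theta>\<^sub>1 c * (p - z)) * (exp (- \<theta>\<^sub>1 c * (p - z)) * expectation (\<lambda>\<omega>. indicator ?D' \<omega> * exp (- q * ?T' \<omega>)))
      \<le> exp (\<theta>\<^sub>1 c * (p - z)) * expectation (\<lambda>\<omega>. indicator D \<omega> * exp (- q * T \<omega>))"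
    by (intro mult_left_mono) auto
  then show ?thesis by (simp add: mult.assoc[symmetric] exp_add[symmetric])
qed

end

subsection \<open>Paths of threshold strategies\<close>

text \<open>The recursion in terms of \<open>hits\<close> and \<open>shift\<close>, with the two
  situations in which the top rate is still paid merged: never hit, or not hit yet.\<close>

lemma thr_Suc:
  "thr z cs (Suc i) x Y t =
    (if x \<le> z (Suc i) then thr z cs i x Y t
     else if hits Y (cs (Suc i)) x (z (Suc i)) = {} \<or> t < Inf (hits Y (cs (Suc i)) x (z (Suc i))) then cs (Suc i)
     else thr z cs i (z (Suc i)) (shift Y (Inf (hits Y (cs (Suc i)) x (z (Suc i)))))
            (t - Inf (hits Y (cs (Suc i)) x (z (Suc i)))))"
  unfolding hits_def shift_def[abs_def] thr.simps(2) Let_def by (simp only: if_split simp_thms) auto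

declare thr.simps(2) [simp del]

text \<open>A strategy at level \<open>i\<close> reads only thresholds 1 to i. This reconciles the
  partial tables of \<open>zstep\<close> with the complete threshold function.\<close>

lemma thr_cong: "(\<And>j. 1 \<le> j \<Longrightarrow> j \<le> i \<Longrightarrow> z j = z' j) \<Longrightarrow> thr z cs i x Y t = thr z' cs i x Y t"
proof (induction i arbitrary: x Y t)
  case (Suc i)
  then show ?case by (simp add: thr_Suc)
qed simp

lemma thr_right_constant: "\<exists>e>0. \<forall>s. t \<le> s \<and> s < t + e \<longrightarrow> thr z cs i x Y s = thr z cs i x Y t"
proof (induction i arbitrary: x Y t)
  case 0
  show ?case by (intro exI[of _ 1]) simp
next
  case (Suc i)
  let ?H = "hits Y (cs (Suc i)) x (z (Suc i))"
  consider "x \<le> z (Suc i)" | "z (Suc i) < x" "?H = {}" | "z (Suc i) < x" "?H \<noteq> {}" "t < Inf ?H"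
    | "z (Suc i) < x" "?H \<noteq> {}" "Inf ?H \<le> t" by linarith
  then show ?case
  proof cases
    case 1
    then show ?thesis using Suc by (simp add: thr_Suc)
  next
    case 2
    then show ?thesis by (intro exI[of _ 1]) (simp add: thr_Suc)
  next
    case 3
    then show ?thesis by (intro exI[of _ "Inf ?H - t"]) (simp add: thr_Suc)
  next
    case 4
    obtain e where e: "e > 0" "\<And>s. t - Inf ?H \<le> s \<Longrightarrow> s < t - Inf ?H + e \<Longrightarrow>
        thr z cs i (z (Suc i)) (shift Y (Inf ?H)) s = thr z cs i (z (Suc i)) (shift Y (Inf ?H)) (t - Inf ?H)"
      using Suc[of "t - Inf ?H" "z (Suc i)" "shift Y (Inf ?H)"] by blast
    have "thr z cs (Suc i) x Y s = thr z cs (Suc i) x Y t" if "t \<le> s" "s < t + e" for s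
      using 4 that e(2)[of "s - Inf ?H"] by (simp add: thr_Suc)
    then show ?thesis using e(1) by blast
  qed
qed

lemma thr_right_continuous: "continuous (at_right t) (thr z cs i x Y)"
proof -
  obtain e where e: "e > 0" "\<And>s. t \<le> s \<Longrightarrow> s < t + e \<Longrightarrow> thr z cs i x Y s = thr z cs i x Y t"
    using thr_right_constant by blast
  have "\<forall>\<^sub>F s in at_right t. thr z cs i x Y s = thr z cs i x Y t"
  proof (rule eventually_at_rightI)
    show "t < t + e" using e(1) by simp
    show "thr z cs i x Y s = thr z cs i x Y t" if "s \<in> {t<..<t + e}" for s
      by (rule e(2)) (use that in auto)
  qed
  then have "(thr z cs i x Y \<longlongrightarrow> thr z cs i x Y t) (at_right t)" by (rule tendsto_eventually)
  then show ?thesis by (simp add: continuous_within)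
qed

lemma thr_measurable [measurable]: "thr z cs i x Y \<in> borel_measurable borel"
proof (induction i arbitrary: x Y)
  case 0
  have "thr z cs 0 x Y = (\<lambda>_. 0)" by auto
  then show ?case by simp
next
  case (Suc i)
  let ?H = "hits Y (cs (Suc i)) x (z (Suc i))"
  have [measurable]: "thr z cs i (z (Suc i)) (shift Y (Inf ?H)) \<in> borel_measurable borel" by (rule Suc)
  show ?case
  proof (cases "x \<le> z (Suc i)")
    case True
    then have "thr z cs (Suc i) x Y = thr z cs i x Y" by (auto simp: thr_Suc)
    then show ?thesis using Suc by simp
  next
    case False
    then have "thr z cs (Suc i) x Y = (\<lambda>t. if ?H = {} \<or> t < Inf ?H then cs (Suc i) else thr z cs i (z (Suc i)) (shift Y (Inf ?H)) (t - Inf ?H))"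
      by (auto simp: thr_Suc)
    moreover have "(\<lambda>t. if ?H = {} \<or> t < Inf ?H then cs (Suc i) else thr z cs i (z (Suc i)) (shift Y (Inf ?H)) (t - Inf ?H)) \<in> borel_measurable borel"
      by measurable
    ultimately show ?thesis by (simp only:)
  qed
qed

locale rate_levels =
  fixes cs :: "nat \<Rightarrow> real" and n :: nat
  assumes cs_0: "cs 0 = 0" and cs_step: "\<And>j. j < n \<Longrightarrow> cs j < cs (Suc j)"
begin

lemma cs_less: "j < k \<Longrightarrow> k \<le> n \<Longrightarrow> cs j < cs k"
proof (induction k)
  case (Suc k)
  then show ?case using cs_step[of k] by (cases "j = k") auto
qed simp

lemma cs_le: "j \<le> k \<Longrightarrow> k \<le> n \<Longrightarrow> cs j \<le> cs k"
  using cs_less[of j k] by (cases "j = k") auto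

lemma cs_nonneg: "k \<le> n \<Longrightarrow> 0 \<le> cs k"
  using cs_le[of 0 k] cs_0 by simp

lemma thr_range: "thr z cs i x Y t \<in> cs ` {0..i}"
proof (induction i arbitrary: x Y t)
  case 0
  show ?case using cs_0 by simp
next
  case (Suc i)
  have "thr z cs i x' Y' t' \<in> cs ` {0..Suc i}" for x' Y' t'
    using Suc[of x' Y' t'] by (rule rev_subsetD) auto
  then show ?case by (auto simp: thr_Suc)
qed

lemma thr_bounds: "i \<le> n \<Longrightarrow> 0 \<le> thr z cs i x Y t \<and> thr z cs i x Y t \<le> cs i"
  using thr_range[of z i x Y t] cs_nonneg cs_le by fastforce

lemma thr_antimono: "i \<le> n \<Longrightarrow> s \<le> t \<Longrightarrow> thr z cs i x Y t \<le> thr z cs i x Y s"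
proof (induction i arbitrary: x Y s t)
  case (Suc i)
  have "thr z cs i x' Y' t' \<le> cs (Suc i)" for x' Y' t'
    using thr_bounds[of i z x' Y' t'] cs_step[of i] Suc.prems by simp
  then show ?case using Suc by (auto simp: thr_Suc)
qed simp

end

section \<open>The payoff as a functional of the path\<close>

text \<open>Surplus, ruin and payoff are restated for a single deterministic path, so that the part
  after a hit is the same functional of the shifted path.\<close>

definition thr_surplus :: "(nat \<Rightarrow> real) \<Rightarrow> (nat \<Rightarrow> real) \<Rightarrow> nat \<Rightarrow> real \<Rightarrow> (real \<Rightarrow> real) \<Rightarrow> real \<Rightarrow> real" where
  "thr_surplus z cs i p Y t = p + Y t - (LINT s:{0..t}|lborel. thr z cs i p Y s)"

definition thr_ruin :: "(nat \<Rightarrow> real) \<Rightarrow> (nat \<Rightarrow> real) \<Rightarrow> nat \<Rightarrow> real \<Rightarrow> (real \<Rightarrow> real) \<Rightarrow> ereal" where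
  "thr_ruin z cs i p Y = Inf {ereal t | t. 0 \<le> t \<and> thr_surplus z cs i p Y t < 0}"

definition thr_pay :: "real \<Rightarrow> real \<Rightarrow> (nat \<Rightarrow> real) \<Rightarrow> (nat \<Rightarrow> real) \<Rightarrow> nat \<Rightarrow> real \<Rightarrow> (real \<Rightarrow> real) \<Rightarrow> real" where
  "thr_pay q Lam z cs i p Y =
     (LINT s:{s. 0 \<le> s \<and> ereal s < thr_ruin z cs i p Y}|lborel. exp (- q * s) * (thr z cs i p Y s + Lam))"

lemma thr_ruin_nonneg: "0 \<le> thr_ruin z cs i p Y"
  unfolding thr_ruin_def by (rule Inf_greatest) auto

lemma integral_shift:
  fixes f :: "real \<Rightarrow> real"
  shows "(\<integral>s. f s \<partial>lborel) = (\<integral>s. f (h + s) \<partial>lborel)"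
  using lborel_integral_real_affine[of 1 f h] by simp

lemma integrable_shift:
  fixes f :: "real \<Rightarrow> real"
  shows "integrable lborel (\<lambda>s. f (s - h)) \<longleftrightarrow> integrable lborel f"
  using lborel_integrable_real_affine_iff[of 1 f "- h"] by (simp add: add.commute)

locale threshold_path = dividend_model mu sig q Lam + rate_levels cs n
  for mu sig q Lam :: real and cs :: "nat \<Rightarrow> real" and n :: nat +
  fixes z :: "nat \<Rightarrow> real"
begin

lemma pay_integrable:
  assumes "i \<le> n" "A \<in> sets borel" "A \<subseteq> {0..}"
  shows "integrable lborel (\<lambda>s. indicator A s * (exp (- q * s) * (thr z cs i p Y s + Lam)))"
proof (rule Bochner_Integration.integrable_bound)
  show "integrable lborel (\<lambda>s. (indicator {0..} s * exp (- q * s)) * (cs i + Lam))"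
    by (intro integrable_mult_left integrable.intros[OF exp_tail_integral[OF q_pos, of 0]])
  show "(\<lambda>s. indicator A s * (exp (- q * s) * (thr z cs i p Y s + Lam))) \<in> borel_measurable lborel"
    using assms(2) by measurable
  show "AE s in lborel. norm (indicator A s * (exp (- q * s) * (thr z cs i p Y s + Lam)))
      \<le> norm ((indicator {0..} s * exp (- q * s)) * (cs i + Lam))"
  proof (rule AE_I2)
    fix s
    have "0 \<le> thr z cs i p Y s" "thr z cs i p Y s \<le> cs i" using thr_bounds[OF assms(1)] by auto
    moreover have "s \<in> A \<Longrightarrow> 0 \<le> s" using assms(3) by auto
    ultimately show "norm (indicator A s * (exp (- q * s) * (thr z cs i p Y s + Lam)))
      \<le> norm ((indicator {0..} s * exp (- q * s)) * (cs i + Lam))"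
      using Lam_pos by (auto simp: indicator_def)
  qed
qed

lemma alive_set_borel: "{s. 0 \<le> s \<and> ereal s < r} \<in> sets borel"
  by measurable

lemma thr_pay_bounds:
  assumes "i \<le> n"
  shows "0 \<le> thr_pay q Lam z cs i p Y" "thr_pay q Lam z cs i p Y \<le> (cs i + Lam) / q"
proof -
  let ?A = "{s. 0 \<le> s \<and> ereal s < thr_ruin z cs i p Y}"
  have b: "0 \<le> thr z cs i p Y s" "thr z cs i p Y s \<le> cs i" for s using thr_bounds[OF assms] by auto
  show "0 \<le> thr_pay q Lam z cs i p Y"
    unfolding thr_pay_def set_lebesgue_integral_def using b Lam_pos
    by (intro integral_nonneg_AE AE_I2) (auto intro!: mult_nonneg_nonneg add_nonneg_nonneg)
  have "thr_pay q Lam z cs i p Y \<le> (\<integral>s. (indicator {0..} s * exp (- q * s)) * (cs i + Lam) \<partial>lborel)"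
    unfolding thr_pay_def set_lebesgue_integral_def real_scaleR_def
  proof (rule integral_mono')
    show "integrable lborel (\<lambda>s. (indicator {0..} s * exp (- q * s)) * (cs i + Lam))"
      by (intro integrable_mult_left integrable.intros[OF exp_tail_integral[OF q_pos, of 0]])
    show "indicator ?A s * (exp (- q * s) * (thr z cs i p Y s + Lam)) \<le> (indicator {0..} s * exp (- q * s)) * (cs i + Lam)" for s
      using b[of s] Lam_pos by (auto simp: indicator_def)
    show "0 \<le> (indicator {0..} s * exp (- q * s)) * (cs i + Lam)" for s
      using b[of s] Lam_pos by simp
  qed
  also have "\<dots> = (cs i + Lam) / q"
    by (rule discounted_constant_integral[OF q_pos])
  finally show "thr_pay q Lam z cs i p Y \<le> (cs i + Lam) / q" .
qed

context
  fixes i :: nat and p :: real and Y :: "real \<Rightarrow> real"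
  assumes i: "Suc i \<le> n" and Y: "continuous_on {0..} Y" "Y 0 = 0"
    and zp: "0 \<le> z (Suc i)" "z (Suc i) < p"
begin

private abbreviation "c \<equiv> cs (Suc i)"
private abbreviation "H \<equiv> hits Y (cs (Suc i)) p (z (Suc i))"
private abbreviation "h \<equiv> Inf (hits Y (cs (Suc i)) p (z (Suc i)))"

text \<open>The surplus stays above a nonnegative threshold forever, so there is no ruin and rate c
  is paid on [0, \<infinity>).\<close>

lemma thr_pay_no_hit:
  assumes "H = {}"
  shows "thr_pay q Lam z cs (Suc i) p Y = (c + Lam) / q"
proof -
  have thr: "thr z cs (Suc i) p Y s = c" for s using assms zp by (simp add: thr_Suc)
  have "0 \<le> thr_surplus z cs (Suc i) p Y t" if "0 \<le> t" for t
  proof -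
    have "(LINT s:{0..t}|lborel. thr z cs (Suc i) p Y s) = c * t"
      unfolding thr using that by (simp add: set_lebesgue_integral_def)
    moreover have "t \<notin> H" using assms by simp
    ultimately show ?thesis using that zp by (simp add: thr_surplus_def hits_def)
  qed
  then have "{ereal t |t. 0 \<le> t \<and> thr_surplus z cs (Suc i) p Y t < 0} = {}" by force
  then have "thr_ruin z cs (Suc i) p Y = \<infinity>"
    unfolding thr_ruin_def by (simp only: Inf_empty top_ereal_def)
  then have "thr_pay q Lam z cs (Suc i) p Y = (\<integral>s. (indicator {0..} s * exp (- q * s)) * (c + Lam) \<partial>lborel)"
    unfolding thr_pay_def set_lebesgue_integral_def thr
    by (intro Bochner_Integration.integral_cong) (auto simp: indicator_def)
  also have "\<dots> = (c + Lam) / q"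
    by (rule discounted_constant_integral[OF q_pos])
  finally show ?thesis .
qed

context
  assumes ne: "H \<noteq> {}"
begin

private lemmas hit = hits_Inf[OF Y zp(2) ne]

lemma thr_before_hit: "s < h \<Longrightarrow> thr z cs (Suc i) p Y s = c"
  using zp by (simp add: thr_Suc)

lemma thr_after_hit: "h \<le> s \<Longrightarrow> thr z cs (Suc i) p Y s = thr z cs i (z (Suc i)) (shift Y h) (s - h)"
  using zp ne by (simp add: thr_Suc)

lemma thr_surplus_before_hit:
  assumes "0 \<le> t" "t \<le> h"
  shows "thr_surplus z cs (Suc i) p Y t = p + Y t - c * t"
proof -
  have "(LINT s:{0..t}|lborel. thr z cs (Suc i) p Y s) = (LINT s:{0..t}|lborel. c)"
    unfolding set_lebesgue_integral_def
  proof (rule integral_cong_AE)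
    \<comment> \<open>At time h itself the strategy has already switched, so for t = h the rates
      agree only off one point.\<close>
    have "AE s in lborel. s \<noteq> h" by (rule AE_lborel_singleton)
    then show "AE s in lborel. indicator {0..t} s *\<^sub>R thr z cs (Suc i) p Y s = indicator {0..t} s *\<^sub>R c"
      by eventually_elim (use assms thr_before_hit in \<open>auto simp: indicator_def\<close>)
  qed auto
  then show ?thesis using assms by (simp add: thr_surplus_def set_lebesgue_integral_def)
qed

lemma thr_surplus_after_hit:
  assumes "h \<le> t"
  shows "thr_surplus z cs (Suc i) p Y t = thr_surplus z cs i (z (Suc i)) (shift Y h) (t - h)"
proof -
  let ?thr = "thr z cs (Suc i) p Y" and ?thr' = "thr z cs i (z (Suc i)) (shift Y h)"
  have int: "set_integrable lborel {a..b} ?thr" if "0 \<le> a" for a b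
    using thr_antimono[OF i] thr_bounds[OF i] that by (intro antimono_set_integrable) auto
  have "(LINT s:{0..h}|lborel. ?thr s) = c * h"
    using thr_surplus_before_hit[OF hit(1) order_refl] by (simp add: thr_surplus_def)
  moreover have "(LINT s:{h..t}|lborel. ?thr s) = (LINT s:{0..t - h}|lborel. ?thr' s)"
    unfolding set_lebesgue_integral_def
    by (subst integral_shift[of _ h]) (intro Bochner_Integration.integral_cong, auto simp: indicator_def thr_after_hit)
  moreover have "(LINT s:{0..h} \<union> {h..t}|lborel. ?thr s) = (LINT s:{0..h}|lborel. ?thr s) + (LINT s:{h..t}|lborel. ?thr s)"
    using hit(1) by (intro set_integral_Un_AE int) (auto intro!: AE_I[where N="{h}"])
  moreover have "{0..h} \<union> {h..t} = {0..t}" using assms hit(1) by auto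
  ultimately have "(LINT s:{0..t}|lborel. ?thr s) = c * h + (LINT s:{0..t - h}|lborel. ?thr' s)" by simp
  then show ?thesis using hit(2) by (simp add: thr_surplus_def shift_def)
qed

text \<open>Before the hit the surplus exceeds a nonnegative threshold, so ruin can only come from
  the restarted path.\<close>

lemma thr_ruin_after_hit:
  "thr_ruin z cs (Suc i) p Y = ereal h + thr_ruin z cs i (z (Suc i)) (shift Y h)"
proof (rule antisym)
  let ?r = "thr_ruin z cs (Suc i) p Y" and ?r' = "thr_ruin z cs i (z (Suc i)) (shift Y h)"
  have "?r - ereal h \<le> ?r'"
    unfolding thr_ruin_def[of z cs i]
  proof (rule Inf_greatest)
    fix u assume "u \<in> {ereal t |t. 0 \<le> t \<and> thr_surplus z cs i (z (Suc i)) (shift Y h) t < 0}"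
    then obtain t where t: "u = ereal t" "0 \<le> t" "thr_surplus z cs i (z (Suc i)) (shift Y h) t < 0" by blast
    then have "thr_surplus z cs (Suc i) p Y (h + t) < 0"
      using thr_surplus_after_hit[of "h + t"] by simp
    then have "?r \<le> ereal (h + t)"
      unfolding thr_ruin_def using t hit(1) by (intro Inf_lower) auto
    then show "?r - ereal h \<le> u"
      unfolding t(1) by (simp add: ereal_minus_le add.commute)
  qed
  then show "?r \<le> ereal h + ?r'" by (simp add: ereal_minus_le add.commute)
  show "ereal h + ?r' \<le> ?r"
    unfolding thr_ruin_def[of z cs "Suc i"]
  proof (rule Inf_greatest)
    fix u assume "u \<in> {ereal t |t. 0 \<le> t \<and> thr_surplus z cs (Suc i) p Y t < 0}"
    then obtain t where t: "u = ereal t" "0 \<le> t" "thr_surplus z cs (Suc i) p Y t < 0" by blast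
    have "h \<le> t"
    proof (rule ccontr)
      assume "\<not> h \<le> t"
      then show False using t thr_surplus_before_hit[of t] hit(3)[of t] zp by simp
    qed
    then have "thr_surplus z cs i (z (Suc i)) (shift Y h) (t - h) < 0"
      using t thr_surplus_after_hit by simp
    then have "?r' \<le> ereal (t - h)"
      unfolding thr_ruin_def using \<open>h \<le> t\<close> by (intro Inf_lower) auto
    then have "ereal h + ?r' \<le> ereal h + ereal (t - h)" by (rule add_left_mono)
    then show "ereal h + ?r' \<le> u" unfolding t(1) by simp
  qed
qed

text \<open>The integral is cut at the hit. After substituting s - h the second piece is the payoff
  of the restarted path, with the discount exp (- q h) in front; the identity holds path by
  path.\<close>

lemma thr_pay_after_hit:
  "thr_pay q Lam z cs (Suc i) p Y
    = (c + Lam) / q * (1 - exp (- q * h)) + exp (- q * h) * thr_pay q Lam z cs i (z (Suc i)) (shift Y h)"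
proof -
  let ?r' = "thr_ruin z cs i (z (Suc i)) (shift Y h)"
  let ?thr' = "thr z cs i (z (Suc i)) (shift Y h)"
  let ?A' = "{s. 0 \<le> s \<and> ereal s < ?r'}"
  let ?f = "\<lambda>s. indicator ?A' s * (exp (- q * s) * (?thr' s + Lam))"
  have ii: "i \<le> n" using i by simp
  have f: "integrable lborel ?f" by (rule pay_integrable[OF ii]) (use alive_set_borel in auto)
  have e: "has_bochner_integral lborel (\<lambda>s. indicator {0..<h} s * exp (- q * s)) ((exp (- q * 0) - exp (- q * h)) / q)"
    by (rule exp_segment_integral[OF q_pos hit(1)])
  have "thr_pay q Lam z cs (Suc i) p Y
     = (\<integral>s. (indicator {0..<h} s * exp (- q * s)) * (c + Lam) + exp (- q * h) * ?f (s - h) \<partial>lborel)"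
    unfolding thr_pay_def set_lebesgue_integral_def real_scaleR_def
  proof (intro Bochner_Integration.integral_cong refl)
    fix s
    have alive: "ereal s < ereal h + ?r' \<longleftrightarrow> ereal (s - h) < ?r'"
      by (cases ?r') auto
    show "indicator {s. 0 \<le> s \<and> ereal s < thr_ruin z cs (Suc i) p Y} s * (exp (- q * s) * (thr z cs (Suc i) p Y s + Lam))
      = (indicator {0..<h} s * exp (- q * s)) * (c + Lam) + exp (- q * h) * ?f (s - h)"
    proof (cases "s < h")
      case True
      then have "ereal (s - h) < 0" by simp
      then have "ereal (s - h) < ?r'" using thr_ruin_nonneg by (rule less_le_trans)
      then show ?thesis
        unfolding thr_ruin_after_hit using True thr_before_hit[OF True] alive by (simp add: indicator_def)
    next
      case False
      have "exp (- q * s) = exp (- q * h) * exp (- q * (s - h))"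
        by (simp add: exp_add[symmetric] algebra_simps)
      then show ?thesis
        unfolding thr_ruin_after_hit using False thr_after_hit[of s] alive hit(1) by (simp add: indicator_def)
    qed
  qed
  also have "\<dots> = (\<integral>s. (indicator {0..<h} s * exp (- q * s)) * (c + Lam) \<partial>lborel) + (\<integral>s. exp (- q * h) * ?f (s - h) \<partial>lborel)"
  proof (rule Bochner_Integration.integral_add)
    show "integrable lborel (\<lambda>s. (indicator {0..<h} s * exp (- q * s)) * (c + Lam))"
      by (intro integrable_mult_left integrable.intros[OF e])
    show "integrable lborel (\<lambda>s. exp (- q * h) * ?f (s - h))"
      using integrable_shift[of ?f h] f by (intro integrable_mult_right) blast
  qed
  also have "(\<integral>s. (indicator {0..<h} s * exp (- q * s)) * (c + Lam) \<partial>lborel) = (c + Lam) / q * (1 - exp (- q * h))"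
    by (rule discounted_constant_integral(2)[OF q_pos hit(1)])
  also have "(\<integral>s. exp (- q * h) * ?f (s - h) \<partial>lborel) = exp (- q * h) * (\<integral>s. ?f s \<partial>lborel)"
  proof -
    have "(\<integral>s. ?f (s - h) \<partial>lborel) = (\<integral>s. ?f ((h + s) - h) \<partial>lborel)" by (rule integral_shift)
    then show ?thesis unfolding integral_mult_right_zero by (simp only: add_diff_cancel_left')
  qed
  finally show ?thesis unfolding thr_pay_def set_lebesgue_integral_def by simp
qed

end

end

end

subsection \<open>The value of a threshold strategy\<close>

locale threshold_setting =
  dividend_setting mu sig q Lam N W F + threshold_path mu sig q Lam cs n z
  for mu sig q Lam :: real and N :: "'a measure" and W F and cs n z
begin

lemma hit_shift:
  assumes "stopping D T" "\<omega> \<in> D"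
  shows "continuous_on {0..} (shift (drift_path \<omega>) (T \<omega>))"
  using assms by (intro shift_continuous drift_path_continuous) (auto simp: stopping_def)

text \<open>The start at an arbitrary stopping time is what the induction requires: after a hit the
  strategy one level lower restarts at another one. Up to time t either the level has not been hit
  and the rate is the top one, or the induction hypothesis decides.\<close>

lemma thr_adapted:
  assumes "stopping D T" "0 \<le> t" "B \<in> sets borel"
  shows "{\<omega> \<in> D. T \<omega> \<le> t \<and> thr z cs i p (shift (drift_path \<omega>) (T \<omega>)) (t - T \<omega>) \<in> B} \<in> sets (F t)"
  using assms(1)
proof (induction i arbitrary: p D T)
  case 0
  have "{\<omega> \<in> D. T \<omega> \<le> t \<and> thr z cs 0 p (shift (drift_path \<omega>) (T \<omega>)) (t - T \<omega>) \<in> B}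
    = (if 0 \<in> B then {\<omega> \<in> D. T \<omega> \<le> t} else {})" by auto
  then show ?case using 0 assms(2) by (simp add: stopping_def)
next
  case (Suc i)
  show ?case
  proof (cases "p \<le> z (Suc i)")
    case True
    then show ?thesis using Suc by (simp add: thr_Suc)
  next
    case False
    let ?c = "cs (Suc i)" and ?z = "z (Suc i)"
    let ?D' = "hit_set ?c p ?z D T" and ?T' = "hit_time ?c p ?z T"
    have s': "stopping ?D' ?T'" using False by (intro stopping_hit Suc.prems) simp
    have "{\<omega> \<in> D. T \<omega> \<le> t \<and> thr z cs (Suc i) p (shift (drift_path \<omega>) (T \<omega>)) (t - T \<omega>) \<in> B}
      = (if ?c \<in> B then {\<omega> \<in> D. T \<omega> \<le> t} - {\<omega> \<in> ?D'. ?T' \<omega> \<le> t} else {})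
        \<union> {\<omega> \<in> ?D'. ?T' \<omega> \<le> t \<and> thr z cs i ?z (shift (drift_path \<omega>) (?T' \<omega>)) (t - ?T' \<omega>) \<in> B}"
      (is "?L = ?R")
    proof (rule set_eqI)
      fix \<omega>
      let ?H = "hits (shift (drift_path \<omega>) (T \<omega>)) ?c p ?z"
      have T': "T \<omega> \<le> ?T' \<omega>" if "\<omega> \<in> ?D'"
        using hits_Inf(1)[OF hit_shift[OF Suc.prems] shift_zero, of \<omega> ?z p ?c] that False
        by (simp add: hit_set_def hit_time_def)
      have eq: "thr z cs (Suc i) p (shift (drift_path \<omega>) (T \<omega>)) (t - T \<omega>)
         = (if \<omega> \<in> ?D' \<and> ?T' \<omega> \<le> t then thr z cs i ?z (shift (drift_path \<omega>) (?T' \<omega>)) (t - ?T' \<omega>) else ?c)"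
        if "\<omega> \<in> D"
      proof (cases "?H = {} \<or> t - T \<omega> < Inf ?H")
        case True
        then have "\<not> (\<omega> \<in> ?D' \<and> ?T' \<omega> \<le> t)" by (auto simp: hit_set_def hit_time_def)
        then show ?thesis using True False by (auto simp: thr_Suc)
      next
        case H: False
        have "\<omega> \<in> ?D'" using H that by (simp add: hit_set_def)
        moreover have "?T' \<omega> \<le> t" using H by (simp add: hit_time_def)
        moreover have "thr z cs i ?z (shift (shift (drift_path \<omega>) (T \<omega>)) (Inf ?H)) (t - T \<omega> - Inf ?H)
            = thr z cs i ?z (shift (drift_path \<omega>) (?T' \<omega>)) (t - ?T' \<omega>)"
          by (simp only: shift_shift hit_time_def diff_diff_eq)
        ultimately show ?thesis using H False by (simp add: thr_Suc)
      qed
      have D': "\<omega> \<in> ?D' \<Longrightarrow> \<omega> \<in> D" by (simp add: hit_set_def)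
      show "\<omega> \<in> ?L \<longleftrightarrow> \<omega> \<in> ?R"
      proof (cases "\<omega> \<in> D")
        case True
        show ?thesis
        proof (cases "\<omega> \<in> ?D' \<and> ?T' \<omega> \<le> t")
          case H: True
          then have "T \<omega> \<le> t" using T' by linarith
          then show ?thesis using H True unfolding mem_Collect_eq Un_iff eq[OF True] if_P[OF H] by simp
        next
          case H: False
          have v: "thr z cs (Suc i) p (shift (drift_path \<omega>) (T \<omega>)) (t - T \<omega>) = ?c"
            unfolding eq[OF True] by (rule if_not_P[OF H])
          have "\<omega> \<notin> {\<omega> \<in> ?D'. ?T' \<omega> \<le> t \<and> thr z cs i ?z (shift (drift_path \<omega>) (?T' \<omega>)) (t - ?T' \<omega>) \<in> B}"
            "\<omega> \<notin> {\<omega> \<in> ?D'. ?T' \<omega> \<le> t}" using H by blast+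
          then show ?thesis using True unfolding Un_iff mem_Collect_eq v by (simp, blast)
        qed
      next
        case False
        then have "\<omega> \<notin> ?D'" using D' by blast
        then show ?thesis using False by simp
      qed
    qed
    also have "\<dots> \<in> sets (F t)"
    proof (rule sets.Un)
      have "{\<omega> \<in> D. T \<omega> \<le> t} \<in> sets (F t)" "{\<omega> \<in> ?D'. ?T' \<omega> \<le> t} \<in> sets (F t)"
        using Suc.prems s' assms(2) unfolding stopping_def by blast+
      then show "(if ?c \<in> B then {\<omega> \<in> D. T \<omega> \<le> t} - {\<omega> \<in> ?D'. ?T' \<omega> \<le> t} else {}) \<in> sets (F t)"
        by (simp add: sets.Diff)
    qed (rule Suc.IH[OF s'])
    finally show ?thesis .
  qed
qed

text \<open>The value obtained by replacing the discount of each first passage by exp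
  (\<open>\<theta>\<^sub>1 c\<close> (p - z)), its upper bound in
  \<open>first_passage_laplace\<close>.\<close>

fun thr_value :: "nat \<Rightarrow> real \<Rightarrow> real" where
  "thr_value 0 p = Lam / q * (1 - exp (\<theta>\<^sub>1 0 * p))"
| "thr_value (Suc i) p = (if p \<le> z (Suc i) then thr_value i p
     else (cs (Suc i) + Lam) / q * (1 - exp (\<theta>\<^sub>1 (cs (Suc i)) * (p - z (Suc i))))
          + exp (\<theta>\<^sub>1 (cs (Suc i)) * (p - z (Suc i))) * thr_value i (z (Suc i)))"

text \<open>Above the threshold the value averages the perpetuity at the top rate and a smaller
  quantity. The bound fixes the sign of the factor by which the first passage estimate is later
  multiplied.\<close>

lemma thr_value_le: "i \<le> n \<Longrightarrow> thr_value i p \<le> (cs i + Lam) / q"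
proof (induction i arbitrary: p)
  case 0
  have "Lam / q * (1 - exp (\<theta>\<^sub>1 0 * p)) \<le> Lam / q * 1"
    using Lam_pos q_pos by (intro mult_left_mono) auto
  then show ?case using cs_0 by simp
next
  case (Suc i)
  let ?k = "(cs (Suc i) + Lam) / q"
  have "(cs i + Lam) / q \<le> ?k"
    using cs_step[of i] Suc.prems q_pos by (intro divide_right_mono) auto
  then have le: "thr_value i x \<le> ?k" for x using Suc.IH[of x] Suc.prems by simp
  have "k * (1 - e) + e * v \<le> k" if "v \<le> k" "0 \<le> e" for e v k :: real
    using mult_left_mono[OF that] by (simp add: right_diff_distrib mult.commute)
  from this[OF le] show ?case using le by (simp only: thr_value.simps split: if_split) auto
qed

text \<open>Ruin means strictly below 0 and is not a first hit of a closed set. By continuity,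
  however, ruin before time a is seen at some rational time below a; this makes the absolute ruin
  time \<open>V\<close> measurable, and at rate 0 the payoff is an explicit function of it.\<close>

lemma first_exit_measurable:
  assumes s: "stopping D T"
  shows "(\<lambda>\<omega>. indicator D \<omega> * exp (- q * T \<omega>) * thr_pay q Lam z cs 0 p (shift (drift_path \<omega>) (T \<omega>))) \<in> borel_measurable N"
proof -
  let ?Y = "\<lambda>\<omega>. shift (drift_path \<omega>) (T \<omega>)"
  let ?R = "\<lambda>\<omega>. thr_ruin z cs 0 p (?Y \<omega>)"
  have D: "\<omega> \<in> space N" "0 \<le> T \<omega>" if "\<omega> \<in> D" for \<omega> using s that by (auto simp: stopping_def)
  define V where "V \<omega> = (if \<omega> \<in> D then ereal (T \<omega>) + ?R \<omega> else \<infinity>)" for \<omega>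
  have sur: "thr_surplus z cs 0 p Y t = p + Y t" for Y t
    by (simp add: thr_surplus_def set_lebesgue_integral_def)
  have less_sets: "{\<omega> \<in> space N. V \<omega> < ereal a} \<in> sets N" for a
  proof -
    \<comment> \<open>Cutting the starting time at \<open>r\<close> keeps the evaluation inside the
      past of \<open>r\<close>; on {T \<le> r} it changes nothing.\<close>
    let ?S = "\<lambda>r \<omega>. if \<omega> \<in> D \<and> T \<omega> \<le> r then T \<omega> else r"
    let ?E = "\<lambda>r. {\<omega> \<in> D. T \<omega> \<le> r} \<inter> {\<omega> \<in> space (F r). p + (drift_path \<omega> r - drift_path \<omega> (?S r \<omega>)) < 0}"
    have eq: "{\<omega> \<in> space N. V \<omega> < ereal a} = (\<Union>r\<in>{r\<in>\<rat>. 0 \<le> r \<and> r < a}. ?E r)"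
    proof (intro set_eqI iffI)
      fix \<omega> assume "\<omega> \<in> {\<omega> \<in> space N. V \<omega> < ereal a}"
      then have \<omega>: "\<omega> \<in> D" "ereal (T \<omega>) + ?R \<omega> < ereal a" by (auto simp: V_def split: if_splits)
      then have "?R \<omega> < ereal (a - T \<omega>)" by (cases "?R \<omega>") auto
      then obtain t where t: "0 \<le> t" "p + ?Y \<omega> t < 0" "t < a - T \<omega>"
        unfolding thr_ruin_def sur Inf_less_iff by auto
      define u where "u = T \<omega> + t"
      have u: "T \<omega> \<le> u" "u < a" "p + (drift_path \<omega> u - drift_path \<omega> (T \<omega>)) < 0"
        using t by (auto simp: u_def shift_def)
      have "((\<lambda>v. p + (drift_path \<omega> v - drift_path \<omega> (T \<omega>))) \<longlongrightarrow> p + (drift_path \<omega> u - drift_path \<omega> (T \<omega>))) (at_right u)"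
      proof (intro tendsto_intros)
        have "(drift_path \<omega> \<longlongrightarrow> drift_path \<omega> u) (at u within {0..})"
          using drift_path_continuous[OF D(1)[OF \<omega>(1)]] u D(2)[OF \<omega>(1)] by (auto simp: continuous_on_def)
        then show "(drift_path \<omega> \<longlongrightarrow> drift_path \<omega> u) (at_right u)"
          by (rule tendsto_within_subset) (use u D(2)[OF \<omega>(1)] in auto)
      qed
      then have "\<forall>\<^sub>F v in at_right u. p + (drift_path \<omega> v - drift_path \<omega> (T \<omega>)) < 0"
        using u(3) by (rule order_tendstoD)
      then obtain b where b: "u < b" "\<And>v. u < v \<Longrightarrow> v < b \<Longrightarrow> p + (drift_path \<omega> v - drift_path \<omega> (T \<omega>)) < 0"
        unfolding eventually_at_right_field by blast
      obtain r where r: "r \<in> \<rat>" "u < r" "r < min a b"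
        using Rats_dense_in_real[of u "min a b"] u(2) b(1) by auto
      then have "\<omega> \<in> ?E r" using u b(2)[of r] \<omega>(1) D[OF \<omega>(1)] by (auto simp: space_F)
      then show "\<omega> \<in> (\<Union>r\<in>{r\<in>\<rat>. 0 \<le> r \<and> r < a}. ?E r)"
        using r u D(2)[OF \<omega>(1)] by (intro UN_I[of r]) auto
    next
      fix \<omega> assume "\<omega> \<in> (\<Union>r\<in>{r\<in>\<rat>. 0 \<le> r \<and> r < a}. ?E r)"
      then obtain r where r: "r < a" "\<omega> \<in> D" "T \<omega> \<le> r" "p + (drift_path \<omega> r - drift_path \<omega> (T \<omega>)) < 0"
        by (auto split: if_splits)
      have "?R \<omega> \<le> ereal (r - T \<omega>)"
        unfolding thr_ruin_def sur using r by (intro Inf_lower) (auto simp: shift_def)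
      then have "ereal (T \<omega>) + ?R \<omega> \<le> ereal (T \<omega>) + ereal (r - T \<omega>)" by (rule add_left_mono)
      then have "ereal (T \<omega>) + ?R \<omega> \<le> ereal r" by simp
      also have "\<dots> < ereal a" using r by simp
      finally show "\<omega> \<in> {\<omega> \<in> space N. V \<omega> < ereal a}" using r D[OF r(2)] by (simp add: V_def)
    qed
    have E: "?E r \<in> sets N" if "0 \<le> r" for r
    proof -
      have [measurable]: "(\<lambda>\<omega>. drift_path \<omega> (?S r \<omega>)) \<in> borel_measurable (F r)" "(\<lambda>\<omega>. drift_path \<omega> r) \<in> borel_measurable (F r)"
        using D that by (auto intro!: sample_measurable stopping_min_measurable[OF s])
      have "{\<omega> \<in> D. T \<omega> \<le> r} \<in> sets (F r)" using s that by (simp add: stopping_def)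
      moreover have "{\<omega> \<in> space (F r). p + (drift_path \<omega> r - drift_path \<omega> (?S r \<omega>)) < 0} \<in> sets (F r)"
        by measurable
      ultimately show ?thesis using F_sub[OF that] by blast
    qed
    have cnt: "countable {r\<in>\<rat>. 0 \<le> r \<and> r < a}"
      by (rule countable_subset[OF _ countable_rat]) auto
    show ?thesis
      unfolding eq by (rule sets.countable_UN'[OF cnt], rule image_subsetI, rule E) simp
  qed
  have V: "V \<in> borel_measurable N"
  proof (rule borel_measurableI_less)
    fix y :: ereal
    show "{\<omega> \<in> space N. V \<omega> < y} \<in> sets N"
    proof (cases y)
      case (real a)
      then show ?thesis using less_sets by simp
    next
      case PInf
      have "{\<omega> \<in> space N. V \<omega> < y} = (\<Union>m::nat. {\<omega> \<in> space N. V \<omega> < ereal (real m)})"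
        unfolding PInf using less_PInf_Ex_of_nat[of "V _"] by (auto simp: less_le_trans)
      then show ?thesis using less_sets by auto
    next
      case MInf
      then show ?thesis by simp
    qed
  qed
  have pay: "indicator D \<omega> * exp (- q * T \<omega>) * thr_pay q Lam z cs 0 p (?Y \<omega>)
    = Lam / q * (indicator D \<omega> * exp (- q * T \<omega>) - (if V \<omega> = \<infinity> then 0 else exp (- q * real_of_ereal (V \<omega>))))" for \<omega>
  proof (cases "\<omega> \<in> D")
    case True
    show ?thesis
    proof (cases "?R \<omega>")
      case (real r)
      have r: "0 \<le> r" using thr_ruin_nonneg[of z cs 0 p "?Y \<omega>"] real by simp
      have "thr_pay q Lam z cs 0 p (?Y \<omega>) = (\<integral>s. (indicator {0..<r} s * exp (- q * s)) * Lam \<partial>lborel)"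
        unfolding thr_pay_def set_lebesgue_integral_def real
        by (intro Bochner_Integration.integral_cong) (auto simp: indicator_def)
      also have "\<dots> = Lam / q * (1 - exp (- q * r))"
        by (rule discounted_constant_integral(2)[OF q_pos r])
      finally have p: "thr_pay q Lam z cs 0 p (?Y \<omega>) = Lam / q * (1 - exp (- q * r))" .
      have v: "V \<omega> = ereal (T \<omega> + r)" using True real by (simp add: V_def)
      have "exp (- q * (T \<omega> + r)) = exp (- q * T \<omega>) * exp (- q * r)"
        by (simp add: exp_add[symmetric] algebra_simps)
      then show ?thesis unfolding p v using True by (simp add: algebra_simps)
    next
      case PInf
      have "thr_pay q Lam z cs 0 p (?Y \<omega>) = (\<integral>s. (indicator {0..} s * exp (- q * s)) * Lam \<partial>lborel)"
        unfolding thr_pay_def set_lebesgue_integral_def PInf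
        by (intro Bochner_Integration.integral_cong) (auto simp: indicator_def)
      also have "\<dots> = Lam / q"
        by (rule discounted_constant_integral[OF q_pos])
      finally have p: "thr_pay q Lam z cs 0 p (?Y \<omega>) = Lam / q" .
      have v: "V \<omega> = \<infinity>" using True PInf by (simp add: V_def)
      show ?thesis unfolding p v using True by simp
    next
      case MInf
      then show ?thesis using thr_ruin_nonneg[of z cs 0 p "?Y \<omega>"] by simp
    qed
  qed (simp add: V_def)
  have [measurable]: "(\<lambda>\<omega>. indicator D \<omega> * exp (- q * T \<omega>)) \<in> borel_measurable N" by (rule stopping_exp_measurable[OF s])
  show ?thesis unfolding pay using V by measurable
qed

text \<open>The first time at or below 0 is no later than the first time strictly below 0, so
  stopping the payments there can only lose.\<close>

lemma thr_pay_0_ge: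
  assumes "0 < p" "continuous_on {0..} Y" "Y 0 = 0"
  shows "Lam / q * (1 - (if hits Y 0 p 0 = {} then 0 else exp (- q * Inf (hits Y 0 p 0)))) \<le> thr_pay q Lam z cs 0 p Y"
proof -
  have sur: "thr_surplus z cs 0 p Y t = p + Y t" for t
    by (simp add: thr_surplus_def set_lebesgue_integral_def)
  have int: "integrable lborel (\<lambda>s. indicator {s. 0 \<le> s \<and> ereal s < thr_ruin z cs 0 p Y} s * (exp (- q * s) * (thr z cs 0 p Y s + Lam)))"
    by (rule pay_integrable) (use alive_set_borel in auto)
  show ?thesis
  proof (cases "hits Y 0 p 0 = {}")
    case True
    then have "\<not> p + Y t < 0" if "0 \<le> t" for t using that by (force simp: hits_def)
    then have "{ereal t |t. 0 \<le> t \<and> thr_surplus z cs 0 p Y t < 0} = {}" unfolding sur by blast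
    then have "thr_ruin z cs 0 p Y = \<infinity>" unfolding thr_ruin_def by (simp only: Inf_empty top_ereal_def)
    then have "thr_pay q Lam z cs 0 p Y = (\<integral>s. (indicator {0..} s * exp (- q * s)) * Lam \<partial>lborel)"
      unfolding thr_pay_def set_lebesgue_integral_def
      by (intro Bochner_Integration.integral_cong) (auto simp: indicator_def)
    also have "\<dots> = Lam / q"
      by (rule discounted_constant_integral[OF q_pos])
    finally show ?thesis using True by simp
  next
    case False
    note H = hits_Inf[OF assms(2,3,1) False]
    let ?h = "Inf (hits Y 0 p 0)"
    have "ereal ?h \<le> thr_ruin z cs 0 p Y"
      unfolding thr_ruin_def sur using H(5) by (intro Inf_greatest) (auto simp: hits_def)
    then have alive: "ereal s < thr_ruin z cs 0 p Y" if "s < ?h" for s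
      using that by (meson ereal_less(2) less_ereal.simps(1) less_le_trans)
    have "(\<integral>s. (indicator {0..<?h} s * exp (- q * s)) * Lam \<partial>lborel) \<le> thr_pay q Lam z cs 0 p Y"
      unfolding thr_pay_def set_lebesgue_integral_def real_scaleR_def
    proof (rule integral_mono[OF _ int])
      show "integrable lborel (\<lambda>s. (indicator {0..<?h} s * exp (- q * s)) * Lam)"
        by (intro integrable_mult_left integrable.intros[OF exp_segment_integral[OF q_pos H(1)]])
      show "(indicator {0..<?h} s * exp (- q * s)) * Lam
         \<le> indicator {s. 0 \<le> s \<and> ereal s < thr_ruin z cs 0 p Y} s * (exp (- q * s) * (thr z cs 0 p Y s + Lam))" for s
        using alive[of s] Lam_pos by (auto simp: indicator_def)
    qed
    also have "(\<integral>s. (indicator {0..<?h} s * exp (- q * s)) * Lam \<partial>lborel) = Lam / q * (1 - exp (- q * ?h))"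
      by (rule discounted_constant_integral(2)[OF q_pos H(1)])
    finally show ?thesis using False by simp
  qed
qed

abbreviation "disc D T \<equiv> \<lambda>\<omega>. indicator D \<omega> * exp (- q * T \<omega>)"
abbreviation "disc_pay i p D T \<equiv> \<lambda>\<omega>. indicator D \<omega> * exp (- q * T \<omega>) * thr_pay q Lam z cs i p (shift (drift_path \<omega>) (T \<omega>))"

lemma disc_pay_bounds:
  assumes "i \<le> n" "stopping D T"
  shows "0 \<le> disc_pay i p D T \<omega>" "disc_pay i p D T \<omega> \<le> (cs i + Lam) / q"
proof -
  show "0 \<le> disc_pay i p D T \<omega>" using thr_pay_bounds[OF assms(1)] by simp
  have "disc D T \<omega> \<le> 1" using assms(2) q_pos by (auto simp: indicator_def stopping_def)
  then show "disc_pay i p D T \<omega> \<le> (cs i + Lam) / q"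
    using mult_mono[of "disc D T \<omega>" 1 "thr_pay q Lam z cs i p (shift (drift_path \<omega>) (T \<omega>))" "(cs i + Lam) / q"] thr_pay_bounds[OF assms(1)]
    by simp
qed

lemma disc_pay_integrable:
  assumes "i \<le> n" "stopping D T" "disc_pay i p D T \<in> borel_measurable N"
  shows "integrable N (disc_pay i p D T)"
  using assms(3)
proof (rule integrable_const_bound[of _ "(cs i + Lam) / q", rotated])
  show "AE \<omega> in N. norm (disc_pay i p D T \<omega>) \<le> (cs i + Lam) / q"
  proof (rule AE_I2)
    fix \<omega>
    show "norm (disc_pay i p D T \<omega>) \<le> (cs i + Lam) / q"
      using disc_pay_bounds[OF assms(1,2), where p = p and \<omega> = \<omega>] unfolding real_norm_def by (subst abs_of_nonneg)
  qed
qed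

text \<open>Only an inequality is needed: the opposite one holds for every admissible control.\<close>

lemma thr_pay_lower:
  assumes z: "\<And>j. 1 \<le> j \<Longrightarrow> j \<le> n \<Longrightarrow> 0 \<le> z j"
  shows "i \<le> n \<Longrightarrow> stopping D T \<Longrightarrow> 0 \<le> p \<Longrightarrow>
    disc_pay i p D T \<in> borel_measurable N \<and>
    expectation (disc D T) * thr_value i p \<le> expectation (disc_pay i p D T)"
proof (induction i arbitrary: p D T)
  case 0
  have m: "disc_pay 0 p D T \<in> borel_measurable N" by (rule first_exit_measurable[OF 0(2)])
  have "expectation (disc D T) * thr_value 0 p \<le> expectation (disc_pay 0 p D T)"
  \<comment> \<open>First passage to 0 requires a start strictly above 0; at p = 0 the claimed value
    is 0 and payoffs are nonnegative.\<close>
  proof (cases "p = 0")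
    case True
    have "0 \<le> expectation (disc_pay 0 p D T)"
      using disc_pay_bounds(1)[OF 0(1,2)] by (intro integral_nonneg_AE AE_I2)
    then show ?thesis using True by simp
  next
    case False
    then have p: "0 < p" using 0 by simp
    let ?D' = "hit_set 0 p 0 D T" and ?T' = "hit_time 0 p 0 T"
    have s': "stopping ?D' ?T'" by (rule stopping_hit[OF 0(2) p])
    have i: "integrable N (disc D T)" "integrable N (disc ?D' ?T')"
      by (rule stopping_exp_integrable[OF 0(2)], rule stopping_exp_integrable[OF s'])
    have "expectation (disc D T) * thr_value 0 p
      = Lam / q * (expectation (disc D T) - exp (\<theta>\<^sub>1 0 * (p - 0)) * expectation (disc D T))"
      by (simp add: algebra_simps)
    also have "\<dots> \<le> Lam / q * (expectation (disc D T) - expectation (disc ?D' ?T'))"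
      using first_passage_laplace[OF 0(2) p, of 0] Lam_pos q_pos by (intro mult_left_mono) auto
    also have "\<dots> = expectation (\<lambda>\<omega>. Lam / q * (disc D T \<omega> - disc ?D' ?T' \<omega>))"
      unfolding integral_mult_right_zero Bochner_Integration.integral_diff[OF i] ..
    also have "\<dots> \<le> expectation (disc_pay 0 p D T)"
    proof (rule integral_mono)
      show "integrable N (\<lambda>\<omega>. Lam / q * (disc D T \<omega> - disc ?D' ?T' \<omega>))"
        by (intro integrable_mult_right Bochner_Integration.integrable_diff i)
      show "integrable N (disc_pay 0 p D T)" by (rule disc_pay_integrable[OF 0(1,2) m])
      fix \<omega>
      show "Lam / q * (disc D T \<omega> - disc ?D' ?T' \<omega>) \<le> disc_pay 0 p D T \<omega>"
      proof (cases "\<omega> \<in> D")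
        case True
        let ?H = "hits (shift (drift_path \<omega>) (T \<omega>)) 0 p 0"
        have "exp (- q * ?T' \<omega>) = exp (- q * T \<omega>) * exp (- q * Inf ?H)"
          by (simp add: hit_time_def exp_add[symmetric] algebra_simps)
        then have "Lam / q * (disc D T \<omega> - disc ?D' ?T' \<omega>)
          = exp (- q * T \<omega>) * (Lam / q * (1 - (if ?H = {} then 0 else exp (- q * Inf ?H))))"
          using True by (simp add: hit_set_def algebra_simps)
        also have "\<dots> \<le> exp (- q * T \<omega>) * thr_pay q Lam z cs 0 p (shift (drift_path \<omega>) (T \<omega>))"
          by (intro mult_left_mono thr_pay_0_ge[OF p hit_shift[OF 0(2) True] shift_zero]) auto
        finally show ?thesis using True by simp
      qed (simp add: hit_set_def)
    qed
    finally show ?thesis .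
  qed
  then show ?case using m by blast
next
  case (Suc i)
  show ?case
  proof (cases "p \<le> z (Suc i)")
    case True
    then have "thr z cs (Suc i) p Y = thr z cs i p Y" for Y by (simp add: thr_Suc fun_eq_iff)
    then have "thr_pay q Lam z cs (Suc i) p Y = thr_pay q Lam z cs i p Y" for Y
      by (simp add: thr_pay_def thr_ruin_def thr_surplus_def)
    moreover have "i \<le> n" using Suc.prems by simp
    ultimately show ?thesis using Suc.IH[OF _ Suc.prems(2,3)] True by simp
  next
    case False
    let ?c = "cs (Suc i)" and ?z = "z (Suc i)"
    let ?k = "(?c + Lam) / q"
    let ?D' = "hit_set ?c p ?z D T" and ?T' = "hit_time ?c p ?z T"
    have zp: "?z < p" and z0: "0 \<le> ?z" and i: "i \<le> n" using False z[of "Suc i"] Suc.prems by auto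
    have s': "stopping ?D' ?T'" by (rule stopping_hit[OF Suc.prems(2) zp])
    \<comment> \<open>The top rate is paid between the two stopping times, and the lower level takes
      over at the second. Off \<open>?D'\<close> the second stopping time is infinite and its terms
      vanish.\<close>
    have eq: "disc_pay (Suc i) p D T \<omega> = ?k * (disc D T \<omega> - disc ?D' ?T' \<omega>) + disc_pay i ?z ?D' ?T' \<omega>" for \<omega>
    proof (cases "\<omega> \<in> D")
      case True
      let ?Y = "shift (drift_path \<omega>) (T \<omega>)"
      let ?H = "hits ?Y ?c p ?z"
      note Y = hit_shift[OF Suc.prems(2) True] shift_zero
      show ?thesis
      proof (cases "?H = {}")
        case H: True
        then show ?thesis
          using thr_pay_no_hit[OF Suc.prems(1) Y z0 zp H] True by (simp add: hit_set_def)
      next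
        case H: False
        have e: "exp (- q * ?T' \<omega>) = exp (- q * T \<omega>) * exp (- q * Inf ?H)"
          by (simp add: hit_time_def exp_add[symmetric] algebra_simps)
        have sh: "shift ?Y (Inf ?H) = shift (drift_path \<omega>) (?T' \<omega>)"
          by (simp add: shift_shift hit_time_def)
        have D': "\<omega> \<in> ?D'" using H True by (simp add: hit_set_def)
        have alg: "x * (k * (1 - y) + y * u) = k * (x - x * y) + x * y * u" for x k y u :: real
          by (simp add: algebra_simps)
        show ?thesis
          using thr_pay_after_hit[OF Suc.prems(1) Y z0 zp H] True D'
          unfolding sh by (simp only: indicator_simps if_True mult_1 e alg)
      qed
    qed (simp add: hit_set_def)
    note IH = Suc.IH[OF i s' z0]
    have ints: "integrable N (disc D T)" "integrable N (disc ?D' ?T')" "integrable N (disc_pay i ?z ?D' ?T')"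
      by (rule stopping_exp_integrable[OF Suc.prems(2)], rule stopping_exp_integrable[OF s'],
          rule disc_pay_integrable[OF i s' conjunct1[OF IH]])
    let ?ex = "exp (\<theta>\<^sub>1 ?c * (p - ?z))"
    have "expectation (disc D T) * thr_value (Suc i) p
      = ?k * expectation (disc D T) - (?ex * expectation (disc D T)) * (?k - thr_value i ?z)"
      using False by (simp add: algebra_simps del: times_divide_eq_left times_divide_eq_right)
    also have "\<dots> \<le> ?k * expectation (disc D T) - expectation (disc ?D' ?T') * (?k - thr_value i ?z)"
    proof -
      \<comment> \<open>Reaching the threshold is a loss relative to the perpetuity
        \<open>?k\<close>, so an upper bound on the discounted passage gives a lower bound on the
        value.\<close>
      have "(cs i + Lam) / q \<le> ?k" using cs_step[of i] Suc.prems(1) q_pos by (intro divide_right_mono) auto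
      then have "0 \<le> ?k - thr_value i ?z" using thr_value_le[OF i, of ?z] by simp
      then have "expectation (disc ?D' ?T') * (?k - thr_value i ?z) \<le> (?ex * expectation (disc D T)) * (?k - thr_value i ?z)"
        by (rule mult_right_mono[OF first_passage_laplace[OF Suc.prems(2) zp]])
      then show ?thesis by simp
    qed
    also have "\<dots> = ?k * (expectation (disc D T) - expectation (disc ?D' ?T')) + expectation (disc ?D' ?T') * thr_value i ?z"
      by (simp add: algebra_simps del: times_divide_eq_left times_divide_eq_right)
    also have "\<dots> \<le> ?k * (expectation (disc D T) - expectation (disc ?D' ?T')) + expectation (disc_pay i ?z ?D' ?T')"
      using IH by simp
    also have "\<dots> = expectation (\<lambda>\<omega>. ?k * (disc D T \<omega> - disc ?D' ?T' \<omega>) + disc_pay i ?z ?D' ?T' \<omega>)"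
      by (simp only: Bochner_Integration.integral_add[OF integrable_mult_right[OF Bochner_Integration.integrable_diff[OF ints(1,2)]] ints(3)]
          integral_mult_right_zero Bochner_Integration.integral_diff[OF ints(1,2)])
    also have "\<dots> = expectation (disc_pay (Suc i) p D T)" unfolding eq ..
    finally have "expectation (disc D T) * thr_value (Suc i) p \<le> expectation (disc_pay (Suc i) p D T)" .
    moreover have "disc_pay (Suc i) p D T \<in> borel_measurable N"
      unfolding eq
      by (rule borel_measurable_integrable[OF Bochner_Integration.integrable_add[OF
            integrable_mult_right[OF Bochner_Integration.integrable_diff[OF ints(1,2)]] ints(3)]])
    ultimately show ?thesis by blast
  qed
qed

end

subsection \<open>Optimality of the threshold strategy\<close>

lemma (in dividend_setting) stopping_zero: "stopping (space N) (\<lambda>_. 0)"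
  using sets.top[of "F t" for t] by (simp add: stopping_def space_F)

context dividend_model
begin

text \<open>No probability space appears: threshold and candidate at each level depend only on the
  previous candidate, which makes an induction on the level possible.\<close>

primrec opt_value :: "(nat \<Rightarrow> real) \<Rightarrow> nat \<Rightarrow> real \<Rightarrow> real" where
  "opt_value cs 0 = (\<lambda>x. Lam / q * (1 - exp (\<theta>\<^sub>1 0 * x)))"
| "opt_value cs (Suc i) = extend (cs (Suc i)) (opt_value cs i) (least_argmin (gfun (cs (Suc i)) (opt_value cs i)))"

definition opt_threshold :: "(nat \<Rightarrow> real) \<Rightarrow> nat \<Rightarrow> real" where
  "opt_threshold cs i = least_argmin (gfun (cs i) (opt_value cs (i - 1)))"

end

locale ratcheting = dividend_model mu sig q Lam + rate_levels cs n
  for mu sig q Lam :: real and cs :: "nat \<Rightarrow> real" and n :: nat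
begin

abbreviation "v \<equiv> opt_value cs"
abbreviation "zo \<equiv> opt_threshold cs"

lemma opt_value_profile: "i \<le> n \<Longrightarrow> \<exists>f'. profile (cs i) (v i) f'"
proof (induction i)
  case 0
  show ?case using profile_exp[of 0] cs_0 by auto
next
  case (Suc i)
  then obtain f' where "profile (cs i) (v i) f'" by auto
  then show ?case
    using extend_profile[of "cs i" "v i" f' "cs (Suc i)"] cs_nonneg[of i] cs_step[of i] Suc.prems by simp
qed

lemma opt_threshold_nonneg: "1 \<le> i \<Longrightarrow> i \<le> n \<Longrightarrow> 0 \<le> zo i"
proof (cases i)
  case (Suc j)
  assume "i \<le> n"
  then obtain f' where "profile (cs j) (v j) f'" using opt_value_profile[of j] Suc by auto
  then show ?thesis
    using least_argmin_props(1)[of "cs j" "v j" f' "cs (Suc j)"] cs_nonneg[of j] cs_step[of j] \<open>i \<le> n\<close> Suc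
    by (simp add: opt_threshold_def)
qed simp

lemma opt_value_mono: "j \<le> i \<Longrightarrow> i \<le> n \<Longrightarrow> 0 \<le> y \<Longrightarrow> v j y \<le> v i y"
proof (induction i)
  case (Suc i)
  show ?case
  proof (cases "j = Suc i")
    case False
    then have "v j y \<le> v i y" using Suc by simp
    also obtain f' where "profile (cs i) (v i) f'" using opt_value_profile[of i] Suc by auto
    then have "v i y \<le> v (Suc i) y"
      using extend_ge[of "cs i" "v i" f' "cs (Suc i)" y] cs_nonneg[of i] cs_step[of i] Suc.prems by simp
    finally show ?thesis .
  qed simp
qed simp

lemma opt_value_0: "i \<le> n \<Longrightarrow> v i 0 = 0"
  using opt_value_profile unfolding profile_def by blast

text \<open>Recentres the exponential at the threshold, which exhibits the pasted function in the
  recursive form of \<open>thr_value\<close>.\<close>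

lemma extend_above:
  assumes "z < p" "0 < c + Lam"
  shows "extend c f z p = (c + Lam) / q * (1 - exp (\<theta>\<^sub>1 c * (p - z))) + exp (\<theta>\<^sub>1 c * (p - z)) * f z"
proof -
  define e where "e = exp (\<theta>\<^sub>1 c * (p - z))"
  have "exp (- \<theta>\<^sub>1 c * z) * exp (\<theta>\<^sub>1 c * p) = e"
    unfolding e_def by (simp add: exp_add[symmetric] algebra_simps)
  then have "gfun c f z * exp (\<theta>\<^sub>1 c * p) = (1 - q / (c + Lam) * f z) * e"
    by (simp add: gfun_def mult.assoc)
  then show ?thesis
    using assms q_pos unfolding extend_def e_def[symmetric] by (simp add: field_simps)
qed

end

section \<open>Identification of candidates, values and thresholds\<close>

locale ratcheting_bm = ratcheting mu sig q Lam cs n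
  for mu sig q Lam :: real and cs :: "nat \<Rightarrow> real" and n :: nat +
  fixes M :: "'a measure" and W :: "real \<Rightarrow> 'a \<Rightarrow> real"
  assumes BM: "std_BM M W"
begin

lemma threshold_setting:
  "threshold_setting sig q Lam (completion M) W (filt_measure M W mu sig x) cs n"
proof -
  interpret bm_filtration "completion M" W "filt_measure M W mu sig x"
    by (rule std_BM_bm_filtration[OF BM sig_pos])
  show ?thesis by unfold_locales
qed

lemma Jval_payoff: "Jval M W mu sig q Lam x C = integral\<^sup>L (completion M) (payoff W mu sig q Lam x C)"
  by (simp add: Jval_def payoff_def[abs_def])

text \<open>An admissible control started at rate cs i uses only the rates of index at most i, and
  on these the candidates satisfy the assumptions of \<open>controlled\<close>.\<close>

lemma admissible_upper:
  assumes adm: "admissible M W mu sig (cs ` {0..n}) x (cs i) C" and x: "0 \<le> x" and i: "i \<le> n"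
  shows "Jval M W mu sig q Lam x C \<le> v i x"
proof -
  interpret threshold_setting mu sig q Lam "completion M" W "filt_measure M W mu sig x" cs n zo
    by (rule threshold_setting)
  obtain v' where v': "\<And>j. j \<le> n \<Longrightarrow> profile (cs j) (v j) (v' j)"
    using opt_value_profile by metis
  \<comment> \<open>\<open>controlled\<close> indexes candidates by rates, so the index is recovered
    from the rate; this works because the rates are strictly increasing.\<close>
  define idx where "idx = inv_into {0..n} cs"
  have inj: "inj_on cs {0..n}"
    using cs_less by (intro linorder_inj_onI') (metis atLeastAtMost_iff less_irrefl)
  have idx: "idx (cs j) = j" if "j \<le> n" for j
    unfolding idx_def using inj that by (intro inv_into_f_f) auto
  have le_iff: "cs j \<le> cs k \<longleftrightarrow> j \<le> k" if "j \<le> n" "k \<le> n" for j k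
    using cs_le[of j k] cs_less[of k j] that by (meson not_le)
  interpret controlled mu sig q Lam "completion M" W "filt_measure M W mu sig x"
    "cs ` {0..i}" "\<lambda>c. v (idx c)" "\<lambda>c. v' (idx c)" C "cs i"
  proof
    show "finite (cs ` {0..i})" "cs i \<in> cs ` {0..i}" by auto
    show "0 \<le> c" "c \<le> cs i" if "c \<in> cs ` {0..i}" for c
      using that i cs_nonneg cs_le by auto
    show "profile c (v (idx c)) (v' (idx c))" if "c \<in> cs ` {0..i}" for c
      using that i v' by (auto simp: idx)
    show "v (idx c) y \<le> v (idx c') y" if "c \<in> cs ` {0..i}" "c' \<in> cs ` {0..i}" "c \<le> c'" "0 \<le> y" for c c' y
      using that i le_iff by (auto simp: idx intro!: opt_value_mono)
    show "C t \<omega> \<in> cs ` {0..i}" if t: "0 \<le> t" and \<omega>: "\<omega> \<in> space (completion M)" for t \<omega>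
    proof -
      have "C t \<omega> \<in> cs ` {0..n}" "C t \<omega> \<le> cs i" using adm t \<omega> unfolding admissible_def by auto
      then show ?thesis using le_iff i by auto
    qed
    show "C t \<omega> \<le> C s \<omega>" if "0 \<le> s" "s \<le> t" "\<omega> \<in> space (completion M)" for s t \<omega>
      using adm that unfolding admissible_def by auto
    show "C t \<in> borel_measurable (filt_measure M W mu sig x t)" if "0 \<le> t" for t
      using adm that unfolding admissible_def by (intro measurableI) (auto simp: sets_filt_measure)
  qed
  show ?thesis
    unfolding Jval_payoff using payoff_bound[OF x] idx[OF i] by simp
qed

text \<open>Adaptedness is \<open>thr_adapted\<close> for the deterministic stopping time 0; the
  remaining requirements hold path by path.\<close>

lemma threshold_admissible:
  assumes i: "i \<le> n"
  shows "admissible M W mu sig (cs ` {0..n}) x (cs i) (thrC W mu sig z cs i x)"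
proof -
  interpret threshold_setting mu sig q Lam "completion M" W "filt_measure M W mu sig x" cs n z
    by (rule threshold_setting)
  note st = stopping_zero
  have path: "thrC W mu sig z cs i x t \<omega> = thr z cs i x (drift_path \<omega>) t" for t \<omega>
    by (simp add: thrC_def drift_path_def[abs_def])
  have shift: "shift (drift_path \<omega>) 0 = drift_path \<omega>" if "\<omega> \<in> space M" for \<omega>
    using that drift_path_0[of \<omega>] by (simp add: shift_def fun_eq_iff)
  have meas: "thrC W mu sig z cs i x t -` B \<inter> space M \<in> filt M W mu sig x t"
    if t: "0 \<le> t" and B: "B \<in> sets borel" for t B
  proof -
    have "thrC W mu sig z cs i x t -` B \<inter> space M
      = {\<omega> \<in> space (completion M). 0 \<le> t \<and> thr z cs i x (shift (drift_path \<omega>) 0) (t - 0) \<in> B}"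
      using t shift by (auto simp: path)
    also have "\<dots> \<in> sets (filt_measure M W mu sig x t)" by (rule thr_adapted[OF st t B])
    finally show ?thesis unfolding sets_filt_measure .
  qed
  show ?thesis
    unfolding admissible_def
  proof (intro conjI ballI allI impI meas; (unfold path)?)
    fix \<omega> t
    show "thr z cs i x (drift_path \<omega>) t \<in> cs ` {0..n}"
      using thr_range[of z i x "drift_path \<omega>" t] by (rule rev_subsetD) (use i in auto)
    show "thr z cs i x (drift_path \<omega>) t \<le> cs i" using thr_bounds[OF i] by simp
    show "continuous (at_right t) (\<lambda>s. thr z cs i x (drift_path \<omega>) s)" by (rule thr_right_continuous)
    fix s assume "s \<le> t"
    then show "thr z cs i x (drift_path \<omega>) t \<le> thr z cs i x (drift_path \<omega>) s" by (rule thr_antimono[OF i])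
  qed
qed

lemma threshold_lower:
  assumes x: "0 \<le> x" and i: "i \<le> n"
  shows "v i x \<le> Jval M W mu sig q Lam x (thrC W mu sig zo cs i x)"
proof -
  interpret threshold_setting mu sig q Lam "completion M" W "filt_measure M W mu sig x" cs n zo
    by (rule threshold_setting)
  note st = stopping_zero
  have thr_v: "thr_value j p = v j p" if "j \<le> n" "0 \<le> p" for j p
    using that
  proof (induction j arbitrary: p)
    case (Suc j)
    have z: "zo (Suc j) = least_argmin (gfun (cs (Suc j)) (v j))" by (simp add: opt_threshold_def)
    have z0: "0 \<le> zo (Suc j)" using opt_threshold_nonneg Suc.prems by simp
    show ?case
    proof (cases "p \<le> zo (Suc j)")
      case True
      \<comment> \<open>For threshold 0 this means p = 0: there \<open>extend\<close> uses its
        exponential branch while \<open>thr_value\<close> keeps the lower level, and both are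
        0.\<close>
      then show ?thesis
        using Suc z0 opt_value_0[of j] opt_value_0[of "Suc j"]
        by (cases "zo (Suc j) = 0") (auto simp: extend_def z)
    next
      case False
      then show ?thesis
        using Suc.IH[of "zo (Suc j)"] z0 Suc.prems cs_nonneg[of "Suc j"] Lam_pos
          extend_above[of "zo (Suc j)" p "cs (Suc j)" "v j"]
        by (simp add: z)
    qed
  qed simp
  have pay: "payoff W mu sig q Lam x (thrC W mu sig zo cs i x) \<omega>
      = disc_pay i x (space (completion M)) (\<lambda>_. 0) \<omega>" if "\<omega> \<in> space (completion M)" for \<omega>
  proof -
    have Y: "shift (drift_path \<omega>) 0 = drift_path \<omega>"
      using that drift_path_0[of \<omega>] by (simp add: shift_def fun_eq_iff)
    have C: "thrC W mu sig zo cs i x t \<omega> = thr zo cs i x (drift_path \<omega>) t" for t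
      by (simp add: thrC_def drift_path_def[abs_def])
    have "ruin W mu sig x (thrC W mu sig zo cs i x) \<omega> = thr_ruin zo cs i x (drift_path \<omega>)"
      unfolding ruin_def thr_ruin_def Xctrl_def Xproc_def thr_surplus_def C
      by (simp add: drift_path_def add.assoc)
    then show ?thesis
      unfolding payoff_def thr_pay_def C Y using that by simp
  qed
  have "expectation (disc (space (completion M)) (\<lambda>_. 0)) = 1"
  proof -
    have "expectation (disc (space (completion M)) (\<lambda>_. 0)) = expectation (\<lambda>_. 1)"
      by (intro Bochner_Integration.integral_cong) auto
    then show ?thesis using prob_space by simp
  qed
  then have "v i x \<le> expectation (disc_pay i x (space (completion M)) (\<lambda>_. 0))"
    using thr_pay_lower[OF opt_threshold_nonneg i st x] thr_v[OF i x] by simp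
  also have "\<dots> = Jval M W mu sig q Lam x (thrC W mu sig zo cs i x)"
    unfolding Jval_payoff by (intro Bochner_Integration.integral_cong refl pay[symmetric])
  finally show ?thesis .
qed

text \<open>The threshold strategy is itself admissible, so the general upper bound meets the lower
  bound. Agreement of the thresholds is asked only up to level i, to fit the partially filled tables
  of \<open>zstep\<close>.\<close>

lemma Wz_opt: 
  assumes "0 \<le> x" "i \<le> n" and z: "\<And>j. 1 \<le> j \<Longrightarrow> j \<le> i \<Longrightarrow> z j = zo j"
  shows "Wz M W mu sig q Lam cs z x i = v i x"
proof -
  have "thrC W mu sig z cs i x = thrC W mu sig zo cs i x"
    using thr_cong[OF z] by (simp add: thrC_def fun_eq_iff)
  then show ?thesis
    unfolding Wz_def using threshold_lower[OF assms(1,2)] admissible_upper[OF threshold_admissible assms(1,2)] assms(2)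
    by (simp add: order_antisym)
qed

text \<open>With the first i thresholds identified, the value at that level is the candidate, so
  \<open>Gfun\<close> and \<open>gfun\<close> agree on [0, \<infinity>). Their sets of minimisers
  coincide, and with them the next threshold.\<close>

lemma zstep_opt: "i \<le> n \<Longrightarrow> 1 \<le> j \<Longrightarrow> j \<le> i \<Longrightarrow> zstep M W mu sig q Lam cs i j = zo j"
proof (induction i arbitrary: j)
  case (Suc i)
  let ?z = "zstep M W mu sig q Lam cs i"
  have "Gfun M W mu sig q Lam cs ?z (Suc i) y = gfun (cs (Suc i)) (v i) y" if "0 \<le> y" for y
    using Wz_opt[OF that, of i ?z] Suc by (simp add: Gfun_def gfun_def)
  then have "{y. 0 \<le> y \<and> (\<forall>y'\<ge>0. Gfun M W mu sig q Lam cs ?z (Suc i) y \<le> Gfun M W mu sig q Lam cs ?z (Suc i) y')}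
    = {y. 0 \<le> y \<and> (\<forall>y'\<ge>0. gfun (cs (Suc i)) (v i) y \<le> gfun (cs (Suc i)) (v i) y')}"
    by auto
  then have "(LEAST y. y \<in> {y. 0 \<le> y \<and> (\<forall>y'\<ge>0. Gfun M W mu sig q Lam cs ?z (Suc i) y \<le> Gfun M W mu sig q Lam cs ?z (Suc i) y')})
    = zo (Suc i)"
    unfolding opt_threshold_def least_argmin_def by simp
  then show ?case using Suc by (simp add: Let_def)
qed simp

lemma optimality:
  assumes i: "i \<le> n" and x: "0 \<le> x"
  shows "Wz M W mu sig q Lam cs (zstar M W mu sig q Lam cs) x i
    = VS M W mu sig q Lam (cs ` {0..n}) x (cs i)"
proof -
  have z: "zstar M W mu sig q Lam cs j = zo j" if "1 \<le> j" "j \<le> i" for j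
    unfolding zstar_def using that i by (intro zstep_opt) auto
  have w: "Wz M W mu sig q Lam cs (zstar M W mu sig q Lam cs) x i = v i x"
    by (rule Wz_opt[OF x i z])
  have "VS M W mu sig q Lam (cs ` {0..n}) x (cs i) = v i x"
    unfolding VS_def
  proof (rule cSup_eq_maximum)
    show "v i x \<in> {Jval M W mu sig q Lam x C |C. admissible M W mu sig (cs ` {0..n}) x (cs i) C}"
      using threshold_admissible[OF i] unfolding w[symmetric] Wz_def by blast
    show "y \<le> v i x" if "y \<in> {Jval M W mu sig q Lam x C |C. admissible M W mu sig (cs ` {0..n}) x (cs i) C}" for y
      using that admissible_upper[OF _ x i] by blast
  qed
  then show ?thesis using w by simp
qed

end

theorem theorem6p2:
  fixes M :: "'a measure" and W :: "real \<Rightarrow> 'a \<Rightarrow> real"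
    and mu sig q Lam :: real and cs :: "nat \<Rightarrow> real" and n :: nat
  assumes "std_BM M W"
    and "sig > 0" and "q > 0" and "Lam > 0"
    and "cs 0 = 0" and "\<forall>j<n. cs j < cs (Suc j)"
  shows "\<forall>i\<in>{1..n}. \<forall>x\<ge>0.
           Wz M W mu sig q Lam cs (zstar M W mu sig q Lam cs) x i
             = VS M W mu sig q Lam (cs ` {0..n}) x (cs i)"
proof -
  interpret ratcheting_bm mu sig q Lam cs n M W
    by unfold_locales (use assms in auto)
  show ?thesis by (auto intro: optimality)
qed

end
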